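(* Fix $1<p<\infty$. Given a matrix weight $W\in\mathcal{A}_p$ on $\mathbb{R}^n$ (with values in $d\times d$ matrices), there exist matrix weights $W_0$ and $W_1$ such that: (i) $W_0\in\mathcal{A}_1$ with $[W_0]_{\mathcal{A}_1}\lesssim[W]_{\mathcal{A}_p}^{p}$; (ii) $W_1\in\mathcal{A}_\infty$ with $[W_1]_{\mathcal{A}_\infty}\lesssim[W]_{\mathcal{A}_p}^{p'}$; (iii) $W_0=rW$ and $W_1=sW$ for some measurable scalar functions $r,s$, and $$W=W_0^{1/p}\,W_1^{1/p'}.$$
   Context: A matrix weight is a measurable map $W:\mathbb{R}^n\to\mathcal{S}_d$ that is positive definite a.e., where $\mathcal{S}_d$ is the set of $d\times d$ real symmetric positive semidefinite matrices; powers are taken pointwise and identities hold a.e. $A\lesssim B$ means $A\le cB$ with a constant $c>0$ independent of $W$. Cubes $Q$ have sides parallel to the axes; $|\cdot|_{\mathrm{op}}$ is the operator norm; $1/p+1/p'=1$. For $1<p<\infty$, $W\in\mathcal{A}_p$ means $$[W]_{\mathcal{A}_p}=\sup_Q\Big(\frac{1}{|Q|}\int_Q\Big(\frac{1}{|Q|}\int_Q|W(x)W^{-1}(y)|_{\mathrm{op}}^{p'}\,dy\Big)^{p/p'}dx\Big)^{1/p}<\infty .$$ $W\in\mathcal{A}_1$ means $[W]_{\mathcal{A}_1}=\sup_Q\operatorname{ess\,sup}_{x\in Q}\frac{1}{|Q|}\int_Q|W^{-1}(x)W(y)|_{\mathrm{op}}\,dy<\infty$, and $W\in\mathcal{A}_\infty$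 means $[W]_{\mathcal{A}_\infty}=\sup_Q\operatorname{ess\,sup}_{x\in Q}\frac{1}{|Q|}\int_Q|W(x)W^{-1}(y)|_{\mathrm{op}}\,dy<\infty$. *)

theory Defs
  imports "HOL-Analysis.Analysis" "HOL-Probability.Essential_Supremum"
begin

definition pos_semidef :: "real^'d^'d \<Rightarrow> bool" where
  "pos_semidef A \<longleftrightarrow> transpose A = A \<and> (\<forall>v. 0 \<le> v \<bullet> (A *v v))"

definition pos_def :: "real^'d^'d \<Rightarrow> bool" where
  "pos_def A \<longleftrightarrow> transpose A = A \<and> (\<forall>v. v \<noteq> 0 \<longrightarrow> 0 < v \<bullet> (A *v v))"

definition diag_matrix :: "real^'d \<Rightarrow> real^'d^'d" where
  "diag_matrix v = (\<chi> i j. if i = j then v $ i else 0)"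

text \<open>Functional calculus: apply \<open>\<lambda>t. t powr s\<close> to the eigenvalues in any orthogonal
  diagonalization. The result does not depend on the diagonalization. It is meant for positive
  semidefinite matrices and \<open>s > 0\<close>, where \<open>0 powr s = 0\<close> is the correct convention.\<close>

definition matrix_powr :: "real^'d^'d \<Rightarrow> real \<Rightarrow> real^'d^'d" where
  "matrix_powr A s = (THE B. \<exists>U v. orthogonal_matrix U
     \<and> A = U ** diag_matrix v ** transpose U
     \<and> B = U ** diag_matrix (\<chi> i. v $ i powr s) ** transpose U)"

text \<open>The operator norm with respect to the Euclidean norm; \<open>norm\<close> on \<open>real^'d^'d\<close> would be
  the Frobenius norm.\<close>

definition op_norm :: "real^'d^'d \<Rightarrow> real" where
  "op_norm A = onorm ((*v) A)"

definition matrix_weight :: "(real^'n \<Rightarrow> real^'d^'d) \<Rightarrow> bool" where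
  "matrix_weight W \<longleftrightarrow> W \<in> borel_measurable lebesgue
     \<and> (\<forall>x. pos_semidef (W x)) \<and> (AE x in lebesgue. pos_def (W x))"

definition cubes :: "(real^'n) set set" where
  "cubes = {cbox a (\<chi> i. a $ i + l) | a l. 0 < l}"

definition average :: "(real^'n) set \<Rightarrow> (real^'n \<Rightarrow> ennreal) \<Rightarrow> ennreal" where
  "average Q f = (\<integral>\<^sup>+x\<in>Q. f x \<partial>lebesgue) / emeasure lebesgue Q"

definition conj_exponent :: "real \<Rightarrow> real" where
  "conj_exponent p = p / (p - 1)"

lemma conj_exponent: "1 < p \<Longrightarrow> 1 / p + 1 / conj_exponent p = 1"
  by (simp add: conj_exponent_def field_simps)

text \<open>Powers of extended nonnegative numbers, intended for exponents \<open>s > 0\<close>.\<close>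

definition ennreal_powr :: "ennreal \<Rightarrow> real \<Rightarrow> ennreal" where
  "ennreal_powr a s = (if a = \<infinity> then \<infinity> else ennreal (enn2real a powr s))"

text \<open>\<open>matrix_inv\<close> is unspecified at singular matrices; for a matrix weight these values only
  occur on a null set and so affect neither the integrals nor the essential suprema below.\<close>

definition Ap_const :: "real \<Rightarrow> (real^'n \<Rightarrow> real^'d^'d) \<Rightarrow> ennreal" where
  "Ap_const p W = (SUP Q\<in>cubes.
     ennreal_powr
       (average Q (\<lambda>x. ennreal_powr
          (average Q (\<lambda>y. ennreal (op_norm (W x ** matrix_inv (W y)) powr conj_exponent p)))
          (p / conj_exponent p)))
       (1 / p))"

definition A1_const :: "(real^'n \<Rightarrow> real^'d^'d) \<Rightarrow> ennreal" where
  "A1_const W = (SUP Q\<in>cubes. esssup (lebesgue_on Q)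
     (\<lambda>x. average Q (\<lambda>y. ennreal (op_norm (matrix_inv (W x) ** W y)))))"

definition Ainf_const :: "(real^'n \<Rightarrow> real^'d^'d) \<Rightarrow> ennreal" where
  "Ainf_const W = (SUP Q\<in>cubes. esssup (lebesgue_on Q)
     (\<lambda>x. average Q (\<lambda>y. ennreal (op_norm (W x ** matrix_inv (W y))))))"

definition Ap_class :: "real \<Rightarrow> (real^'n \<Rightarrow> real^'d^'d) set" where
  "Ap_class p = {W. matrix_weight W \<and> Ap_const p W < \<infinity>}"

definition A1_class :: "(real^'n \<Rightarrow> real^'d^'d) set" where
  "A1_class = {W. matrix_weight W \<and> A1_const W < \<infinity>}"

definition Ainf_class :: "(real^'n \<Rightarrow> real^'d^'d) set" where
  "Ainf_class = {W. matrix_weight W \<and> Ainf_const W < \<infinity>}"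

end

theory Submission
  imports Defs
begin

text \<open>Write \<open>T2 f x\<close> and \<open>T1 f x\<close> for the suprema over cubes \<open>Q\<close> containing \<open>x\<close> of the averages over
  \<open>y \<in> Q\<close> of \<open>|W(x) W(y)\<^sup>-\<^sup>1| f(y)\<close> and \<open>|W(x)\<^sup>-\<^sup>1 W(y)| f(y)\<close>. With \<open>r = F powr (1/p')\<close> and \<open>s = F powr (-1/p)\<close>
  the factorization holds, and the two conditions on \<open>r W\<close> and \<open>s W\<close> say that \<open>T1 r \<le> C r\<close> and
  \<open>T2 (1/s) \<le> C (1/s)\<close>. The iteration of Rubio de Francia yields such an \<open>F\<close> once \<open>T2\<close> is bounded on
  \<open>L\<^sup>p\<close> with norm of order \<open>[W] powr p'\<close>, and \<open>T1\<close> on the dual space with norm of order \<open>[W] powr p\<close>.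

  For the sharp bound, dual bases \<open>u\<close>, \<open>v\<close> adapted to a cube \<open>R\<close> bound the kernel on \<open>R\<close> by a product
  \<open>\<alpha>(x) \<sigma>(y) powr (1/p')\<close>, where \<open>\<sigma>\<close> has a quantitative \<open>A\<^sub>\<infinity>\<close> property: a subset of at most half the
  volume of a cube carries at most the fraction \<open>1 - \<delta>\<close> of its \<open>\<sigma>\<close>-mass, with \<open>\<delta>\<close> of order
  \<open>[W] powr -p'\<close>. Stopping cubes are the maximal ones on which the average of \<open>\<sigma> powr (1/p') f\<close> has
  quadrupled. The \<open>\<sigma>\<close>-mass decays like \<open>(1 - \<delta>)\<^sup>k\<close> over \<open>k\<close> generations, and distributing this decay in
  Hoelder's inequality costs only one factor \<open>1/\<delta>\<close> in the \<open>p\<close>-th power of the norm; neither a reverse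
  Hoelder inequality nor the Hardy-Littlewood maximal theorem is needed.\<close>

subsection \<open>Powers of extended nonnegative reals and Hoelder's inequality\<close>

text \<open>The obstacle is that the factorization of the kernel depends on the cube: \<alpha> and
  \<sigma> change from one stopping set to the next, so no single measure governs the whole tree of
  stopping sets. The generations are therefore counted by one function whose mass bound holds for
  every weight with the A_infinity property at once, although different weights select the stopping
  sets at different places.

  The exponents come from one computation. Let K have the order of [W]. Hoelder's inequality with
  \<sigma>-averages of order K^(p') contributes K^(p'(p-1)) = K^p, and the decay contributes
  1/\<delta> of order K^(p'). So the p-th power of the norm of \<open>T2\<close> has order K^(p+p'),
  and the norm has order K^((p+p')/p) = K^(p'). The argument is symmetric in W and its inverse, so
  \<open>T1\<close> has on L^(p') a norm of order K^((p+p')/p') = K^p.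

  A single \<open>F\<close> has to serve both operators, because the scalars \<open>r\<close> and
  \<open>s\<close> must cancel in the product of the two powers.\<close>

abbreviation vol :: "'a::euclidean_space set \<Rightarrow> ennreal" where
  "vol \<equiv> emeasure lebesgue"

lemma ennreal_powr_ennreal [simp]: "0 \<le> x \<Longrightarrow> ennreal_powr (ennreal x) s = ennreal (x powr s)"
  by (simp add: ennreal_powr_def)

lemma ennreal_powr_simps [simp]:
  "ennreal_powr 0 s = 0" "ennreal_powr 1 s = 1" "ennreal_powr top s = top" "ennreal_powr \<infinity> s = \<infinity>"
  by (simp_all add: ennreal_powr_def)

lemma ennreal_powr_mono: "a \<le> b \<Longrightarrow> 0 \<le> s \<Longrightarrow> ennreal_powr a s \<le> ennreal_powr b s"
  by (cases a; cases b) (auto intro!: ennreal_leI powr_mono2 simp: top_unique)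

lemma ennreal_powr_mult: "0 < s \<Longrightarrow> ennreal_powr (a * b) s = ennreal_powr a s * ennreal_powr b s"
proof (cases a; cases b)
  fix x y assume "a = ennreal x" "0 \<le> x" "b = ennreal y" "0 \<le> y" "0 < s"
  then show ?thesis by (simp flip: ennreal_mult' add: powr_mult)
next
  fix x assume "a = ennreal x" "0 \<le> x" "b = top" "0 < s"
  then show ?thesis by (cases "x = 0") (simp_all add: ennreal_mult_top powr_gt_zero)
next
  fix y assume "a = top" "b = ennreal y" "0 \<le> y" "0 < s"
  then show ?thesis by (cases "y = 0") (simp_all add: ennreal_top_mult powr_gt_zero)
qed auto

lemma ennreal_powr_powr: "ennreal_powr (ennreal_powr a s) t = ennreal_powr a (s * t)"
  by (cases a) (simp_all add: powr_powr)

lemma ennreal_powr_one [simp]: "ennreal_powr a 1 = a"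
  by (cases a) simp_all

lemma ennreal_powr_max: "0 \<le> s \<Longrightarrow> ennreal_powr (max a b) s = max (ennreal_powr a s) (ennreal_powr b s)"
  using ennreal_powr_mono[of a b s] ennreal_powr_mono[of b a s]
  by (cases a b rule: linorder_le_cases) (simp_all add: max_absorb1 max_absorb2)

lemma ennreal_powr_eq_0_iff: "0 < s \<Longrightarrow> ennreal_powr a s = 0 \<longleftrightarrow> a = 0"
  by (cases a) (auto simp: ennreal_eq_0_iff)

lemma ennreal_powr_eq_top_iff: "ennreal_powr a s = top \<longleftrightarrow> a = top"
  by (cases a) auto

lemma ennreal_powr_less_top_iff: "ennreal_powr a s < top \<longleftrightarrow> a < top"
  by (simp add: ennreal_powr_eq_top_iff flip: less_top)

lemma ennreal_powr_measurable [measurable (raw)]: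
  "f \<in> borel_measurable M \<Longrightarrow> (\<lambda>x. ennreal_powr (f x) s) \<in> borel_measurable M"
  by (rule measurable_compose[of f M borel "\<lambda>a. ennreal_powr a s"]) (auto simp: ennreal_powr_def)

text \<open>The sum is at most \<open>card A\<close> times its largest term. This gives one constant
  for all \<open>s > 0\<close>, with no distinction between exponents below and above 1.\<close>

lemma ennreal_powr_sum_le:
  assumes "finite A" "A \<noteq> {}" "0 < s"
  shows "ennreal_powr (\<Sum>i\<in>A. f i) s \<le> ennreal_powr (of_nat (card A)) s * (\<Sum>i\<in>A. ennreal_powr (f i) s)"
proof -
  obtain m where m: "m \<in> A" "\<And>i. i \<in> A \<Longrightarrow> f i \<le> f m"
    using assms finite_has_maximal[of "f ` A"] by (metis (no_types, lifting) image_iff image_is_empty finite_imageI linorder_le_cases)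
  have "(\<Sum>i\<in>A. f i) \<le> of_nat (card A) * f m" using m by (intro sum_bounded_above) auto
  then have "ennreal_powr (\<Sum>i\<in>A. f i) s \<le> ennreal_powr (of_nat (card A)) s * ennreal_powr (f m) s"
    using assms by (metis ennreal_powr_mono ennreal_powr_mult less_imp_le)
  also have "\<dots> \<le> ennreal_powr (of_nat (card A)) s * (\<Sum>i\<in>A. ennreal_powr (f i) s)"
    using m assms by (intro mult_left_mono member_le_sum) auto
  finally show ?thesis .
qed

lemma conj_exponent_gt_1: "1 < p \<Longrightarrow> 1 < conj_exponent p"
  by (simp add: conj_exponent_def field_simps)

lemma conj_exponent_conj_exponent: "1 < p \<Longrightarrow> conj_exponent (conj_exponent p) = p"
  by (simp add: conj_exponent_def field_simps)

lemma ennreal_Young: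
  fixes a b :: ennreal
  assumes p: "1 < p"
  shows "a * b \<le> ennreal (1/p) * ennreal_powr a p
       + ennreal (1 / conj_exponent p) * ennreal_powr b (conj_exponent p)"
proof -
  note q = conj_exponent_gt_1[OF p] conj_exponent[OF p]
  show ?thesis
  proof (cases a; cases b)
    fix x y assume "a = ennreal x" "0 \<le> x" "b = ennreal y" "0 \<le> y"
    then show ?thesis
      using Youngs_inequality[of p "conj_exponent p" x y] p q
      by (simp flip: ennreal_mult' ennreal_plus add: ennreal_leI)
  qed (use p q in \<open>auto simp: ennreal_mult_top\<close>)
qed

lemma nn_integral_Holder:
  assumes p: "1 < p" and [measurable]: "f \<in> borel_measurable M" "g \<in> borel_measurable M"
  shows "(\<integral>\<^sup>+x. f x * g x \<partial>M) \<le> ennreal_powr (\<integral>\<^sup>+x. ennreal_powr (f x) p \<partial>M) (1/p)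
     * ennreal_powr (\<integral>\<^sup>+x. ennreal_powr (g x) (conj_exponent p) \<partial>M) (1 / conj_exponent p)"
proof -
  let ?q = "conj_exponent p"
  have q: "1 < ?q" using p by (rule conj_exponent_gt_1)
  let ?F = "\<integral>\<^sup>+x. ennreal_powr (f x) p \<partial>M" and ?G = "\<integral>\<^sup>+x. ennreal_powr (g x) ?q \<partial>M"
  consider "?F = 0 \<or> ?G = 0" | "?F \<noteq> 0" "?G \<noteq> 0" "?F = \<infinity> \<or> ?G = \<infinity>"
    | F G where "?F = ennreal F" "0 < F" "?G = ennreal G" "0 < G"
    by (cases ?F; cases ?G) (auto simp: less_le)
  then show ?thesis
  proof cases
    case 1
    then have "AE x in M. f x * g x = 0"
    proof
      assume "?F = 0"
      then have "AE x in M. f x = 0" using p by (simp add: nn_integral_0_iff_AE ennreal_powr_eq_0_iff)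
      then show ?thesis by eventually_elim simp
    next
      assume "?G = 0"
      then have "AE x in M. g x = 0" using q by (simp add: nn_integral_0_iff_AE ennreal_powr_eq_0_iff)
      then show ?thesis by eventually_elim simp
    qed
    then show ?thesis by (subst nn_integral_0_iff_AE[THEN iffD2]) auto
  next
    \<comment> \<open>Neither factor on the right is zero and one is infinite, so their product is
      infinite.\<close>
    case 2
    then show ?thesis using p q
      by (auto simp: ennreal_top_mult ennreal_mult_top ennreal_powr_eq_0_iff)
  next
    case (3 F G)
    \<comment> \<open>Dividing by the norms \<open>s\<close> and \<open>t\<close> makes both power
      integrals equal to 1; Young's inequality then integrates to 1/p + 1/q = 1.\<close>
    define s t where "s = F powr (1/p)" and "t = G powr (1/?q)"
    have st: "0 < s" "0 < t" using 3 by (simp_all add: s_def t_def)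
    have sp: "s powr p = F" "t powr ?q = G" using 3 p q by (simp_all add: s_def t_def powr_powr)
    let ?J = "\<integral>\<^sup>+x. (ennreal (1/s) * f x) * (ennreal (1/t) * g x) \<partial>M"
    have "?J \<le>
       (\<integral>\<^sup>+x. ennreal (1/p) * ennreal_powr (ennreal (1/s) * f x) p
           + ennreal (1/?q) * ennreal_powr (ennreal (1/t) * g x) ?q \<partial>M)"
      by (intro nn_integral_mono ennreal_Young p)
    also have "\<dots> = (\<integral>\<^sup>+x. ennreal (1/p) * (ennreal (1/F) * ennreal_powr (f x) p)
           + ennreal (1/?q) * (ennreal (1/G) * ennreal_powr (g x) ?q) \<partial>M)"
      using p q st sp by (simp add: ennreal_powr_mult powr_divide)
    also have "\<dots> = ennreal (1/p) * (ennreal (1/F) * ?F) + ennreal (1/?q) * (ennreal (1/G) * ?G)"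
      by (simp add: nn_integral_add nn_integral_cmult)
    also have "\<dots> = ennreal (1/p + 1/?q)"
      using 3 p q by (simp flip: ennreal_mult' ennreal_plus)
    also have "\<dots> = 1" using conj_exponent[OF p] by simp
    finally have *: "?J \<le> 1" .
    have "(\<integral>\<^sup>+x. f x * g x \<partial>M) = (\<integral>\<^sup>+x. ennreal (s * t) * ((ennreal (1/s) * f x) * (ennreal (1/t) * g x)) \<partial>M)"
    proof (intro nn_integral_cong)
      fix x
      have "ennreal (s * t) * ((ennreal (1/s) * f x) * (ennreal (1/t) * g x))
         = (ennreal (s*t) * ennreal (1/s) * ennreal (1/t)) * (f x * g x)"
        by (simp add: ac_simps)
      also have "ennreal (s*t) * ennreal (1/s) * ennreal (1/t) = 1"
        using st by (simp flip: ennreal_mult')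
      finally show "f x * g x = ennreal (s * t) * ((ennreal (1/s) * f x) * (ennreal (1/t) * g x))" by simp
    qed
    also have "\<dots> = ennreal (s * t) * ?J"
      by (simp add: nn_integral_cmult)
    also have "\<dots> \<le> ennreal (s * t) * 1" by (intro mult_left_mono *) simp
    also have "\<dots> = ennreal_powr ?F (1/p) * ennreal_powr ?G (1/?q)"
      using 3 by (simp add: s_def t_def ennreal_mult)
    finally show ?thesis .
  qed
qed

lemma nn_set_integral_mono:
  assumes "\<And>x. x \<in> A \<Longrightarrow> f x \<le> g x"
  shows "(\<integral>\<^sup>+x\<in>A. f x \<partial>M) \<le> (\<integral>\<^sup>+x\<in>A. g x \<partial>M)"
  using assms by (intro nn_integral_mono) (auto simp: indicator_def)

lemma nn_set_integral_cong':
  assumes "\<And>x. x \<in> A \<Longrightarrow> f x = g x"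
  shows "(\<integral>\<^sup>+x\<in>A. f x \<partial>M) = (\<integral>\<^sup>+x\<in>A. g x \<partial>M)"
  using assms by (intro nn_integral_cong) (auto simp: indicator_def)

lemma nn_set_integral_cmult:
  assumes "A \<in> sets M" "f \<in> borel_measurable M"
  shows "(\<integral>\<^sup>+x\<in>A. c * f x \<partial>M) = c * (\<integral>\<^sup>+x\<in>A. f x \<partial>M)"
  using assms unfolding mult.assoc by (intro nn_integral_cmult) auto

lemma nn_set_integral_sum:
  assumes "A \<in> sets M" "\<And>i. i \<in> I \<Longrightarrow> f i \<in> borel_measurable M"
  shows "(\<integral>\<^sup>+x\<in>A. (\<Sum>i\<in>I. f i x) \<partial>M) = (\<Sum>i\<in>I. \<integral>\<^sup>+x\<in>A. f i x \<partial>M)"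
  using assms unfolding sum_distrib_right by (intro nn_integral_sum) auto

lemma nn_set_integral_Holder:
  assumes p: "1 < p" and A: "A \<in> sets M" and f: "f \<in> borel_measurable M" and g: "g \<in> borel_measurable M"
  shows "(\<integral>\<^sup>+x\<in>A. f x * g x \<partial>M) \<le> ennreal_powr (\<integral>\<^sup>+x\<in>A. ennreal_powr (f x) p \<partial>M) (1/p)
     * ennreal_powr (\<integral>\<^sup>+x\<in>A. ennreal_powr (g x) (conj_exponent p) \<partial>M) (1 / conj_exponent p)"
proof -
  have ind: "ennreal_powr (h * indicator A x) s = ennreal_powr h s * indicator A x" for h x s
    by (simp add: indicator_def)
  have "(\<integral>\<^sup>+x\<in>A. f x * g x \<partial>M) = (\<integral>\<^sup>+x. (f x * indicator A x) * (g x * indicator A x) \<partial>M)"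
    by (intro nn_integral_cong) (simp add: indicator_def)
  then show ?thesis
    using nn_integral_Holder[OF p, of "\<lambda>x. f x * indicator A x" M "\<lambda>x. g x * indicator A x"] A f g
    by (simp add: ind)
qed

subsection \<open>A stopping time bound for laminar families\<close>

abbreviation (input) nondegenerate :: "(real^'n) set \<Rightarrow> bool" where
  "nondegenerate Q \<equiv> Q \<in> sets lebesgue \<and> 0 < vol Q \<and> vol Q < \<infinity>"

definition laminar :: "'a set set \<Rightarrow> bool" where
  "laminar D \<longleftrightarrow> (\<forall>Q\<in>D. \<forall>R\<in>D. Q \<subseteq> R \<or> R \<subseteq> Q \<or> Q \<inter> R = {})"

text \<open>The set \<open>E\<close> is an arbitrary measurable subset and not a member of
  \<open>D\<close>, since it will be a union of stopping sets.\<close>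

definition halving_weight :: "(real^'n) set set \<Rightarrow> real \<Rightarrow> (real^'n \<Rightarrow> ennreal) \<Rightarrow> bool" where
  "halving_weight D \<delta> \<sigma> \<longleftrightarrow> \<sigma> \<in> borel_measurable lebesgue \<and>
     (\<forall>Q\<in>D. \<forall>E\<in>sets lebesgue. E \<subseteq> Q \<longrightarrow> 2 * vol E \<le> vol Q \<longrightarrow>
        (\<integral>\<^sup>+x\<in>E. \<sigma> x \<partial>lebesgue) \<le> ennreal (1 - \<delta>) * (\<integral>\<^sup>+x\<in>Q. \<sigma> x \<partial>lebesgue))"

definition maximal_sets :: "'a set set \<Rightarrow> 'a set set" where
  "maximal_sets F = {Q\<in>F. \<forall>R\<in>F. Q \<subseteq> R \<longrightarrow> R = Q}"

lemma maximal_sets_subset: "maximal_sets F \<subseteq> F"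
  by (auto simp: maximal_sets_def)

lemma exists_maximal_superset:
  assumes "finite F" "Q \<in> F"
  shows "\<exists>P\<in>maximal_sets F. Q \<subseteq> P"
proof -
  obtain P where "P \<in> F" "Q \<subseteq> P" "\<forall>R\<in>F. P \<subseteq> R \<longrightarrow> P = R"
    using finite_has_maximal2[OF assms] by auto
  then have "P \<in> maximal_sets F" by (simp add: maximal_sets_def eq_commute)
  with \<open>Q \<subseteq> P\<close> show ?thesis ..
qed

lemma disjoint_maximal_sets:
  assumes "laminar F" shows "disjoint (maximal_sets F)"
proof (rule disjointI)
  fix P Q assume "P \<in> maximal_sets F" "Q \<in> maximal_sets F" "P \<noteq> Q"
  then have "P \<in> F" "Q \<in> F" "\<not> P \<subseteq> Q" "\<not> Q \<subseteq> P" by (auto simp: maximal_sets_def)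
  then show "P \<inter> Q = {}" using assms by (auto simp: laminar_def)
qed

text \<open>Functions defined piecewise on a disjoint family are written as such sums, which makes
  their measurability and integrals immediate; this reads off the value on one piece.\<close>

lemma disjoint_sum_indicator:
  fixes h :: "'a set \<Rightarrow> 'a \<Rightarrow> 'b::semiring_1"
  assumes "finite C" "disjoint C" "P \<in> C" "x \<in> P"
  shows "(\<Sum>P\<in>C. h P x * indicator P x) = h P x"
proof -
  have "(\<Sum>P\<in>C. h P x * indicator P x) = (\<Sum>P'\<in>C. if P' = P then h P x else 0)"
    using assms by (intro sum.cong) (auto simp: disjoint_def indicator_def)
  then show ?thesis using assms by simp
qed

lemma nn_set_integral_disjoint_Union:
  assumes "finite C" "disjoint C" "\<And>P. P \<in> C \<Longrightarrow> P \<in> sets M" "f \<in> borel_measurable M"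
  shows "(\<integral>\<^sup>+x\<in>\<Union>C. f x \<partial>M) = (\<Sum>P\<in>C. \<integral>\<^sup>+x\<in>P. f x \<partial>M)"
proof -
  have "(\<integral>\<^sup>+x\<in>\<Union>C. f x \<partial>M) = (\<integral>\<^sup>+x. (\<Sum>P\<in>C. f x * indicator P x) \<partial>M)"
  proof (intro nn_integral_cong)
    fix x
    show "f x * indicator (\<Union>C) x = (\<Sum>P\<in>C. f x * indicator P x)"
    proof (cases "x \<in> \<Union>C")
      case True
      then obtain P where "P \<in> C" "x \<in> P" by blast
      then show ?thesis using disjoint_sum_indicator[OF assms(1,2), of P x "\<lambda>_. f"] True by simp
    next
      case False
      then have "\<And>P. P \<in> C \<Longrightarrow> x \<notin> P" by auto
      then show ?thesis using False by simp
    qed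
  qed
  also have "\<dots> = (\<Sum>P\<in>C. \<integral>\<^sup>+x\<in>P. f x \<partial>M)"
    using assms by (subst nn_integral_sum) auto
  finally show ?thesis .
qed

lemma nn_set_integral_Diff:
  assumes "U \<in> sets M" "R \<in> sets M" "U \<subseteq> R" "f \<in> borel_measurable M"
  shows "(\<integral>\<^sup>+x\<in>R. f x \<partial>M) = (\<integral>\<^sup>+x\<in>R - U. f x \<partial>M) + (\<integral>\<^sup>+x\<in>U. f x \<partial>M)"
proof -
  have "(\<integral>\<^sup>+x\<in>R. f x \<partial>M) = (\<integral>\<^sup>+x. f x * indicator (R - U) x + f x * indicator U x \<partial>M)"
    using assms(3) by (intro nn_integral_cong) (auto simp: indicator_def)
  then show ?thesis using assms by (simp add: nn_integral_add)
qed

text \<open>With \<open>t\<close> the total \<open>\<sigma>\<close>-mass of the stopping sets, \<open>2\<lambda>t = t + (1 + \<delta>)t\<close> and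
  \<open>(1 + \<delta>)(1 - \<delta>) \<le> 1\<close>: this is why the factor \<open>\<lambda> = 1 + \<delta>/2\<close> per generation is admissible.\<close>

lemma generation_weight_step:
  assumes \<delta>: "0 < \<delta>" "\<delta> \<le> 1" and \<sigma>: "halving_weight D \<delta> \<sigma>" and R: "R \<in> D" "R \<in> sets lebesgue"
    and C: "finite C" "disjoint C" "\<And>P. P \<in> C \<Longrightarrow> P \<in> sets lebesgue \<and> P \<subseteq> R"
    and small: "2 * vol (\<Union>C) \<le> vol R"
    and l: "\<And>P. P \<in> C \<Longrightarrow> (\<integral>\<^sup>+x\<in>P. ennreal (l P x) * \<sigma> x \<partial>lebesgue) \<le> 2 * (\<integral>\<^sup>+x\<in>P. \<sigma> x \<partial>lebesgue)"
    and lm: "\<And>P. P \<in> C \<Longrightarrow> l P \<in> borel_measurable lebesgue" "\<And>P x. P \<in> C \<Longrightarrow> 1 \<le> l P x"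
    and l': "l' \<in> borel_measurable lebesgue"
      "\<And>P x. P \<in> C \<Longrightarrow> x \<in> P \<Longrightarrow> l' x = (1 + \<delta> / 2) * l P x" "\<And>x. x \<notin> \<Union>C \<Longrightarrow> l' x = 1"
  shows "(\<integral>\<^sup>+x\<in>R. ennreal (l' x) * \<sigma> x \<partial>lebesgue) \<le> 2 * (\<integral>\<^sup>+x\<in>R. \<sigma> x \<partial>lebesgue)"
proof -
  let ?U = "\<Union>C"
  have [measurable]: "\<sigma> \<in> borel_measurable lebesgue" using \<sigma> by (simp add: halving_weight_def)
  note [measurable] = l'(1)
  have U: "?U \<in> sets lebesgue" "?U \<subseteq> R" using C by auto
  let ?n = "\<lambda>A. \<integral>\<^sup>+x\<in>A. ennreal (l' x) * \<sigma> x \<partial>lebesgue" and ?m = "\<lambda>A. \<integral>\<^sup>+x\<in>A. \<sigma> x \<partial>lebesgue"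
  have "?n ?U = (\<Sum>P\<in>C. ?n P)"
    using C by (intro nn_set_integral_disjoint_Union) auto
  also have "\<dots> = (\<Sum>P\<in>C. \<integral>\<^sup>+x\<in>P. ennreal (1 + \<delta> / 2) * (ennreal (l P x) * \<sigma> x) \<partial>lebesgue)"
    using \<delta> lm by (intro sum.cong refl nn_set_integral_cong') (auto simp: l' ennreal_mult' mult.assoc)
  also have "\<dots> = (\<Sum>P\<in>C. ennreal (1 + \<delta> / 2) * (\<integral>\<^sup>+x\<in>P. ennreal (l P x) * \<sigma> x \<partial>lebesgue))"
  proof (intro sum.cong refl)
    fix P assume "P \<in> C"
    then have [measurable]: "P \<in> sets lebesgue" "l P \<in> borel_measurable lebesgue" using C lm by auto
    show "(\<integral>\<^sup>+x\<in>P. ennreal (1 + \<delta> / 2) * (ennreal (l P x) * \<sigma> x) \<partial>lebesgue)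
      = ennreal (1 + \<delta> / 2) * (\<integral>\<^sup>+x\<in>P. ennreal (l P x) * \<sigma> x \<partial>lebesgue)"
      by (simp add: nn_integral_cmult mult.assoc)
  qed
  also have "\<dots> \<le> (\<Sum>P\<in>C. ennreal (1 + \<delta> / 2) * (2 * ?m P))"
    by (intro sum_mono mult_left_mono l) auto
  also have "\<dots> = ennreal (1 + \<delta> / 2) * 2 * ?m ?U"
    using C by (subst nn_set_integral_disjoint_Union) (auto simp: sum_distrib_left mult.assoc)
  also have "ennreal (1 + \<delta> / 2) * 2 = 1 + ennreal (1 + \<delta>)"
    using ennreal_mult'[of 2 "1 + \<delta> / 2"] ennreal_plus[of 1 "1 + \<delta>"] \<delta>
    by (simp add: mult.commute distrib_left)
  finally have 1: "?n ?U
     \<le> (1 + ennreal (1 + \<delta>)) * ?m ?U" .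
  have 2: "?n (R - ?U) = ?m (R - ?U)"
    by (intro nn_set_integral_cong') (auto simp: l'(3))
  have 3: "?m ?U \<le> ennreal (1 - \<delta>) * ?m R"
    using \<sigma> R U small by (auto simp: halving_weight_def)
  have "?n R =
      ?n (R - ?U) + ?n ?U"
    using U R by (intro nn_set_integral_Diff) auto
  also have "\<dots> \<le> ?m (R - ?U) + (1 + ennreal (1 + \<delta>)) * ?m ?U"
    unfolding 2 by (intro add_mono 1) simp
  \<comment> \<open>One copy of the mass of \<open>?U\<close> completes that of
    \<open>R - ?U\<close> to the mass of \<open>R\<close>; only the remaining multiple is estimated
    by the halving property.\<close>
  also have "\<dots> = ?m R + ennreal (1 + \<delta>) * ?m ?U"
    using U R by (subst nn_set_integral_Diff[of ?U _ R]) (auto simp: distrib_right add.assoc)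
  also have "\<dots> \<le> ?m R + ennreal (1 + \<delta>) * (ennreal (1 - \<delta>) * ?m R)"
    by (intro add_mono mult_left_mono 3) auto
  also have "\<dots> \<le> ?m R + 1 * ?m R"
  proof -
    have "ennreal (1 + \<delta>) * ennreal (1 - \<delta>) \<le> 1"
      using \<delta> ennreal_mult'[of "1 + \<delta>" "1 - \<delta>"] ennreal_leI[of "(1 + \<delta>) * (1 - \<delta>)" 1]
      by (simp add: algebra_simps)
    then show ?thesis unfolding mult.assoc[symmetric] by (intro add_mono mult_right_mono) auto
  qed
  finally show ?thesis by (simp add: mult_2)
qed

text \<open>The product of \<open>l powr -(1/q)\<close> and \<open>l powr (1/q)\<close> is inserted
  before Hoelder's inequality. On the side of \<sigma> this at most doubles the mass, by the
  assumption on \<open>l\<close>; on the side of \<open>f\<close> it produces the factor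
  \<open>l powr -(p - 1)\<close>, whose decay over the generations is a geometric series. The left
  side is the p-th power of the stopping threshold on \<open>R\<close>, integrated over
  \<open>R\<close>.\<close>

lemma generation_Holder:
  assumes p: "1 < p" and L: "0 \<le> L" and R: "R \<in> sets lebesgue" "0 < vol R" "vol R < \<infinity>"
    and [measurable]: "\<sigma> \<in> borel_measurable lebesgue" "l \<in> borel_measurable lebesgue" "f \<in> borel_measurable lebesgue"
    and l1: "\<And>x. 1 \<le> l x"
    and l: "(\<integral>\<^sup>+x\<in>R. ennreal (l x) * \<sigma> x \<partial>lebesgue) \<le> 2 * (\<integral>\<^sup>+x\<in>R. \<sigma> x \<partial>lebesgue)"
    and \<sigma>: "(\<integral>\<^sup>+x\<in>R. \<sigma> x \<partial>lebesgue) \<le> ennreal L * vol R"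
  shows "ennreal_powr (4 * average R (\<lambda>y. ennreal_powr (\<sigma> y) (1 / conj_exponent p) * f y)) p * vol R
    \<le> ennreal (4 powr p * (2 * L) powr (p - 1)) *
        (\<integral>\<^sup>+x\<in>R. ennreal (l x powr - (p - 1)) * ennreal_powr (f x) p \<partial>lebesgue)"
proof -
  define q where "q = conj_exponent p"
  have q: "1 < q" and pq: "p / q = p - 1" using p conj_exponent_gt_1[OF p] by (auto simp: q_def conj_exponent_def)
  define m where "m = measure lebesgue R"
  have m: "vol R = ennreal m"
    unfolding m_def by (rule emeasure_eq_ennreal_measure) (use R in auto)
  have "0 < m" using R(2) unfolding m by simp
  note m = m this
  define J where "J = (\<integral>\<^sup>+x\<in>R. ennreal (l x powr - (p - 1)) * ennreal_powr (f x) p \<partial>lebesgue)"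
  define I where "I = (\<integral>\<^sup>+x\<in>R. ennreal_powr (\<sigma> x) (1/q) * f x \<partial>lebesgue)"
  have l0: "0 < l x" for x using l1[of x] by linarith
  note [measurable] = R(1)
  have "I = (\<integral>\<^sup>+x\<in>R. (ennreal (l x powr - (1/q)) * f x) * (ennreal (l x powr (1/q)) * ennreal_powr (\<sigma> x) (1/q)) \<partial>lebesgue)"
    unfolding I_def
  proof (rule nn_set_integral_cong')
    fix x
    have "ennreal (l x powr - (1/q)) * ennreal (l x powr (1/q)) = 1"
      using l0[of x] by (simp flip: ennreal_mult' powr_add)
    then have "ennreal_powr (\<sigma> x) (1/q) * f x = (ennreal (l x powr - (1/q)) * ennreal (l x powr (1/q))) * (ennreal_powr (\<sigma> x) (1/q) * f x)"
      by simp
    then show "ennreal_powr (\<sigma> x) (1/q) * f x = (ennreal (l x powr - (1/q)) * f x) * (ennreal (l x powr (1/q)) * ennreal_powr (\<sigma> x) (1/q))"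
      by (simp add: ac_simps)
  qed
  also have "\<dots> \<le> ennreal_powr (\<integral>\<^sup>+x\<in>R. ennreal_powr (ennreal (l x powr - (1/q)) * f x) p \<partial>lebesgue) (1/p)
     * ennreal_powr (\<integral>\<^sup>+x\<in>R. ennreal_powr (ennreal (l x powr (1/q)) * ennreal_powr (\<sigma> x) (1/q)) q \<partial>lebesgue) (1/q)"
    (is "_ \<le> ennreal_powr ?I1 _ * ennreal_powr ?I2 _")
    unfolding q_def by (rule nn_set_integral_Holder[OF p]) measurable
  also have "?I1 = J"
    unfolding J_def
  proof (rule nn_set_integral_cong')
    fix x
    have "(l x powr - (1/q)) powr p = l x powr - (p - 1)" using pq by (simp add: powr_powr)
    then show "ennreal_powr (ennreal (l x powr - (1/q)) * f x) p = ennreal (l x powr - (p - 1)) * ennreal_powr (f x) p"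
      using p by (simp add: ennreal_powr_mult)
  qed
  also have "?I2 = (\<integral>\<^sup>+x\<in>R. ennreal (l x) * \<sigma> x \<partial>lebesgue)"
    using q less_imp_le[OF l0] by (intro nn_set_integral_cong') (simp add: ennreal_powr_mult ennreal_powr_powr powr_powr)
  finally have I: "I \<le> ennreal_powr J (1/p) * ennreal_powr (\<integral>\<^sup>+x\<in>R. ennreal (l x) * \<sigma> x \<partial>lebesgue) (1/q)" .
  have "(\<integral>\<^sup>+x\<in>R. ennreal (l x) * \<sigma> x \<partial>lebesgue) \<le> 2 * (ennreal L * ennreal m)"
    by (rule order_trans[OF l]) (use \<sigma> in \<open>auto intro!: mult_left_mono simp: m\<close>)
  also have "\<dots> = ennreal (2 * L * m)" using L m by (simp add: ennreal_mult' mult.assoc flip: ennreal_numeral)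
  finally have "I \<le> ennreal_powr J (1/p) * ennreal_powr (ennreal (2 * L * m)) (1/q)"
    using q by (intro order_trans[OF I] mult_left_mono ennreal_powr_mono) auto
  then have "ennreal_powr I p \<le> ennreal_powr (ennreal_powr J (1/p) * ennreal_powr (ennreal (2 * L * m)) (1/q)) p"
    using p by (intro ennreal_powr_mono) auto
  also have "\<dots> = J * ennreal ((2 * L * m) powr (p - 1))"
    using p L m pq by (simp add: ennreal_powr_mult ennreal_powr_powr powr_powr)
  finally have Ip: "ennreal_powr I p \<le> J * ennreal ((2 * L * m) powr (p - 1))" .
  have "average R (\<lambda>y. ennreal_powr (\<sigma> y) (1/q) * f y) = I * ennreal (1 / m)"
    using m by (simp add: average_def I_def divide_ennreal_def inverse_ennreal inverse_eq_divide)
  then have "ennreal_powr (4 * average R (\<lambda>y. ennreal_powr (\<sigma> y) (1/q) * f y)) p * vol R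
     = ennreal_powr I p * (ennreal (4 powr p) * ennreal ((1/m) powr p) * ennreal m)"
    using p m by (simp add: ennreal_powr_mult ac_simps flip: ennreal_numeral)
  also have "\<dots> \<le> J * ennreal ((2 * L * m) powr (p - 1)) * (ennreal (4 powr p) * ennreal ((1/m) powr p) * ennreal m)"
    by (intro mult_right_mono Ip) simp
  also have "\<dots> = J * ennreal ((2 * L * m) powr (p - 1) * (4 powr p * (1/m) powr p * m))"
    using m by (simp add: ennreal_mult' mult.assoc)
  also have "(2 * L * m) powr (p - 1) * (4 powr p * (1/m) powr p * m) = 4 powr p * (2 * L) powr (p - 1)"
    using m L p by (simp add: powr_mult powr_divide powr_diff field_simps)
  finally show ?thesis by (simp add: J_def q_def mult.commute)
qed

text \<open>The pair \<alpha>, \<sigma> may depend on \<open>R\<close>; only \<delta> and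
  \<open>L\<close> are uniform. Normalizing \<alpha> to have p-th power average at most 1 puts the
  whole size of the kernel into \<open>L\<close>.\<close>

definition local_factorization ::
  "(real^'n) set set \<Rightarrow> real \<Rightarrow> real \<Rightarrow> real \<Rightarrow> (real^'n \<Rightarrow> real^'n \<Rightarrow> ennreal) \<Rightarrow> (real^'n) set \<Rightarrow> bool"
  where "local_factorization D p \<delta> L k R \<longleftrightarrow> (\<exists>\<alpha> \<sigma>. \<alpha> \<in> borel_measurable lebesgue \<and> halving_weight D \<delta> \<sigma>
     \<and> (\<forall>x\<in>R. \<forall>y\<in>R. k x y \<le> \<alpha> x * ennreal_powr (\<sigma> y) (1 / conj_exponent p))
     \<and> (\<integral>\<^sup>+x\<in>R. ennreal_powr (\<alpha> x) p \<partial>lebesgue) \<le> vol R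
     \<and> (\<integral>\<^sup>+x\<in>R. \<sigma> x \<partial>lebesgue) \<le> ennreal L * vol R)"

lemma average_mono:
  assumes "\<And>y. y \<in> Q \<Longrightarrow> f y \<le> g y" shows "average Q f \<le> average Q g"
  unfolding average_def by (intro divide_right_mono_ennreal nn_set_integral_mono assms)

lemma average_cmult:
  assumes "Q \<in> sets lebesgue" "f \<in> borel_measurable lebesgue"
  shows "average Q (\<lambda>x. c * f x) = c * average Q f"
  using assms by (simp add: average_def mult.assoc nn_integral_cmult ennreal_times_divide)

lemma average_times_emeasure:
  assumes "0 < vol R" "vol R < \<infinity>"
  shows "average R h * vol R = (\<integral>\<^sup>+x\<in>R. h x \<partial>lebesgue)"
proof -
  have "a / m * m = a" if "0 < m" "m < top" for a m :: ennreal
    using that by (metis ennreal_divide_times ennreal_times_divide ennreal_mult_divide_eq less_irrefl)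
  then show ?thesis using assms by (simp only: average_def infinity_ennreal_def)
qed

text \<open>Chebyshev's inequality: the sets are disjoint and carry more than four times the
  average, so they fill at most a quarter of \<open>R\<close>. Half is what the halving property
  asks for.\<close>

lemma emeasure_Union_stopping:
  assumes C: "finite C" "disjoint C" "\<And>P. P \<in> C \<Longrightarrow> P \<in> sets lebesgue \<and> P \<subseteq> R \<and>
       0 < vol P \<and> vol P < \<infinity> \<and> 4 * average R h < average P h"
    and R: "R \<in> sets lebesgue" "0 < vol R" "vol R < \<infinity>"
    and [measurable]: "h \<in> borel_measurable lebesgue"
  shows "2 * vol (\<Union>C) \<le> vol R"
proof (cases "C = {}")
  case True
  then show ?thesis by simp
next
  case False
  define a where "a = average R h"
  define I where "I = (\<integral>\<^sup>+x\<in>R. h x \<partial>lebesgue)"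
  have Ia: "I = a * vol R"
    unfolding a_def I_def by (rule average_times_emeasure[symmetric]) (use R in auto)
  have le: "4 * a * vol P \<le> (\<integral>\<^sup>+x\<in>P. h x \<partial>lebesgue)" if "P \<in> C" for P
  proof -
    have "4 * a * vol P \<le> average P h * vol P"
      using C(3)[OF that] by (intro mult_right_mono) (auto simp: a_def)
    also have "\<dots> = (\<integral>\<^sup>+x\<in>P. h x \<partial>lebesgue)"
      by (rule average_times_emeasure) (use C(3)[OF that] in auto)
    finally show ?thesis .
  qed
  have U: "\<Union>C \<in> sets lebesgue" "\<Union>C \<subseteq> R" using C by auto
  have "4 * a * vol (\<Union>C) = (\<Sum>P\<in>C. 4 * a * vol P)"
    using C by (subst sum_distrib_left[symmetric], subst sum_emeasure)
      (auto simp: disjoint_def disjoint_family_on_def)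
  also have "\<dots> \<le> (\<Sum>P\<in>C. \<integral>\<^sup>+x\<in>P. h x \<partial>lebesgue)" by (intro sum_mono le)
  also have "\<dots> = (\<integral>\<^sup>+x\<in>\<Union>C. h x \<partial>lebesgue)"
    using C by (intro nn_set_integral_disjoint_Union[symmetric]) auto
  also have "\<dots> \<le> I" unfolding I_def using U by (intro nn_set_integral_set_mono) auto
  finally have *: "4 * a * vol (\<Union>C) \<le> a * vol R" by (simp add: Ia)
  \<comment> \<open>Cancelling \<open>a\<close> requires it to be finite and nonzero. A stopping set
    shows both: the strict stopping inequality excludes \<open>a = top\<close>, and
    \<open>a = 0\<close> would make the average over \<open>P\<close> vanish as well.\<close>
  obtain P where P: "P \<in> C" using False by auto
  have "a \<noteq> top" using C(3)[OF P] by (auto simp: a_def ennreal_mult_top)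
  have "a \<noteq> 0"
  proof
    assume "a = 0"
    then have "I = 0" by (simp add: Ia)
    moreover have "(\<integral>\<^sup>+x\<in>P. h x \<partial>lebesgue) \<le> I"
      unfolding I_def using C(3)[OF P] by (intro nn_set_integral_set_mono) auto
    ultimately have "average P h = 0" by (simp add: average_def)
    with C(3)[OF P] show False by simp
  qed
  have "a * (4 * vol (\<Union>C)) \<le> a * vol R"
    using * by (simp only: ac_simps)
  then have "4 * vol (\<Union>C) \<le> vol R"
    using \<open>a \<noteq> top\<close> \<open>a \<noteq> 0\<close> by (simp only: ennreal_mult_le_mult_iff simp_thms)
  moreover have "2 * vol (\<Union>C) \<le> 4 * vol (\<Union>C)"
    by (intro mult_right_mono) auto
  ultimately show ?thesis by (rule order_trans[rotated])
qed

text \<open>\<open>l\<close> is \<open>\<lambda>\<close> to the number of stopping sets around a point, and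
  \<open>(1 - \<theta> l powr - (p - 1)) / (1 - \<theta>)\<close> is the partial geometric sum of powers of
  \<open>\<theta> = \<lambda> powr - (p - 1)\<close> over these generations.\<close>

lemma stopping_time_domination:
  fixes D :: "(real^'n) set set" and k :: "real^'n \<Rightarrow> real^'n \<Rightarrow> ennreal"
  assumes p: "1 < p" and \<delta>: "0 < \<delta>" "\<delta> \<le> 1" and L: "0 \<le> L"
    and D: "finite D" "laminar D"
      "\<And>Q. Q \<in> D \<Longrightarrow> nondegenerate Q"
    and k: "\<And>R. R \<in> D \<Longrightarrow> local_factorization D p \<delta> L k R"
    and f [measurable]: "f \<in> borel_measurable lebesgue"
    and \<theta>_def: "\<theta> = (1 + \<delta> / 2) powr - (p - 1)"
    and R: "R \<in> D"
  shows "\<exists>l S. l \<in> borel_measurable lebesgue \<and> (\<forall>x. 1 \<le> l x) \<and> S \<in> borel_measurable lebesgue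
     \<and> (\<forall>\<sigma>. halving_weight D \<delta> \<sigma> \<longrightarrow>
          (\<integral>\<^sup>+x\<in>R. ennreal (l x) * \<sigma> x \<partial>lebesgue) \<le> 2 * (\<integral>\<^sup>+x\<in>R. \<sigma> x \<partial>lebesgue))
     \<and> (\<forall>Q\<in>D. Q \<subseteq> R \<longrightarrow> (\<forall>x\<in>Q. average Q (\<lambda>y. k x y * f y) \<le> S x))
     \<and> (\<integral>\<^sup>+x\<in>R. ennreal_powr (S x) p \<partial>lebesgue) \<le> ennreal (4 powr p * (2 * L) powr (p - 1)) *
          (\<integral>\<^sup>+x\<in>R. ennreal ((1 - \<theta> * l x powr - (p - 1)) / (1 - \<theta>)) * ennreal_powr (f x) p \<partial>lebesgue)"
    (is "\<exists>l S. ?P R l S")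
  using R
\<comment> \<open>The mass bound for \<open>l\<close> is proved for all halving weights because the
  stopping sets inside a stopping set \<open>P\<close> are selected by the weight belonging to
  \<open>P\<close>, while Hoelder's inequality on \<open>R\<close> needs the bound for the weight
  belonging to \<open>R\<close>.\<close>
proof (induction "card {Q\<in>D. Q \<subseteq> R}" arbitrary: R rule: less_induct)
  case less
  note R = D(3)[OF less.prems]
  then have [measurable]: "R \<in> sets lebesgue" by simp
  define Cst where "Cst = 4 powr p * (2 * L) powr (p - 1)"
  define \<Lambda> where "\<Lambda> = 1 + \<delta> / 2"
  have \<Lambda>: "1 < \<Lambda>" using \<delta> by (simp add: \<Lambda>_def)
  have \<theta>: "0 < \<theta>" "\<theta> < 1" using \<Lambda> p by (auto simp: \<theta>_def \<Lambda>_def powr_less_one)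
  define q where "q = conj_exponent p"
  obtain \<alpha> \<sigma> where [measurable]: "\<alpha> \<in> borel_measurable lebesgue" and \<sigma>: "halving_weight D \<delta> \<sigma>"
     and k\<alpha>\<sigma>: "\<forall>x\<in>R. \<forall>y\<in>R. k x y \<le> \<alpha> x * ennreal_powr (\<sigma> y) (1 / q)"
     and \<alpha>: "(\<integral>\<^sup>+x\<in>R. ennreal_powr (\<alpha> x) p \<partial>lebesgue) \<le> vol R"
     and \<sigma>L: "(\<integral>\<^sup>+x\<in>R. \<sigma> x \<partial>lebesgue) \<le> ennreal L * vol R"
    using k[OF less.prems] unfolding local_factorization_def q_def by blast
  have [measurable]: "\<sigma> \<in> borel_measurable lebesgue" using \<sigma> by (simp add: halving_weight_def)
  define h where "h = (\<lambda>y. ennreal_powr (\<sigma> y) (1/q) * f y)"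
  have h [measurable]: "h \<in> borel_measurable lebesgue" unfolding h_def by measurable
  define F where "F = {Q\<in>D. Q \<subseteq> R \<and> 4 * average R h < average Q h}"
  define C where "C = maximal_sets F"
  have F: "finite F" "laminar F" "F \<subseteq> D" using D by (auto simp: F_def laminar_def)
  have C: "finite C" "disjoint C" "C \<subseteq> F"
    using F disjoint_maximal_sets[of F] maximal_sets_subset[of F] unfolding C_def by (auto intro: finite_subset)
  \<comment> \<open>The strict inequality excludes \<open>R\<close> even if its average is zero or
    infinite. Hence every stopping set is a proper subset of \<open>R\<close> and the induction
    hypothesis applies to it.\<close>
  have "R \<notin> F"
  proof
    assume "R \<in> F"
    then have "4 * average R h < average R h" by (simp add: F_def)
    moreover have "1 * average R h \<le> 4 * average R h" by (intro mult_right_mono) auto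
    ultimately show False by simp
  qed
  have CD: "P \<in> sets lebesgue \<and> P \<subseteq> R \<and> 0 < vol P \<and> vol P < \<infinity> \<and>
       4 * average R h < average P h \<and> P \<in> D \<and> P \<noteq> R" if "P \<in> C" for P
    using that C(3) D(3)[of P] \<open>R \<notin> F\<close> by (auto simp: F_def)
  let ?U = "\<Union>C"
  have U [measurable]: "?U \<in> sets lebesgue" and UR: "?U \<subseteq> R" using C CD by auto
  have small: "2 * vol ?U \<le> vol R"
  proof (rule emeasure_Union_stopping[where h = h])
    fix P assume "P \<in> C"
    from CD[OF this] show "P \<in> sets lebesgue \<and> P \<subseteq> R \<and> 0 < vol P \<and> vol P < \<infinity>
      \<and> 4 * average R h < average P h" by blast
  qed (use C(1,2) R h in \<open>simp_all del: emeasure_completion\<close>)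
  have "\<forall>P\<in>C. \<exists>l S. ?P P l S"
  proof
    fix P assume "P \<in> C"
    then have "{Q\<in>D. Q \<subseteq> P} \<subset> {Q\<in>D. Q \<subseteq> R}" using CD[of P] less.prems by auto
    then have "card {Q\<in>D. Q \<subseteq> P} < card {Q\<in>D. Q \<subseteq> R}" using D(1) by (intro psubset_card_mono) auto
    then show "\<exists>l S. ?P P l S" using CD[OF \<open>P \<in> C\<close>] by (intro less.hyps) auto
  qed
  then have "\<exists>lP. \<forall>P\<in>C. \<exists>S. ?P P (lP P) S" by (rule bchoice)
  then obtain lP where "\<forall>P\<in>C. \<exists>S. ?P P (lP P) S" ..
  then have "\<exists>SP. \<forall>P\<in>C. ?P P (lP P) (SP P)" by (rule bchoice)
  then obtain SP where SP: "\<forall>P\<in>C. ?P P (lP P) (SP P)" ..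
  note IH = bspec[OF SP]
  have [measurable]: "\<And>P. P \<in> C \<Longrightarrow> lP P \<in> borel_measurable lebesgue" "\<And>P. P \<in> C \<Longrightarrow> SP P \<in> borel_measurable lebesgue"
       "\<And>P. P \<in> C \<Longrightarrow> P \<in> sets lebesgue"
    using IH CD by auto
  define l where "l = (\<lambda>x. if x \<in> ?U then \<Lambda> * (\<Sum>P\<in>C. lP P x * indicator P x) else 1)"
  define S' where "S' = (\<lambda>x. \<Sum>P\<in>C. SP P x * indicator P x)"
  \<comment> \<open>A maximum suffices, since each average is controlled either by the threshold on
    \<open>R\<close> or by a stopping set. The p-th power of a maximum is at most the sum of the
    p-th powers, so no constant accumulates over the generations.\<close>
  define S where "S = (\<lambda>x. max (4 * average R h * \<alpha> x) (S' x))"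
  have l_in: "l x = \<Lambda> * lP P x" and S'_in: "S' x = SP P x" if "P \<in> C" "x \<in> P" for P x
    using that disjoint_sum_indicator[OF C(1,2) that, of lP] disjoint_sum_indicator[OF C(1,2) that, of SP]
    by (auto simp: l_def S'_def)
  have l_out: "l x = 1" if "x \<notin> ?U" for x using that by (simp add: l_def)
  have S'_out: "S' x = 0" if "x \<notin> ?U" for x
    unfolding S'_def by (rule sum.neutral) (use that in \<open>auto simp: indicator_def\<close>)
  have l_meas [measurable]: "l \<in> borel_measurable lebesgue"
    unfolding l_def by measurable
  have S'_meas [measurable]: "S' \<in> borel_measurable lebesgue"
    unfolding S'_def by measurable
  have S_meas [measurable]: "S \<in> borel_measurable lebesgue"
    unfolding S_def by measurable
  have l1: "1 \<le> l x" for x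
  proof (cases "x \<in> ?U")
    case True
    then obtain P where P: "P \<in> C" "x \<in> P" by auto
    then have "1 * 1 \<le> \<Lambda> * lP P x" using IH[OF P(1)] \<Lambda> by (intro mult_mono) auto
    then show ?thesis using l_in[OF P] by simp
  qed (simp add: l_out)
  have a: "(\<integral>\<^sup>+x\<in>R. ennreal (l x) * \<tau> x \<partial>lebesgue) \<le> 2 * (\<integral>\<^sup>+x\<in>R. \<tau> x \<partial>lebesgue)"
    if "halving_weight D \<delta> \<tau>" for \<tau>
  proof (rule generation_weight_step[where C = C and l = lP, OF \<delta> that less.prems])
    fix P assume "P \<in> C"
    show "P \<in> sets lebesgue \<and> P \<subseteq> R" using CD[OF \<open>P \<in> C\<close>] by blast
    show "(\<integral>\<^sup>+x\<in>P. ennreal (lP P x) * \<tau> x \<partial>lebesgue) \<le> 2 * (\<integral>\<^sup>+x\<in>P. \<tau> x \<partial>lebesgue)"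
      using IH[OF \<open>P \<in> C\<close>] that by blast
    show "lP P \<in> borel_measurable lebesgue" "\<And>x. 1 \<le> lP P x" using IH[OF \<open>P \<in> C\<close>] by blast+
    show "\<And>x. x \<in> P \<Longrightarrow> l x = (1 + \<delta> / 2) * lP P x"
      using l_in[OF \<open>P \<in> C\<close>] by (simp add: \<Lambda>_def)
  qed (use R C small l_meas l_out in blast)+
  have b: "average Q (\<lambda>y. k x y * f y) \<le> S x" if Q: "Q \<in> D" "Q \<subseteq> R" "x \<in> Q" for Q x
  proof (cases "Q \<in> F")
    case True
    then obtain P where P: "P \<in> C" "Q \<subseteq> P" using exists_maximal_superset[OF F(1)] unfolding C_def by blast
    then have "average Q (\<lambda>y. k x y * f y) \<le> SP P x" using IH[OF P(1)] Q by blast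
    also have "\<dots> = S' x" using S'_in[of P x] P Q by auto
    finally show ?thesis by (simp add: S_def max.coboundedI2)
  next
    \<comment> \<open>Failing the stopping inequality bounds the average by the threshold on
      \<open>R\<close>, even when \<open>Q\<close> lies inside a stopping set.\<close>
    case False
    then have le: "average Q h \<le> 4 * average R h" using Q by (auto simp: F_def)
    have "average Q (\<lambda>y. k x y * f y) \<le> average Q (\<lambda>y. \<alpha> x * h y)"
    proof (rule average_mono)
      fix y assume "y \<in> Q"
      then have "k x y \<le> \<alpha> x * ennreal_powr (\<sigma> y) (1 / q)" using k\<alpha>\<sigma> Q by blast
      then show "k x y * f y \<le> \<alpha> x * h y" by (simp add: h_def mult_right_mono flip: mult.assoc)
    qed
    also have "\<dots> = \<alpha> x * average Q h" using D(3)[OF Q(1)] by (intro average_cmult) auto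
    also have "\<dots> \<le> \<alpha> x * (4 * average R h)" by (intro mult_left_mono le) simp
    finally show ?thesis by (simp add: S_def mult.commute max.coboundedI1)
  qed
  define G where "G = (\<lambda>l. (1 - \<theta> * l powr - (p - 1)) / (1 - \<theta>))"
  \<comment> \<open>By this recursion the induction closes with an unchanged constant: the term of
    the present generation is added to the partial sum inherited from the stopping set. Outside the
    stopping sets, \<open>G 1 = 1\<close> accounts for the term of \<open>R\<close> alone.\<close>
  have G_step: "G (\<Lambda> * m) = (\<Lambda> * m) powr - (p - 1) + G m" if "1 \<le> m" for m
  proof -
    have "(\<Lambda> * m) powr - (p - 1) = \<theta> * m powr - (p - 1)"
      using that \<Lambda> unfolding \<theta>_def \<Lambda>_def[symmetric] by (subst powr_mult) auto
    then show ?thesis using \<theta> by (simp add: G_def field_simps)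
  qed
  have G_nonneg: "0 \<le> G m" if "1 \<le> m" for m
  proof -
    have "m powr - (p - 1) \<le> 1" using powr_mono[of "- (p - 1)" 0 m] that p by simp
    then have "\<theta> * m powr - (p - 1) \<le> 1 * 1" using \<theta> by (intro mult_mono) auto
    then show ?thesis using \<theta> by (simp add: G_def)
  qed
  have G1: "G 1 = 1" using \<theta> by (simp add: G_def)
  let ?fp = "\<lambda>x. ennreal_powr (f x) p"
  let ?J = "\<lambda>P. \<integral>\<^sup>+x\<in>P. ennreal (G (lP P x)) * ?fp x \<partial>lebesgue"
    and ?I = "\<integral>\<^sup>+x\<in>R. ennreal (l x powr - (p - 1)) * ?fp x \<partial>lebesgue"
    and ?g = "\<lambda>x. \<Sum>P\<in>C. ennreal (G (lP P x)) * ?fp x * indicator P x"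
    and ?s = "\<lambda>x. \<Sum>P\<in>C. ennreal_powr (SP P x) p * indicator P x"
    and ?a = "ennreal_powr (4 * average R h) p"
  have G_sum: "(\<integral>\<^sup>+x\<in>R. ennreal (G (l x)) * ?fp x \<partial>lebesgue) =
      ?I
      + (\<Sum>P\<in>C. ?J P)"
  proof -
    have "(\<integral>\<^sup>+x\<in>R. ennreal (G (l x)) * ?fp x \<partial>lebesgue) =
       (\<integral>\<^sup>+x. ennreal (l x powr - (p - 1)) * ?fp x * indicator R x
          + ?g x \<partial>lebesgue)"
    proof (intro nn_integral_cong)
      fix x
      show "ennreal (G (l x)) * ?fp x * indicator R x = ennreal (l x powr - (p - 1)) * ?fp x * indicator R x
          + ?g x"
      proof (cases "x \<in> ?U")
        case True
        then obtain P where P: "P \<in> C" "x \<in> P" by auto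
        then have "1 \<le> lP P x" using IH[OF P(1)] by simp
        then have "ennreal (G (l x)) = ennreal (l x powr - (p - 1)) + ennreal (G (lP P x))"
          using G_nonneg l_in[OF P] by (simp add: G_step)
        moreover have "x \<in> R" using P CD by auto
        ultimately show ?thesis
          using disjoint_sum_indicator[OF C(1,2) P, of "\<lambda>P x. ennreal (G (lP P x)) * ?fp x"]
          by (simp add: distrib_right)
      next
        case False
        then have "?g x = 0"
          by (intro sum.neutral) (auto simp: indicator_def)
        then show ?thesis using l_out[OF False] by (simp add: G1)
      qed
    qed
    also have "\<dots> = ?I
      + (\<integral>\<^sup>+x. ?g x \<partial>lebesgue)"
      unfolding G_def by (intro nn_integral_add) measurable
    also have "(\<integral>\<^sup>+x. ?g x \<partial>lebesgue)
       = (\<Sum>P\<in>C. ?J P)"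
      unfolding G_def by (intro nn_integral_sum) measurable
    finally show ?thesis .
  qed
  have main: "?a * vol R
      \<le> ennreal Cst * ?I"
    unfolding h_def Cst_def q_def using p L R l1 a[OF \<sigma>] \<sigma>L by (intro generation_Holder) auto
  have c: "(\<integral>\<^sup>+x\<in>R. ennreal_powr (S x) p \<partial>lebesgue)
     \<le> ennreal Cst * (\<integral>\<^sup>+x\<in>R. ennreal (G (l x)) * ?fp x \<partial>lebesgue)"
  proof -
    have "(\<integral>\<^sup>+x\<in>R. ennreal_powr (S x) p \<partial>lebesgue) \<le>
       (\<integral>\<^sup>+x. ?a * (ennreal_powr (\<alpha> x) p * indicator R x)
         + ?s x \<partial>lebesgue)"
    proof (intro nn_integral_mono)
      fix x
      have S': "ennreal_powr (S' x) p = ?s x"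
      proof (cases "x \<in> ?U")
        case True
        then obtain P where P: "P \<in> C" "x \<in> P" by auto
        then show ?thesis
          using disjoint_sum_indicator[OF C(1,2) P, of "\<lambda>P x. ennreal_powr (SP P x) p"] by (simp add: S'_in)
      next
        case False
        then have "?s x = 0"
          by (intro sum.neutral) (auto simp: indicator_def)
        then show ?thesis using S'_out[OF False] by simp
      qed
      have "ennreal_powr (S x) p \<le> ennreal_powr (4 * average R h * \<alpha> x) p + ennreal_powr (S' x) p"
        using p unfolding S_def by (subst ennreal_powr_max) (auto intro: add_increasing add_increasing2)
      also have "\<dots> = ?a * ennreal_powr (\<alpha> x) p + ?s x"
        using p by (simp add: ennreal_powr_mult S')
      finally show "ennreal_powr (S x) p * indicator R x \<le> ?a * (ennreal_powr (\<alpha> x) p * indicator R x)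
         + ?s x"
        by (cases "x \<in> R") auto
    qed
    also have "\<dots> = (\<integral>\<^sup>+x. ?a * (ennreal_powr (\<alpha> x) p * indicator R x) \<partial>lebesgue)
        + (\<integral>\<^sup>+x. ?s x \<partial>lebesgue)"
      by (intro nn_integral_add) measurable
    also have "(\<integral>\<^sup>+x. ?s x \<partial>lebesgue)
        = (\<Sum>P\<in>C. \<integral>\<^sup>+x\<in>P. ennreal_powr (SP P x) p \<partial>lebesgue)"
      by (intro nn_integral_sum) measurable
    also have "(\<integral>\<^sup>+x. ?a * (ennreal_powr (\<alpha> x) p * indicator R x) \<partial>lebesgue)
       = ?a * (\<integral>\<^sup>+x\<in>R. ennreal_powr (\<alpha> x) p \<partial>lebesgue)"
      by (intro nn_integral_cmult) measurable
    also have "\<dots> \<le> ?a * vol R"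
      by (intro mult_left_mono \<alpha>) simp
    also note main
    also have "(\<Sum>P\<in>C. \<integral>\<^sup>+x\<in>P. ennreal_powr (SP P x) p \<partial>lebesgue)
      \<le> (\<Sum>P\<in>C. ennreal Cst * ?J P)"
      using IH unfolding Cst_def G_def by (intro sum_mono) blast
    finally show ?thesis by (simp add: G_sum distrib_left sum_distrib_left)
  qed
  show ?case
    using a b c l1 l_meas S_meas unfolding Cst_def G_def by blast
qed

text \<open>The maximal members of \<open>D\<close> are disjoint and each starts its own tree of
  stopping sets. The partial geometric sums are at most \<open>1 / (1 - \<theta>)\<close>, and since
  \<open>1 - \<theta>\<close> is of order \<delta>, this is where the factor 1/\<delta>
  enters.\<close>

lemma sparse_maximal_bound:
  fixes D :: "(real^'n) set set" and k :: "real^'n \<Rightarrow> real^'n \<Rightarrow> ennreal"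
  assumes p: "1 < p" and \<delta>: "0 < \<delta>" "\<delta> \<le> 1" and L: "0 \<le> L"
    and D: "finite D" "laminar D"
      "\<And>Q. Q \<in> D \<Longrightarrow> nondegenerate Q"
    and k: "\<And>R. R \<in> D \<Longrightarrow> local_factorization D p \<delta> L k R"
    and f [measurable]: "f \<in> borel_measurable lebesgue"
  shows "(\<integral>\<^sup>+x. ennreal_powr (SUP Q\<in>{Q\<in>D. x \<in> Q}. average Q (\<lambda>y. k x y * f y)) p \<partial>lebesgue)
     \<le> ennreal (4 powr p * (2 * L) powr (p - 1) * ((p + 2) / ((p - 1) * \<delta>))) * (\<integral>\<^sup>+x. ennreal_powr (f x) p \<partial>lebesgue)"
proof -
  define \<theta> where "\<theta> = (1 + \<delta> / 2) powr - (p - 1)"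
  have \<theta>: "0 < \<theta>" "\<theta> < 1" using \<delta> p by (auto simp: \<theta>_def powr_less_one)
  define Cst where "Cst = 4 powr p * (2 * L) powr (p - 1)"
  have Cst: "0 \<le> Cst" by (simp add: Cst_def)
  define C where "C = maximal_sets D"
  have C: "finite C" "disjoint C" "C \<subseteq> D"
    using D disjoint_maximal_sets[of D] maximal_sets_subset[of D] unfolding C_def by (auto intro: finite_subset)
  let ?fp = "\<lambda>x. ennreal_powr (f x) p"
  have "\<forall>R\<in>C. \<exists>S. S \<in> borel_measurable lebesgue \<and> (\<forall>Q\<in>D. Q \<subseteq> R \<longrightarrow> (\<forall>x\<in>Q. average Q (\<lambda>y. k x y * f y) \<le> S x))
     \<and> (\<integral>\<^sup>+x\<in>R. ennreal_powr (S x) p \<partial>lebesgue) \<le> ennreal Cst * (ennreal (1 / (1 - \<theta>)) * (\<integral>\<^sup>+x\<in>R. ?fp x \<partial>lebesgue))"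
    (is "\<forall>R\<in>C. \<exists>S. ?P R S")
  proof
    fix R assume "R \<in> C"
    then have RD: "R \<in> D" using C by auto
    have [measurable]: "R \<in> sets lebesgue" using D(3)[OF RD] by simp
    obtain l S where l1: "\<forall>x. 1 \<le> l x" and S: "S \<in> borel_measurable lebesgue"
      "\<forall>Q\<in>D. Q \<subseteq> R \<longrightarrow> (\<forall>x\<in>Q. average Q (\<lambda>y. k x y * f y) \<le> S x)"
      and le: "(\<integral>\<^sup>+x\<in>R. ennreal_powr (S x) p \<partial>lebesgue) \<le> ennreal Cst *
          (\<integral>\<^sup>+x\<in>R. ennreal ((1 - \<theta> * l x powr - (p - 1)) / (1 - \<theta>)) * ?fp x \<partial>lebesgue)"
      using stopping_time_domination[OF p \<delta> L D k f \<theta>_def RD] unfolding Cst_def by blast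
    have "(\<integral>\<^sup>+x\<in>R. ennreal ((1 - \<theta> * l x powr - (p - 1)) / (1 - \<theta>)) * ?fp x \<partial>lebesgue)
       \<le> (\<integral>\<^sup>+x\<in>R. ennreal (1 / (1 - \<theta>)) * ?fp x \<partial>lebesgue)"
      using \<theta> by (intro nn_set_integral_mono mult_right_mono ennreal_leI divide_right_mono) auto
    also have "\<dots> = ennreal (1 / (1 - \<theta>)) * (\<integral>\<^sup>+x\<in>R. ?fp x \<partial>lebesgue)"
      unfolding mult.assoc by (intro nn_integral_cmult) measurable
    finally have "(\<integral>\<^sup>+x\<in>R. ennreal_powr (S x) p \<partial>lebesgue) \<le> ennreal Cst * (ennreal (1 / (1 - \<theta>)) * (\<integral>\<^sup>+x\<in>R. ?fp x \<partial>lebesgue))"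
      using le by (meson mult_left_mono order_trans zero_le)
    with S show "\<exists>S. ?P R S"
      by blast
  qed
  from bchoice[OF this] obtain S where *: "\<forall>R\<in>C. ?P R (S R)" ..
  have S: "S R \<in> borel_measurable lebesgue"
     "Q \<in> D \<Longrightarrow> Q \<subseteq> R \<Longrightarrow> x \<in> Q \<Longrightarrow> average Q (\<lambda>y. k x y * f y) \<le> S R x"
     "(\<integral>\<^sup>+x\<in>R. ennreal_powr (S R x) p \<partial>lebesgue) \<le> ennreal Cst * (ennreal (1 / (1 - \<theta>)) * (\<integral>\<^sup>+x\<in>R. ?fp x \<partial>lebesgue))"
    if "R \<in> C" for R Q x
    using bspec[OF * that] by simp_all
  note S(1) [measurable]
  have [measurable]: "\<And>R. R \<in> C \<Longrightarrow> R \<in> sets lebesgue" using C D by auto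
  have "(\<integral>\<^sup>+x. ennreal_powr (SUP Q\<in>{Q\<in>D. x \<in> Q}. average Q (\<lambda>y. k x y * f y)) p \<partial>lebesgue)
     \<le> (\<integral>\<^sup>+x. (\<Sum>R\<in>C. ennreal_powr (S R x) p * indicator R x) \<partial>lebesgue)"
  proof (intro nn_integral_mono)
    fix x
    show "ennreal_powr (SUP Q\<in>{Q\<in>D. x \<in> Q}. average Q (\<lambda>y. k x y * f y)) p
       \<le> (\<Sum>R\<in>C. ennreal_powr (S R x) p * indicator R x)"
    proof (cases "x \<in> \<Union>C")
      case True
      then obtain R where R: "R \<in> C" "x \<in> R" by auto
      have "(SUP Q\<in>{Q\<in>D. x \<in> Q}. average Q (\<lambda>y. k x y * f y)) \<le> S R x"
      proof (rule SUP_least)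
        fix Q assume Q: "Q \<in> {Q\<in>D. x \<in> Q}"
        then obtain R' where R': "R' \<in> C" "Q \<subseteq> R'" using exists_maximal_superset[OF D(1)] unfolding C_def by blast
        then have "x \<in> R'" using Q by auto
        then have "R' = R" using R R' C(2) by (auto simp: disjoint_def)
        then show "average Q (\<lambda>y. k x y * f y) \<le> S R x" using S(2)[of R Q x] R R' Q by auto
      qed
      then have "ennreal_powr (SUP Q\<in>{Q\<in>D. x \<in> Q}. average Q (\<lambda>y. k x y * f y)) p \<le> ennreal_powr (S R x) p"
        using p by (intro ennreal_powr_mono) auto
      then show ?thesis
        using disjoint_sum_indicator[OF C(1,2) R, of "\<lambda>R x. ennreal_powr (S R x) p"] by simp
    next
      case False
      then have "\<And>Q. Q \<in> D \<Longrightarrow> x \<notin> Q" using exists_maximal_superset[OF D(1)] unfolding C_def by blast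
      then have "{Q\<in>D. x \<in> Q} = {}" by auto
      then show ?thesis by (simp only:) (simp add: bot_ennreal)
    qed
  qed
  also have "\<dots> = (\<Sum>R\<in>C. \<integral>\<^sup>+x\<in>R. ennreal_powr (S R x) p \<partial>lebesgue)"
    by (intro nn_integral_sum) measurable
  also have "\<dots> \<le> (\<Sum>R\<in>C. ennreal Cst * (ennreal (1 / (1 - \<theta>)) * (\<integral>\<^sup>+x\<in>R. ?fp x \<partial>lebesgue)))"
    by (intro sum_mono S)
  also have "\<dots> = ennreal Cst * (ennreal (1 / (1 - \<theta>)) * (\<integral>\<^sup>+x\<in>\<Union>C. ?fp x \<partial>lebesgue))"
    using C by (subst nn_set_integral_disjoint_Union) (auto simp: sum_distrib_left)
  also have "\<dots> \<le> ennreal Cst * (ennreal (1 / (1 - \<theta>)) * (\<integral>\<^sup>+x. ?fp x \<partial>lebesgue))"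
    by (intro mult_left_mono nn_integral_mono) (auto simp: indicator_def)
  also have "\<dots> \<le> ennreal Cst * (ennreal ((p + 2) / ((p - 1) * \<delta>)) * (\<integral>\<^sup>+x. ?fp x \<partial>lebesgue))"
  proof (intro mult_left_mono mult_right_mono ennreal_leI)
    \<comment> \<open>As \<open>ln (1 + \<delta> / 2)\<close> is at least
      \<open>\<delta> / 3\<close>, the inverse of \<theta> is at least \<open>1 + s\<close>. Hence
      \<open>1 - \<theta>\<close> is at least \<open>s / (1 + s)\<close>, and \<open>1 + s\<close>
      is at most \<open>(p + 2) / 3\<close>.\<close>
    define s where "s = (p - 1) * \<delta> / 3"
    have s: "0 < s" "s \<le> (p - 1) / 3" using p \<delta> by (auto simp: s_def)
    have "\<delta> / 3 \<le> ln (1 + \<delta> / 2)"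
    proof -
      have "ln (inverse (1 + \<delta> / 2)) \<le> inverse (1 + \<delta> / 2) - 1" using \<delta> by (intro ln_le_minus_one) auto
      then have "1 - inverse (1 + \<delta> / 2) \<le> ln (1 + \<delta> / 2)" using \<delta> by (simp add: ln_inverse)
      moreover have "\<delta> / 3 \<le> 1 - inverse (1 + \<delta> / 2)"
      proof -
        have "\<delta> * (2 + \<delta>) \<le> \<delta> * 3" using \<delta> by (intro mult_left_mono) auto
        moreover have "1 - inverse (1 + \<delta> / 2) = \<delta> / (2 + \<delta>)" using \<delta> by (simp add: field_simps)
        ultimately show ?thesis using \<delta> by (simp add: field_simps)
      qed
      ultimately show ?thesis by simp
    qed
    then have "(p - 1) * (\<delta> / 3) \<le> (p - 1) * ln (1 + \<delta> / 2)" using p by (intro mult_left_mono) auto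
    then have "1 + s \<le> 1 + (p - 1) * ln (1 + \<delta> / 2)" by (simp add: s_def)
    also have "\<dots> \<le> exp ((p - 1) * ln (1 + \<delta> / 2))" by (rule exp_ge_add_one_self)
    also have "\<dots> = 1 / \<theta>" 
    proof -
      have "\<theta> = exp (- ((p - 1) * ln (1 + \<delta> / 2)))" using \<delta> by (simp add: \<theta>_def powr_def algebra_simps)
      then show ?thesis by (simp only: exp_minus inverse_eq_divide) simp
    qed
    finally have "(1 + s) * \<theta> \<le> 1" using \<theta> by (simp add: field_simps)
    then have "s \<le> (1 - \<theta>) * (1 + s)" by (simp add: algebra_simps)
    also have "\<dots> \<le> (1 - \<theta>) * ((p + 2) / 3)" using s \<theta> by (intro mult_left_mono) (auto simp: field_simps)
    finally have "(p - 1) * \<delta> \<le> (1 - \<theta>) * (p + 2)" by (simp add: s_def)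
    then show "1 / (1 - \<theta>) \<le> (p + 2) / ((p - 1) * \<delta>)" using \<theta> p \<delta> by (simp add: field_simps)
  qed auto
  also have "\<dots> = ennreal (Cst * ((p + 2) / ((p - 1) * \<delta>))) * (\<integral>\<^sup>+x. ?fp x \<partial>lebesgue)"
    using Cst p \<delta> by (subst ennreal_mult) (auto simp: mult.assoc)
  finally show ?thesis by (simp only: Cst_def)
qed

subsection \<open>Kernels of matrix weights\<close>

lemma op_norm_nonneg [simp]: "0 \<le> op_norm A"
  unfolding op_norm_def by (intro onorm_pos_le matrix_vector_mul_bounded_linear)

lemma norm_matrix_vector_le: "norm (A *v x) \<le> op_norm A * norm x"
  unfolding op_norm_def by (intro onorm matrix_vector_mul_bounded_linear)

lemma op_norm_le: "0 \<le> b \<Longrightarrow> (\<And>x. norm (A *v x) \<le> b * norm x) \<Longrightarrow> op_norm A \<le> b"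
  unfolding op_norm_def by (rule onorm_bound)

lemma inner_matrix_vector: "x \<bullet> (A *v y) = (transpose A *v x) \<bullet> (y :: real^'d)" for A :: "real^'d^'d"
  by (metis dot_lmul_matrix transpose_matrix_vector vector_transpose_matrix)

lemma matrix_vector_mult_sum: "A *v (\<Sum>i\<in>I. f i) = (\<Sum>i\<in>I. A *v f i)" for A :: "real^'d^'m"
  by (rule linear_sum[OF matrix_vector_mul_linear])

lemma op_norm_transpose_le: "op_norm (transpose A) \<le> op_norm (A :: real^'d^'d)"
proof (rule op_norm_le)
  fix x :: "real^'d"
  have "norm (transpose A *v x) ^ 2 = x \<bullet> (A *v (transpose A *v x))"
    by (simp add: inner_matrix_vector power2_norm_eq_inner)
  also have "\<dots> \<le> norm x * (op_norm A * norm (transpose A *v x))"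
    by (rule order_trans[OF norm_cauchy_schwarz mult_left_mono[OF norm_matrix_vector_le]]) simp
  finally show "norm (transpose A *v x) \<le> op_norm A * norm x"
    by (cases "norm (transpose A *v x) = 0") (auto simp: power2_eq_square mult.commute)
qed simp

lemma op_norm_transpose: "op_norm (transpose A) = op_norm (A :: real^'d^'d)"
  by (metis antisym op_norm_transpose_le transpose_transpose)

lemma op_norm_scaleR: "op_norm (c *\<^sub>R A) = \<bar>c\<bar> * op_norm A"
proof -
  have "(*v) (c *\<^sub>R A) = (\<lambda>x. c *\<^sub>R (A *v x))" by (auto simp: scaleR_matrix_vector_assoc)
  then show ?thesis unfolding op_norm_def by (simp add: onorm_scaleR)
qed

text \<open>The operator norm is not the norm of the type, so its continuity has to be derived: it
  is subadditive and dominated by the sum of the absolute values of the entries.\<close>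

lemma continuous_on_op_norm: "continuous_on UNIV (op_norm :: real^'d^'d \<Rightarrow> real)"
proof -
  have le: "op_norm (A + B) \<le> op_norm A + op_norm B" for A B :: "real^'d^'d"
    by (rule op_norm_le)
      (auto simp: matrix_vector_mult_add_rdistrib algebra_simps intro!: order_trans[OF norm_triangle_ineq] add_mono norm_matrix_vector_le)
  have "\<bar>op_norm A - op_norm B\<bar> \<le> (\<Sum>i\<in>UNIV. \<Sum>j\<in>UNIV. \<bar>A$i$j - B$i$j\<bar>)" for A B :: "real^'d^'d"
  proof -
    have "op_norm A \<le> op_norm B + op_norm (A - B)" "op_norm B \<le> op_norm A + op_norm (B - A)"
      using le[of B "A - B"] le[of A "B - A"] by auto
    moreover have "op_norm (A - B) \<le> (\<Sum>i\<in>UNIV. \<Sum>j\<in>UNIV. \<bar>A$i$j - B$i$j\<bar>)"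
      "op_norm (B - A) \<le> (\<Sum>i\<in>UNIV. \<Sum>j\<in>UNIV. \<bar>A$i$j - B$i$j\<bar>)"
      using onorm_le_matrix_component_sum[of "A - B"] onorm_le_matrix_component_sum[of "B - A"]
      by (simp_all add: op_norm_def abs_minus_commute)
    ultimately show ?thesis by linarith
  qed
  note bound = this
  show ?thesis
    unfolding continuous_on_def
  proof (intro ballI)
    fix B :: "real^'d^'d"
    have "((\<lambda>A. \<Sum>i\<in>UNIV. \<Sum>j\<in>UNIV. \<bar>A$i$j - B$i$j\<bar>) \<longlongrightarrow> (\<Sum>i\<in>UNIV. \<Sum>j\<in>UNIV. \<bar>B$i$j - B$i$j\<bar>)) (at B)"
      by (intro tendsto_intros)
    then have "((\<lambda>A. op_norm A - op_norm B) \<longlongrightarrow> 0) (at B)"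
      by (rule Lim_null_comparison[rotated, OF tendsto_eq_rhs]) (use bound in \<open>auto intro!: always_eventually\<close>)
    then show "(op_norm \<longlongrightarrow> op_norm B) (at B)" by (simp add: LIM_zero_iff)
  qed
qed

lemma measurable_op_norm [measurable (raw)]:
  "f \<in> borel_measurable M \<Longrightarrow> (\<lambda>x. op_norm (f x)) \<in> borel_measurable M"
  by (rule measurable_compose[OF _ borel_measurable_continuous_onI[OF continuous_on_op_norm]])

lemma measurable_matrix_vector [measurable (raw)]:
  fixes f :: "'a \<Rightarrow> real^'d^'m"
  assumes "f \<in> borel_measurable M" shows "(\<lambda>x. f x *v u) \<in> borel_measurable M"
proof -
  have "continuous_on UNIV (\<lambda>A::real^'d^'m. A *v u)"
    unfolding matrix_vector_mult_def by (intro continuous_intros)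
  from measurable_compose[OF assms borel_measurable_continuous_onI[OF this]] show ?thesis .
qed

lemma measurable_matrix_mult [measurable (raw)]:
  fixes f :: "'a \<Rightarrow> real^'d^'m" and g :: "'a \<Rightarrow> real^'k^'d"
  assumes "f \<in> borel_measurable M" "g \<in> borel_measurable M"
  shows "(\<lambda>x. f x ** g x) \<in> borel_measurable M"
proof -
  have "continuous_on UNIV (\<lambda>A::(real^'d^'m) \<times> (real^'k^'d). fst A ** snd A)"
    unfolding matrix_matrix_mult_def by (intro continuous_intros)
  from measurable_compose[OF _ borel_measurable_continuous_onI[OF this], of "\<lambda>x. (f x, g x)" M] assms
  show ?thesis by simp
qed

section \<open>The A_infinity property of the scalar weights attached to a matrix weight\<close>

lemma halving_weight_sum:
  assumes "finite I" "\<And>i. i \<in> I \<Longrightarrow> halving_weight D \<delta> (\<sigma> i)" "\<And>Q. Q \<in> D \<Longrightarrow> Q \<in> sets lebesgue"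
  shows "halving_weight D \<delta> (\<lambda>x. \<Sum>i\<in>I. \<sigma> i x)"
  unfolding halving_weight_def
proof (intro conjI ballI impI)
  have [measurable]: "\<And>i. i \<in> I \<Longrightarrow> \<sigma> i \<in> borel_measurable lebesgue"
    using assms(2) by (simp add: halving_weight_def)
  show "(\<lambda>x. \<Sum>i\<in>I. \<sigma> i x) \<in> borel_measurable lebesgue" by measurable
  fix Q E assume Q: "Q \<in> D" and E: "E \<in> sets lebesgue" "E \<subseteq> Q" "2 * vol E \<le> vol Q"
  have "(\<Sum>i\<in>I. \<integral>\<^sup>+x\<in>E. \<sigma> i x \<partial>lebesgue) \<le> (\<Sum>i\<in>I. ennreal (1 - \<delta>) * (\<integral>\<^sup>+x\<in>Q. \<sigma> i x \<partial>lebesgue))"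
  proof (intro sum_mono)
    fix i assume "i \<in> I"
    then show "(\<integral>\<^sup>+x\<in>E. \<sigma> i x \<partial>lebesgue) \<le> ennreal (1 - \<delta>) * (\<integral>\<^sup>+x\<in>Q. \<sigma> i x \<partial>lebesgue)"
      using assms(2)[of i] Q E unfolding halving_weight_def by blast
  qed
  then show "(\<integral>\<^sup>+x\<in>E. (\<Sum>i\<in>I. \<sigma> i x) \<partial>lebesgue) \<le> ennreal (1 - \<delta>) * (\<integral>\<^sup>+x\<in>Q. (\<Sum>i\<in>I. \<sigma> i x) \<partial>lebesgue)"
    using E assms(3)[OF Q] by (simp add: nn_set_integral_sum sum_distrib_left)
qed

lemma halving_weight_cmult:
  assumes "halving_weight D \<delta> \<sigma>" "\<And>Q. Q \<in> D \<Longrightarrow> Q \<in> sets lebesgue"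
  shows "halving_weight D \<delta> (\<lambda>x. c * \<sigma> x)"
  unfolding halving_weight_def
proof (intro conjI ballI impI)
  have [measurable]: "\<sigma> \<in> borel_measurable lebesgue"
    using assms by (simp add: halving_weight_def)
  show "(\<lambda>x. c * \<sigma> x) \<in> borel_measurable lebesgue" by measurable
  fix Q E assume Q: "Q \<in> D" and E: "E \<in> sets lebesgue" "E \<subseteq> Q" "2 * vol E \<le> vol Q"
  then have "(\<integral>\<^sup>+x\<in>E. \<sigma> x \<partial>lebesgue) \<le> ennreal (1 - \<delta>) * (\<integral>\<^sup>+x\<in>Q. \<sigma> x \<partial>lebesgue)"
    using assms(1) unfolding halving_weight_def by blast
  then have "c * (\<integral>\<^sup>+x\<in>E. \<sigma> x \<partial>lebesgue) \<le> c * (ennreal (1 - \<delta>) * (\<integral>\<^sup>+x\<in>Q. \<sigma> x \<partial>lebesgue))"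
    by (rule mult_left_mono) simp
  then show "(\<integral>\<^sup>+x\<in>E. c * \<sigma> x \<partial>lebesgue) \<le> ennreal (1 - \<delta>) * (\<integral>\<^sup>+x\<in>Q. c * \<sigma> x \<partial>lebesgue)"
    using E(1) assms(2)[OF Q] by (simp only: nn_set_integral_cmult \<open>\<sigma> \<in> borel_measurable lebesgue\<close> mult.left_commute)
qed

text \<open>\<open>u\<close> and \<open>v\<close> are dual bases, normalized so that \<open>A v\<close> has size at most 1 and \<open>B u\<close> size at
  most \<open>K\<close> on the average over \<open>R\<close>. They take the place of the reducing operators of \<open>A = W\<close> and
  \<open>B = W\<^sup>-\<^sup>1\<close>.\<close>

definition balanced_bases ::
  "(real^'n \<Rightarrow> real^'d^'d) \<Rightarrow> (real^'n \<Rightarrow> real^'d^'d) \<Rightarrow> real \<Rightarrow> real \<Rightarrow> (real^'n) set \<Rightarrow> bool"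
  where "balanced_bases A B p K R \<longleftrightarrow> (\<exists>u v :: 'd \<Rightarrow> real^'d.
     (\<forall>z. z = (\<Sum>i\<in>UNIV. (u i \<bullet> z) *\<^sub>R v i)) \<and> (\<forall>z. z = (\<Sum>i\<in>UNIV. (v i \<bullet> z) *\<^sub>R u i))
     \<and> (\<forall>i. (\<integral>\<^sup>+x\<in>R. ennreal (norm (A x *v v i) powr p) \<partial>lebesgue) \<le> vol R)
     \<and> (\<forall>i. (\<integral>\<^sup>+x\<in>R. ennreal (norm (B x *v u i) powr conj_exponent p) \<partial>lebesgue)
          \<le> ennreal (K powr conj_exponent p) * vol R))"

text \<open>For \<open>B\<close> the inverse of \<open>A\<close> and conjugate exponents, this is
  the p-th power of the A_p condition on a single set, multiplied by the volume.\<close>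

abbreviation (input) Ap_on ::
  "(real^'n \<Rightarrow> real^'d^'d) \<Rightarrow> (real^'n \<Rightarrow> real^'d^'d) \<Rightarrow> real \<Rightarrow> real \<Rightarrow> real \<Rightarrow> (real^'n) set \<Rightarrow> bool"
  where "Ap_on A B p q K Q \<equiv>
    (\<integral>\<^sup>+x\<in>Q. ennreal_powr (average Q (\<lambda>y. ennreal (op_norm (A x ** B y) powr q))) (p / q) \<partial>lebesgue)
      \<le> ennreal (K powr p) * vol Q"

text \<open>The inverse is a second parameter so that the locale is symmetric: exchanging
  \<open>A\<close> and \<open>B\<close> turns each result about the operator \<open>T2\<close> into
  one about \<open>T1\<close>.\<close>

locale dual_matrix_functions =
  fixes A B :: "real^'n \<Rightarrow> real^'d^'d"
  assumes A_meas [measurable]: "A \<in> borel_measurable lebesgue"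
    and B_meas [measurable]: "B \<in> borel_measurable lebesgue"
    and A_sym: "transpose (A x) = A x" and B_sym: "transpose (B x) = B x"
    and AB: "A x ** B x = mat 1"
begin

text \<open>The matrix form of \<open>1 = w * (1 / w)\<close>. Combined with Hoelder's inequality it
  supplies the lower bounds for integrals of \<open>A\<close> and \<open>B\<close>.\<close>

lemma abs_inner_le: "\<bar>u \<bullet> v\<bar> \<le> norm (A x *v v) * norm (B x *v u)"
proof -
  have "B x ** A x = mat 1" using AB matrix_left_right_inverse by blast
  then have "u \<bullet> v = u \<bullet> (B x *v (A x *v v))" by (simp add: matrix_vector_mul_assoc)
  also have "\<dots> = (B x *v u) \<bullet> (A x *v v)" by (simp add: inner_matrix_vector B_sym)
  finally show ?thesis using Cauchy_Schwarz_ineq2[of "B x *v u" "A x *v v"] by (simp add: mult.commute)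
qed

text \<open>The vector \<open>u\<close> is unrelated to \<open>Q\<close>: a weight built from the
  bases of one cube must be halving on all others. Expand \<open>u\<close> in the basis belonging to
  \<open>Q\<close>. Each coefficient is a constant inner product, so it can be estimated on
  \<open>F = Q - E\<close> alone by \<open>abs_inner_le\<close> and Hoelder's inequality; since
  \<open>F\<close> fills at least half of \<open>Q\<close>, the mass of \<open>Q\<close> is at most
  a constant times the mass of \<open>F\<close>. Thus \<open>F\<close> keeps a fixed fraction of the
  mass.\<close>

lemma halving_weight_norm:
  assumes p: "1 < p" and K: "1 \<le> K"
    and D: "\<And>Q. Q \<in> D \<Longrightarrow> nondegenerate Q"
    and bb: "\<And>Q. Q \<in> D \<Longrightarrow> balanced_bases A B p K Q"
    and q_def: "q = conj_exponent p"
    and \<delta>_def: "\<delta> = 1 / (real CARD('d) powr (q + 1) * (2 * K) powr q)"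
  shows "halving_weight D \<delta> (\<lambda>x. ennreal (norm (B x *v u) powr q))"
  unfolding halving_weight_def
proof (intro conjI ballI impI)
  define N where "N = real CARD('d)"
  have N: "1 \<le> N" by (simp add: N_def Suc_leI)
  have q: "1 < q" and qp: "q / p = q - 1" using p conj_exponent_gt_1[OF p] by (auto simp: q_def conj_exponent_def field_simps)
  let ?\<sigma> = "\<lambda>x. ennreal (norm (B x *v u) powr q)"
  show "?\<sigma> \<in> borel_measurable lebesgue" by measurable
  fix Q E assume Q: "Q \<in> D" and E [measurable]: "E \<in> sets lebesgue" and EQ: "E \<subseteq> Q"
    and small: "2 * vol E \<le> vol Q"
  have [measurable]: "Q \<in> sets lebesgue" using D[OF Q] by simp
  obtain u' v' :: "'d \<Rightarrow> real^'d" where uv: "\<And>z. z = (\<Sum>i\<in>UNIV. (v' i \<bullet> z) *\<^sub>R u' i)"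
     and v': "\<And>i. (\<integral>\<^sup>+x\<in>Q. ennreal (norm (A x *v v' i) powr p) \<partial>lebesgue) \<le> vol Q"
     and u': "\<And>i. (\<integral>\<^sup>+x\<in>Q. ennreal (norm (B x *v u' i) powr q) \<partial>lebesgue) \<le> ennreal (K powr q) * vol Q"
    using bb[OF Q] unfolding balanced_bases_def q_def[symmetric] by blast
  define F where "F = Q - E"
  have [measurable]: "F \<in> sets lebesgue" unfolding F_def by measurable
  define m e g where "m = measure lebesgue Q" and "e = measure lebesgue E" and "g = measure lebesgue F"
  have fin: "vol Q \<noteq> top" "vol E \<noteq> top" "vol F \<noteq> top"
    using D[OF Q] EQ emeasure_mono[of E Q lebesgue] emeasure_mono[of F Q lebesgue]
    by (auto simp: F_def top_unique simp del: emeasure_completion)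
  then have em: "vol Q = ennreal m" "vol E = ennreal e" "vol F = ennreal g"
    by (simp_all add: m_def e_def g_def emeasure_eq_ennreal_measure del: emeasure_completion)
  have ge: "0 \<le> e" "0 \<le> g" "0 \<le> m" by (auto simp: e_def g_def m_def)
  have m: "0 < m" using D[OF Q] em by (simp del: emeasure_completion)
  have "vol Q = vol E + vol F"
    unfolding F_def using EQ by (subst plus_emeasure) (auto simp: Un_absorb1)
  then have meg: "m = e + g" using em ge by (simp flip: ennreal_plus del: emeasure_completion)
  have "2 * e \<le> m" using small ge m unfolding em by (simp flip: ennreal_mult' ennreal_numeral)
  then have mg: "m \<le> 2 * g" using meg by simp
  define \<sigma>F where "\<sigma>F = (\<integral>\<^sup>+x\<in>F. ?\<sigma> x \<partial>lebesgue)"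
  let ?c = "\<lambda>i. \<bar>v' i \<bullet> u\<bar>" and ?a = "\<lambda>x i. norm (A x *v v' i)" and ?b = "\<lambda>x i. norm (B x *v u' i)"
  have coeff: "ennreal (?c i powr q * m) \<le> ennreal (2 powr q) * \<sigma>F" for i
  proof -
    have "ennreal (?c i * g) = (\<integral>\<^sup>+x\<in>F. ennreal (?c i) \<partial>lebesgue)"
      using em ge by (simp add: nn_integral_cmult_indicator ennreal_mult del: emeasure_completion)
    also have "\<dots> \<le> (\<integral>\<^sup>+x\<in>F. ennreal (?a x i) * ennreal (norm (B x *v u)) \<partial>lebesgue)"
      using abs_inner_le[of u "v' i"] by (intro nn_set_integral_mono) (simp add: inner_commute ennreal_leI flip: ennreal_mult')
    also have "\<dots> \<le> ennreal_powr (\<integral>\<^sup>+x\<in>F. ennreal_powr (ennreal (?a x i)) p \<partial>lebesgue) (1/p)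
      * ennreal_powr (\<integral>\<^sup>+x\<in>F. ennreal_powr (ennreal (norm (B x *v u))) q \<partial>lebesgue) (1/q)"
      unfolding q_def by (rule nn_set_integral_Holder[OF p]) measurable
    also have "\<dots> \<le> ennreal_powr (ennreal m) (1/p) * ennreal_powr \<sigma>F (1/q)"
    proof (intro mult_mono ennreal_powr_mono)
      have "(\<integral>\<^sup>+x\<in>F. ennreal_powr (ennreal (?a x i)) p \<partial>lebesgue)
        \<le> (\<integral>\<^sup>+x\<in>Q. ennreal (?a x i powr p) \<partial>lebesgue)"
        by (intro nn_integral_mono) (auto simp: indicator_def F_def)
      also have "\<dots> \<le> ennreal m" using v'[of i] unfolding em .
      finally show "(\<integral>\<^sup>+x\<in>F. ennreal_powr (ennreal (?a x i)) p \<partial>lebesgue) \<le> ennreal m" .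
    qed (use p q in \<open>auto simp: \<sigma>F_def\<close>)
    finally have le: "ennreal (?c i * g) \<le> ennreal_powr (ennreal m) (1/p) * ennreal_powr \<sigma>F (1/q)" .
    have "ennreal (?c i * m) \<le> 2 * ennreal (?c i * g)"
      using mg ge mult_left_mono[OF mg, of "?c i"] by (simp add: ac_simps ennreal_leI flip: ennreal_mult' ennreal_numeral)
    also have "\<dots> \<le> 2 * (ennreal_powr (ennreal m) (1/p) * ennreal_powr \<sigma>F (1/q))" by (intro mult_left_mono le) simp
    finally have "ennreal_powr (ennreal (?c i * m)) q \<le> ennreal_powr (2 * (ennreal_powr (ennreal m) (1/p) * ennreal_powr \<sigma>F (1/q))) q"
      using q by (intro ennreal_powr_mono) auto
    also have "\<dots> = ennreal (2 powr q) * (ennreal (m powr (q - 1)) * \<sigma>F)"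
      using q qp m by (simp add: ennreal_powr_mult ennreal_powr_powr powr_powr flip: ennreal_numeral)
    also have "ennreal_powr (ennreal (?c i * m)) q = ennreal (m powr (q - 1)) * ennreal (?c i powr q * m)"
      using m q by (simp add: powr_mult powr_diff flip: ennreal_mult')
    finally have "ennreal (m powr (q - 1)) * ennreal (?c i powr q * m) \<le> ennreal (m powr (q - 1)) * (ennreal (2 powr q) * \<sigma>F)"
      by (simp only: ac_simps)
    then show ?thesis using m by (subst (asm) ennreal_mult_le_mult_iff) (auto simp: powr_gt_zero)
  qed
  let ?m = "\<lambda>A. \<integral>\<^sup>+x\<in>A. ?\<sigma> x \<partial>lebesgue"
  \<comment> \<open>In this constant, \<open>N powr q\<close> comes from the power of a sum of
    \<open>N\<close> terms, a further \<open>N\<close> from their number, \<open>K powr q\<close>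
    from the basis vectors and \<open>2 powr q\<close> from the volume of \<open>F\<close> being at
    least half that of \<open>Q\<close>.\<close>
  define c where "c = N powr (q + 1) * (2 * K) powr q"
  have "?m Q \<le>
     (\<integral>\<^sup>+x\<in>Q. ennreal (N powr q) * (\<Sum>i\<in>UNIV. ennreal (?c i powr q) * ennreal (?b x i powr q)) \<partial>lebesgue)"
  proof (rule nn_set_integral_mono)
    fix x
    have "norm (B x *v u) = norm (\<Sum>i\<in>UNIV. (v' i \<bullet> u) *\<^sub>R (B x *v u' i))"
      by (subst uv[of u]) (simp add: matrix_vector_mult_sum scaleR_matrix_vector_assoc matrix_vector_mult_scaleR)
    also have "\<dots> \<le> (\<Sum>i\<in>UNIV. ?c i * ?b x i)" by (rule order_trans[OF norm_sum]) simp
    finally have "ennreal (norm (B x *v u)) \<le> (\<Sum>i\<in>UNIV. ennreal (?c i * ?b x i))"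
      by (simp add: sum_ennreal ennreal_leI)
    then have "ennreal_powr (ennreal (norm (B x *v u))) q \<le> ennreal_powr (\<Sum>i\<in>UNIV. ennreal (?c i * ?b x i)) q"
      using q by (intro ennreal_powr_mono) auto
    also have "\<dots> \<le> ennreal_powr (of_nat CARD('d)) q * (\<Sum>i\<in>UNIV. ennreal_powr (ennreal (?c i * ?b x i)) q)"
      using q by (intro ennreal_powr_sum_le) auto
    also have "\<dots> = ennreal (N powr q) * (\<Sum>i\<in>UNIV. ennreal (?c i powr q) * ennreal (?b x i powr q))"
      by (simp add: N_def ennreal_of_nat_eq_real_of_nat powr_mult del: sum_ennreal) (simp add: ennreal_mult del: sum_ennreal)
    finally show "?\<sigma> x \<le> ennreal (N powr q) * (\<Sum>i\<in>UNIV. ennreal (?c i powr q) * ennreal (?b x i powr q))"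
      by simp
  qed
  also have "\<dots> = ennreal (N powr q) * (\<Sum>i\<in>UNIV. ennreal (?c i powr q) * (\<integral>\<^sup>+x\<in>Q. ennreal (?b x i powr q) \<partial>lebesgue))"
    by (simp add: nn_set_integral_cmult nn_set_integral_sum del: sum_ennreal)
  also have "\<dots> \<le> ennreal (N powr q) * (\<Sum>i\<in>(UNIV::'d set). ennreal (K powr q) * (ennreal (2 powr q) * \<sigma>F))"
  proof (intro mult_left_mono sum_mono)
    fix i
    have "ennreal (?c i powr q) * (\<integral>\<^sup>+x\<in>Q. ennreal (?b x i powr q) \<partial>lebesgue)
      \<le> ennreal (?c i powr q) * (ennreal (K powr q) * ennreal m)"
      using u'[of i] unfolding em by (intro mult_left_mono) auto
    also have "\<dots> = ennreal (K powr q) * ennreal (?c i powr q * m)" using m by (simp add: ennreal_mult' ac_simps)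
    also have "\<dots> \<le> ennreal (K powr q) * (ennreal (2 powr q) * \<sigma>F)" by (intro mult_left_mono coeff) simp
    finally show "ennreal (?c i powr q) * (\<integral>\<^sup>+x\<in>Q. ennreal (?b x i powr q) \<partial>lebesgue)
      \<le> ennreal (K powr q) * (ennreal (2 powr q) * \<sigma>F)" .
  qed auto
  also have "\<dots> = ennreal c * \<sigma>F"
  proof -
    have "c = N powr q * (N * (K powr q * 2 powr q))" using N K by (simp add: c_def powr_add powr_mult)
    then show ?thesis using N
      by (simp add: ennreal_mult' ennreal_of_nat_eq_real_of_nat mult.assoc flip: N_def)
  qed
  finally have main: "?m Q \<le> ennreal c * \<sigma>F" .
  have "1 powr (q+1) * 2 powr q \<le> c" unfolding c_def using N K q by (intro mult_mono powr_mono2) auto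
  moreover have "2 powr 1 \<le> 2 powr q" using q by (intro powr_mono) auto
  ultimately have c: "2 \<le> c" by simp
  have \<delta>: "\<delta> = 1 / c" by (simp add: \<delta>_def c_def N_def)
  have split: "?m Q = \<sigma>F + ?m E"
    unfolding \<sigma>F_def F_def using EQ by (intro nn_set_integral_Diff) measurable
  show "?m E \<le> ennreal (1 - \<delta>) * ?m Q"
  \<comment> \<open>An infinite mass cannot be subtracted. In that case the right side is infinite,
    because \<open>c \<ge> 2\<close> makes \<open>1 - \<delta>\<close> positive.\<close>
  proof (cases "?m Q = top")
    case True
    then show ?thesis using c by (simp add: \<delta> ennreal_mult_top)
  next
    case False
    then obtain s t where st: "\<sigma>F = ennreal s" "0 \<le> s" "?m E = ennreal t" "0 \<le> t"
      unfolding split by (cases \<sigma>F; cases "?m E") auto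
    have "s + t \<le> c * s" using main st c unfolding split by (simp flip: ennreal_plus ennreal_mult')
    then have "t \<le> (1 - \<delta>) * (s + t)" using c by (simp add: \<delta> field_simps)
    then show ?thesis using st c unfolding split by (simp add: \<delta> flip: ennreal_plus ennreal_mult')
  qed
qed


abbreviation (input) kernel :: "real^'n \<Rightarrow> real^'n \<Rightarrow> ennreal" where
  "kernel x y \<equiv> ennreal (op_norm (A x ** B y))"

text \<open>The expansion in the dual bases is inserted between the two matrices, and the symmetry
  of \<open>B y\<close> moves this matrix onto the basis vector.\<close>

lemma op_norm_kernel_le:
  assumes "\<And>z. z = (\<Sum>i\<in>UNIV. (u i \<bullet> z) *\<^sub>R v i)"
  shows "op_norm (A x ** B y) \<le> (\<Sum>i\<in>UNIV. norm (A x *v v i) * norm (B y *v u i))"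
proof (rule op_norm_le)
  fix z
  have "(A x ** B y) *v z = A x *v (\<Sum>i\<in>UNIV. (u i \<bullet> (B y *v z)) *\<^sub>R v i)"
    by (subst assms[symmetric]) (simp add: matrix_vector_mul_assoc)
  also have "\<dots> = (\<Sum>i\<in>UNIV. ((B y *v u i) \<bullet> z) *\<^sub>R (A x *v v i))"
    by (simp add: matrix_vector_mult_sum matrix_vector_mult_scaleR inner_matrix_vector[of _ "B y"] B_sym)
  also have "norm \<dots> \<le> (\<Sum>i\<in>UNIV. norm (A x *v v i) * norm (B y *v u i) * norm z)"
  proof (rule sum_norm_le)
    fix i
    show "norm (((B y *v u i) \<bullet> z) *\<^sub>R (A x *v v i)) \<le> norm (A x *v v i) * norm (B y *v u i) * norm z"
      using mult_left_mono[OF Cauchy_Schwarz_ineq2[of "B y *v u i" z], of "norm (A x *v v i)"]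
      by (simp add: ac_simps)
  qed
  finally show "norm ((A x ** B y) *v z) \<le> (\<Sum>i\<in>UNIV. norm (A x *v v i) * norm (B y *v u i)) * norm z"
    by (simp add: sum_distrib_right)
qed (simp add: sum_nonneg)

lemma local_factorization_kernel:
  assumes p: "1 < p" and K: "1 \<le> K"
    and D: "\<And>Q. Q \<in> D \<Longrightarrow> nondegenerate Q"
    and bb: "\<And>Q. Q \<in> D \<Longrightarrow> balanced_bases A B p K Q"
    and q_def: "q = conj_exponent p" and N_def: "N = real CARD('d)"
    and R: "R \<in> D"
  shows "local_factorization D p (1 / (N powr (q + 1) * (2 * K) powr q))
     (N powr ((p + 1) / p * q + q + 1) * K powr q) kernel R"
proof -
  have N: "1 \<le> N" by (simp add: N_def Suc_leI)
  have q: "1 < q" using p conj_exponent_gt_1[OF p] by (auto simp: q_def)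
  have [measurable]: "R \<in> sets lebesgue" using D[OF R] by simp
  obtain u v :: "'d \<Rightarrow> real^'d" where uv: "\<And>z. z = (\<Sum>i\<in>UNIV. (u i \<bullet> z) *\<^sub>R v i)"
     and v: "\<And>i. (\<integral>\<^sup>+x\<in>R. ennreal (norm (A x *v v i) powr p) \<partial>lebesgue) \<le> vol R"
     and u: "\<And>i. (\<integral>\<^sup>+x\<in>R. ennreal (norm (B x *v u i) powr q) \<partial>lebesgue) \<le> ennreal (K powr q) * vol R"
    using bb[OF R] unfolding balanced_bases_def q_def[symmetric] by blast
  \<comment> \<open>Chosen to normalize \<alpha>: the p-th power of a sum of \<open>N\<close> terms
    costs \<open>N powr p\<close>, their number costs \<open>N\<close>, and
    \<open>(1 / c) powr p\<close> cancels both.\<close>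
  define c where "c = N powr ((p + 1) / p)"
  have c: "0 < c" using N by (simp add: c_def)
  let ?a = "\<lambda>x i. norm (A x *v v i)" and ?b = "\<lambda>x i. norm (B x *v u i)" and ?C = "ennreal ((1 / c) powr p * N powr p)"
  define \<alpha> where "\<alpha> = (\<lambda>x. ennreal (1 / c) * (\<Sum>i\<in>UNIV. ennreal (?a x i)))"
  \<comment> \<open>The factor \<open>(c * N) powr q\<close> restores the \<open>c\<close> taken out
    of \<alpha> and pays for the q-th power of the sum, so that \<sigma> can be a sum of
    powers.\<close>
  define \<sigma> where "\<sigma> = (\<lambda>x. ennreal ((c * N) powr q) * (\<Sum>i\<in>UNIV. ennreal (?b x i powr q)))"
  let ?\<delta> = "1 / (N powr (q + 1) * (2 * K) powr q)"
  show ?thesis unfolding local_factorization_def q_def[symmetric]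
  proof (rule exI[of _ \<alpha>], rule exI[of _ \<sigma>], intro conjI ballI)
    show "\<alpha> \<in> borel_measurable lebesgue" unfolding \<alpha>_def by measurable
    \<comment> \<open>The halving inequality is linear in the weight, so summing over the basis
      vectors keeps the same \<delta>. The q-th power of the sum of norms would not have this
      form.\<close>
    show "halving_weight D ?\<delta> \<sigma>" unfolding \<sigma>_def
      using D by (intro halving_weight_cmult halving_weight_sum halving_weight_norm[OF p K D bb q_def])
        (auto simp: N_def)
    have pow_sum: "ennreal_powr (\<Sum>i\<in>UNIV. ennreal (f i)) s \<le> ennreal (N powr s) * (\<Sum>i\<in>UNIV. ennreal (f i powr s))"
      if "0 < s" "\<And>i. 0 \<le> f i" for f :: "'d \<Rightarrow> real" and s
      using ennreal_powr_sum_le[of "UNIV :: 'd set" s "\<lambda>i. ennreal (f i)"] that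
      by (simp add: N_def ennreal_of_nat_eq_real_of_nat)
    have "(\<integral>\<^sup>+x\<in>R. ennreal_powr (\<alpha> x) p \<partial>lebesgue)
       \<le> (\<integral>\<^sup>+x\<in>R. ?C * (\<Sum>i\<in>UNIV. ennreal (?a x i powr p)) \<partial>lebesgue)"
    proof (rule nn_set_integral_mono)
      fix x
      have "ennreal_powr (\<alpha> x) p = ennreal ((1 / c) powr p) * ennreal_powr (\<Sum>i\<in>UNIV. ennreal (?a x i)) p"
        using p c by (simp add: \<alpha>_def ennreal_powr_mult del: sum_ennreal)
      also have "\<dots> \<le> ennreal ((1 / c) powr p) * (ennreal (N powr p) * (\<Sum>i\<in>UNIV. ennreal (?a x i powr p)))"
        using p by (intro mult_left_mono pow_sum) auto
      finally show "ennreal_powr (\<alpha> x) p \<le> ?C * (\<Sum>i\<in>UNIV. ennreal (?a x i powr p))"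
        by (simp add: ennreal_mult mult.assoc)
    qed
    also have "\<dots> = ?C * (\<Sum>i\<in>UNIV. \<integral>\<^sup>+x\<in>R. ennreal (?a x i powr p) \<partial>lebesgue)"
      by (simp add: nn_set_integral_cmult nn_set_integral_sum del: sum_ennreal)
    also have "\<dots> \<le> ?C * (\<Sum>i\<in>(UNIV::'d set). vol R)"
      by (intro mult_left_mono sum_mono v) simp
    also have "\<dots> = ennreal ((1 / c) powr p * N powr p * N) * vol R"
      using N by (simp add: ennreal_mult ennreal_of_nat_eq_real_of_nat mult.assoc del: emeasure_completion flip: N_def)
    also have "(1 / c) powr p * N powr p * N = 1"
      using N p by (simp add: c_def powr_divide powr_powr powr_add)
    finally show "(\<integral>\<^sup>+x\<in>R. ennreal_powr (\<alpha> x) p \<partial>lebesgue) \<le> vol R" by simp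
    have "(\<integral>\<^sup>+x\<in>R. \<sigma> x \<partial>lebesgue) = ennreal ((c * N) powr q) * (\<Sum>i\<in>UNIV. \<integral>\<^sup>+x\<in>R. ennreal (?b x i powr q) \<partial>lebesgue)"
      unfolding \<sigma>_def by (simp add: nn_set_integral_cmult nn_set_integral_sum del: sum_ennreal)
    also have "\<dots> \<le> ennreal ((c * N) powr q) * (\<Sum>i\<in>(UNIV::'d set). ennreal (K powr q) * vol R)"
      by (intro mult_left_mono sum_mono u) simp
    also have "\<dots> = ennreal ((c * N) powr q * N * K powr q) * vol R"
      using N by (simp add: ennreal_mult ennreal_of_nat_eq_real_of_nat mult.assoc del: emeasure_completion flip: N_def)
    also have "(c * N) powr q * N * K powr q = N powr ((p + 1) / p * q + q + 1) * K powr q"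
      using N by (simp add: c_def powr_mult powr_powr powr_add)
    finally show "(\<integral>\<^sup>+x\<in>R. \<sigma> x \<partial>lebesgue) \<le> ennreal (N powr ((p + 1) / p * q + q + 1) * K powr q) * vol R" .
    fix x y
    have "ennreal_powr (ennreal c * (\<Sum>i\<in>UNIV. ennreal (?b y i))) q \<le> \<sigma> y"
    proof -
      have "ennreal_powr (ennreal c * (\<Sum>i\<in>UNIV. ennreal (?b y i))) q =
        ennreal (c powr q) * ennreal_powr (\<Sum>i\<in>UNIV. ennreal (?b y i)) q"
        using q c by (simp add: ennreal_powr_mult del: sum_ennreal)
      also have "\<dots> \<le> ennreal (c powr q) * (ennreal (N powr q) * (\<Sum>i\<in>UNIV. ennreal (?b y i powr q)))"
        using q by (intro mult_left_mono pow_sum) auto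
      also have "\<dots> = \<sigma> y" using c N by (simp add: \<sigma>_def powr_mult ennreal_mult mult.assoc)
      finally show ?thesis .
    qed
    then have "ennreal_powr (ennreal_powr (ennreal c * (\<Sum>i\<in>UNIV. ennreal (?b y i))) q) (1/q) \<le> ennreal_powr (\<sigma> y) (1/q)"
      using q by (intro ennreal_powr_mono) auto
    then have \<sigma>: "ennreal c * (\<Sum>i\<in>UNIV. ennreal (?b y i)) \<le> ennreal_powr (\<sigma> y) (1/q)"
      using q by (simp add: ennreal_powr_powr del: sum_ennreal)
    have "op_norm (A x ** B y) \<le> (\<Sum>i\<in>UNIV. ?a x i * ?b y i)" by (rule op_norm_kernel_le[OF uv])
    \<comment> \<open>The diagonal sum is enlarged to the full double sum, which is a product of a
      function of \<open>x\<close> and a function of \<open>y\<close>.\<close>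
    also have "\<dots> \<le> (\<Sum>i\<in>UNIV. ?a x i * (\<Sum>j\<in>UNIV. ?b y j))"
      by (intro sum_mono mult_left_mono member_le_sum) auto
    also have "\<dots> = (1 / c * (\<Sum>i\<in>UNIV. ?a x i)) * (c * (\<Sum>j\<in>UNIV. ?b y j))"
      using c by (simp flip: sum_distrib_right)
    finally have "kernel x y \<le> ennreal ((1 / c * (\<Sum>i\<in>UNIV. ?a x i)) * (c * (\<Sum>j\<in>UNIV. ?b y j)))"
      by (rule ennreal_leI)
    also have "\<dots> = \<alpha> x * (ennreal c * (\<Sum>i\<in>UNIV. ennreal (?b y i)))"
    proof -
      have pos: "0 \<le> (\<Sum>i\<in>UNIV. ?a x i)" "0 \<le> (\<Sum>j\<in>UNIV. ?b y j)" "0 \<le> 1 / c" "0 \<le> c"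
        using c by (auto intro: sum_nonneg)
      show ?thesis
        unfolding ennreal_mult[OF mult_nonneg_nonneg[OF pos(3,1)] mult_nonneg_nonneg[OF pos(4,2)]]
          ennreal_mult[OF pos(3,1)] ennreal_mult[OF pos(4,2)]
        by (simp add: \<alpha>_def)
    qed
    also have "\<dots> \<le> \<alpha> x * ennreal_powr (\<sigma> y) (1/q)" by (intro mult_left_mono \<sigma>) simp
    finally show "kernel x y \<le> \<alpha> x * ennreal_powr (\<sigma> y) (1/q)" .
  qed
qed

end

text \<open>The constant of \<open>sparse_maximal_bound\<close> for the \<delta> and
  \<open>L\<close> of \<open>local_factorization_kernel\<close>, with the powers of \<open>K\<close>
  divided out.\<close>

definition maximal_const :: "real \<Rightarrow> real \<Rightarrow> real" where
  "maximal_const p N = (let q = conj_exponent p in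
     4 powr p * (2 * N powr ((p + 1) / p * q + q + 1)) powr (p - 1) * ((p + 2) / (p - 1)) * (N powr (q + 1) * 2 powr q))"

lemma maximal_const_nonneg: "1 < p \<Longrightarrow> 0 \<le> maximal_const p N"
  by (simp add: maximal_const_def Let_def)

context dual_matrix_functions
begin

lemma finite_laminar_maximal_bound:
  assumes p: "1 < p" and K: "1 \<le> K"
    and D: "finite D" "laminar D"
      "\<And>Q. Q \<in> D \<Longrightarrow> nondegenerate Q"
    and bb: "\<And>Q. Q \<in> D \<Longrightarrow> balanced_bases A B p K Q"
    and f: "f \<in> borel_measurable lebesgue"
  shows "(\<integral>\<^sup>+x. ennreal_powr (SUP Q\<in>{Q\<in>D. x \<in> Q}. average Q (\<lambda>y. ennreal (op_norm (A x ** B y)) * f y)) p \<partial>lebesgue)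
     \<le> ennreal (maximal_const p (real CARD('d)) * K powr (p + conj_exponent p)) * (\<integral>\<^sup>+x. ennreal_powr (f x) p \<partial>lebesgue)"
proof -
  define q where "q = conj_exponent p"
  define N where "N = real CARD('d)"
  define \<delta> where "\<delta> = 1 / (N powr (q + 1) * (2 * K) powr q)"
  define L where "L = N powr ((p + 1) / p * q + q + 1) * K powr q"
  have N: "1 \<le> N" by (simp add: N_def Suc_leI)
  have q: "1 < q" using p conj_exponent_gt_1[OF p] by (auto simp: q_def)
  have qp: "q * (p - 1) = p" using p by (simp add: q_def conj_exponent_def)
  have "1 powr (q+1) * 1 powr q \<le> N powr (q + 1) * (2 * K) powr q"
    using N K q by (intro mult_mono powr_mono2) auto
  then have \<delta>: "0 < \<delta>" "\<delta> \<le> 1" using N K by (auto simp: \<delta>_def)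
  have L: "0 \<le> L" by (simp add: L_def)
  have "local_factorization D p \<delta> L kernel R" if "R \<in> D" for R
    unfolding \<delta>_def L_def using local_factorization_kernel[OF p K D(3) bb q_def N_def that] .
  note sparse_maximal_bound[OF p \<delta> L D this f]
  also have "4 powr p * (2 * L) powr (p - 1) * ((p + 2) / ((p - 1) * \<delta>)) = maximal_const p N * K powr (p + q)"
  proof -
    have "(2 * L) powr (p - 1) = (2 * N powr ((p + 1) / p * q + q + 1)) powr (p - 1) * K powr p"
      using N K qp by (simp add: L_def powr_mult powr_powr)
    moreover have "(p + 2) / ((p - 1) * \<delta>) = (p + 2) / (p - 1) * (N powr (q + 1) * 2 powr q) * K powr q"
      using K by (simp add: \<delta>_def powr_mult)
    ultimately show ?thesis
      by (simp only: maximal_const_def Let_def q_def[symmetric] powr_add ac_simps)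
  qed
  finally show ?thesis by (simp add: N_def q_def)
qed

end

section \<open>Balanced dual bases from the A_p condition\<close>

text \<open>A near maximizer of the determinant among matrices with rows in \<open>S\<close>: replacing a row by
  \<open>z \<in> S\<close> multiplies the determinant by a coordinate of \<open>z\<close> (Auerbach's argument).\<close>

lemma almost_Auerbach_basis:
  fixes S :: "(real^'d) set"
  assumes "bounded S" and t: "0 < t" "\<And>i. axis i t \<in> S"
  obtains u v :: "'d \<Rightarrow> real^'d"
  where "\<And>i. u i \<in> S" "\<And>z. z = (\<Sum>i\<in>UNIV. (u i \<bullet> z) *\<^sub>R v i)" "\<And>z. z = (\<Sum>i\<in>UNIV. (v i \<bullet> z) *\<^sub>R u i)"
    "\<And>z i. z \<in> S \<Longrightarrow> \<bar>v i \<bullet> z\<bar> \<le> 2" "\<And>i. u i \<bullet> v i = 1"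
proof -
  define T where "T = {\<bar>det U\<bar> | U :: real^'d^'d. \<forall>i. U $ i \<in> S}"
  obtain M where M: "\<And>z. z \<in> S \<Longrightarrow> norm z \<le> M" "0 < M" using assms(1) bounded_pos by metis
  have bound: "\<bar>det U\<bar> \<le> real (card {p. p permutes (UNIV::'d set)}) * M ^ CARD('d)" if U: "\<And>i. U $ i \<in> S" for U :: "real^'d^'d"
  proof -
    have "\<bar>of_int (sign p) * (\<Prod>i\<in>UNIV. U $ i $ p i)\<bar> \<le> M ^ CARD('d)" for p
    proof -
      have "\<bar>of_int (sign p) * (\<Prod>i\<in>UNIV. U $ i $ p i)\<bar> = (\<Prod>i\<in>UNIV. \<bar>U $ i $ p i\<bar>)"
        by (simp add: abs_mult abs_prod sign_def)
      also have "\<dots> \<le> (\<Prod>i\<in>(UNIV::'d set). M)"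
        using order_trans[OF component_le_norm_cart M(1)[OF U]] by (intro prod_mono) auto
      finally show ?thesis by simp
    qed
    then have "\<bar>det U\<bar> \<le> (\<Sum>p\<in>{p. p permutes (UNIV::'d set)}. M ^ CARD('d))"
      unfolding det_def by (intro order_trans[OF sum_abs] sum_mono) auto
    then show ?thesis by simp
  qed
  have bdd: "bdd_above T" unfolding T_def bdd_above_def using bound by blast
  have "\<bar>det ((\<chi> i. axis i t) :: real^'d^'d)\<bar> \<in> T" unfolding T_def using t by auto
  moreover have "det ((\<chi> i. axis i t) :: real^'d^'d) = t ^ CARD('d)"
    by (subst det_diagonal) (auto simp: axis_def)
  ultimately have "t ^ CARD('d) \<in> T" using t by simp
  then have s: "0 < Sup T" using cSup_upper[OF _ bdd] t by (meson zero_less_power less_le_trans)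
  \<comment> \<open>The set \<open>S\<close> need not be closed, so the supremum may not be
    attained. Settling for more than half of it is the origin of the bound 2 on the
    coordinates.\<close>
  then have "\<exists>x\<in>T. Sup T / 2 < x" using \<open>t ^ CARD('d) \<in> T\<close> less_cSup_iff[of T "Sup T / 2"] bdd by auto
  then obtain U :: "real^'d^'d" where U: "\<And>i. U $ i \<in> S" "Sup T / 2 < \<bar>det U\<bar>"
    unfolding T_def by auto
  have d: "det U \<noteq> 0" using U(2) s by auto
  then obtain V where V: "U ** V = mat 1" "V ** U = mat 1"
    unfolding invertible_det_nz[symmetric] invertible_def by auto
  have expand: "z = (\<Sum>i\<in>UNIV. (transpose V $ i \<bullet> z) *\<^sub>R U $ i)" for z
  proof -
    have "z = transpose (V ** U) *v z" by (simp add: V transpose_mat)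
    also have "\<dots> = transpose U *v (transpose V *v z)" by (simp only: matrix_transpose_mul matrix_vector_mul_assoc)
    also have "\<dots> = (\<Sum>i\<in>UNIV. (transpose V $ i \<bullet> z) *\<^sub>R U $ i)"
      unfolding matrix_mult_sum[of "transpose U"] matrix_vector_mul_component
      by (simp add: scalar_mult_eq_scaleR row_def)
    finally show ?thesis .
  qed
  show thesis
  proof (rule that[of "\<lambda>i. U $ i" "\<lambda>i. transpose V $ i"])
    show "U $ i \<in> S" for i by (rule U)
    show "z = (\<Sum>i\<in>UNIV. (transpose V $ i \<bullet> z) *\<^sub>R U $ i)" for z by (rule expand)
    show "z = (\<Sum>i\<in>UNIV. (U $ i \<bullet> z) *\<^sub>R transpose V $ i)" for z
    proof -
      have "z = V *v (U *v z)" by (simp add: V matrix_vector_mul_assoc)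
      also have "\<dots> = (\<Sum>i\<in>UNIV. (U $ i \<bullet> z) *\<^sub>R transpose V $ i)"
        unfolding matrix_mult_sum[of V] matrix_vector_mul_component
        by (simp add: scalar_mult_eq_scaleR column_def transpose_def)
      finally show ?thesis .
    qed
    show "U $ i \<bullet> transpose V $ i = 1" for i
    proof -
      have "(U ** V) $ i $ i = 1" by (simp add: V mat_def)
      then show ?thesis by (simp add: matrix_matrix_mult_def inner_vec_def transpose_def)
    qed
    show "\<bar>transpose V $ i \<bullet> z\<bar> \<le> 2" if z: "z \<in> S" for z i
    proof -
      let ?x = "\<chi> i. transpose V $ i \<bullet> z"
      let ?U = "\<chi> j. if j = i then z else U $ j"
      have "det ?U = (transpose V $ i \<bullet> z) * det U"
      proof -
        have "(\<Sum>j\<in>UNIV. ?x $ j *s row j U) = (\<Sum>j\<in>UNIV. (transpose V $ j \<bullet> z) *\<^sub>R U $ j)"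
          by (simp add: scalar_mult_eq_scaleR row_def)
        also have "\<dots> = z" by (rule expand[symmetric])
        finally have z: "(\<Sum>j\<in>UNIV. ?x $ j *s row j U) = z" .
        have row: "row j U = U $ j" for j by (simp add: row_def)
        show ?thesis using cramer_lemma_transpose[of i ?x U] unfolding z unfolding row by simp
      qed
      moreover have "\<bar>det ?U\<bar> \<le> Sup T"
        using z U(1) by (intro cSup_upper[OF _ bdd]) (auto simp: T_def intro!: exI[of _ ?U])
      ultimately have "\<bar>transpose V $ i \<bullet> z\<bar> * \<bar>det U\<bar> \<le> 2 * \<bar>det U\<bar>" using U(2) by (simp add: abs_mult)
      then show ?thesis using d by simp
    qed
  qed
qed

text \<open>Needed for the measurability of integrals that depend on a parameter, and for the
  strictly positive integrable function that starts the iteration.\<close>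

lemma sigma_finite_lebesgue: "sigma_finite_measure (lebesgue :: 'a::euclidean_space measure)"
proof -
  obtain A :: "'a set set" where "countable A" "A \<subseteq> sets lborel" "\<Union>A = space lborel"
      "\<forall>a\<in>A. emeasure lborel a \<noteq> \<infinity>"
    using lborel.sigma_finite_countable by blast
  then show ?thesis
    by unfold_locales (intro exI[of _ A], auto simp: subset_iff)
qed

context dual_matrix_functions
begin

lemma BA: "B x ** A x = mat 1"
  using AB matrix_left_right_inverse by blast

lemma norm_A_pos: "z \<noteq> 0 \<Longrightarrow> 0 < norm (A x *v z)"
  by (metis BA matrix_vector_mul_assoc matrix_vector_mul_lid matrix_vector_mult_0_right zero_less_norm_iff)

lemma op_norm_A_pos: "0 < op_norm (A x)"
  using norm_A_pos[of "axis undefined 1" x] norm_matrix_vector_le[of "A x" "axis undefined 1"]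
  by (simp add: axis_eq_0_iff) (metis norm_ge_zero zero_less_norm_iff less_le_trans)

lemma op_norm_BA: "op_norm (B y ** A x) = op_norm (A x ** B y)"
  by (metis A_sym B_sym matrix_transpose_mul op_norm_transpose)

text \<open>An almost Auerbach basis is taken for the set \<open>S\<close> where the average of
  \<open>norm (B y *v z) powr q\<close> is at most 1. The functionals \<open>v i\<close> are then
  bounded by that average for every \<open>z\<close>. Testing with a vector in the image of
  \<open>A x\<close> bounds \<open>A x *v v i\<close> pointwise by the inner A_p average, and the
  outer integral finishes the estimate. One pair of bases serves both orders of \<open>A\<close> and
  \<open>B\<close>, so the dual A_p condition is never established separately.\<close>

lemma balanced_bases_of_Ap:
  assumes p: "1 < p" and q_def: "q = conj_exponent p" and K: "0 \<le> K"
    and R [measurable]: "R \<in> sets lebesgue" and R0: "0 < vol R" "vol R < \<infinity>"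
    and Ap: "Ap_on A B p q K R"
  shows "balanced_bases B A q (2 * K) R" "balanced_bases A B p (2 * K) R" "1 \<le> 2 * K"
proof -
  have q: "1 < q" using p conj_exponent_gt_1[OF p] by (auto simp: q_def)
  define m where "m = measure lebesgue R"
  have m: "vol R = ennreal m"
    unfolding m_def by (rule emeasure_eq_ennreal_measure) (use R0 in auto)
  have "0 < m" using R0(1) unfolding m by simp
  note m = m this
  let ?k = "\<lambda>x y. ennreal (op_norm (A x ** B y) powr q)"
  define I where "I x = average R (\<lambda>y. ?k x y)" for x
  have I_int: "(\<integral>\<^sup>+y\<in>R. ?k x y \<partial>lebesgue) = I x * ennreal m" for x
    unfolding I_def m(1)[symmetric] by (rule average_times_emeasure[symmetric]) (use R0 in auto)
  define \<nu> where "\<nu> z = (\<integral>\<^sup>+y\<in>R. ennreal (norm (B y *v z) powr q) \<partial>lebesgue)" for z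
  have \<nu>_scale: "\<nu> (t *\<^sub>R z) = ennreal (\<bar>t\<bar> powr q) * \<nu> z" for t z
    unfolding \<nu>_def
    by (simp add: matrix_vector_mult_scaleR powr_mult ennreal_mult nn_set_integral_cmult)
  have \<nu>_le: "\<nu> (A x *v z) \<le> ennreal (norm z powr q) * (I x * ennreal m)" for x z
  proof -
    have "\<nu> (A x *v z) \<le> (\<integral>\<^sup>+y\<in>R. ennreal (norm z powr q) * ?k x y \<partial>lebesgue)"
      unfolding \<nu>_def
    proof (rule nn_set_integral_mono)
      fix y
      have "norm (B y *v (A x *v z)) \<le> op_norm (A x ** B y) * norm z"
        using norm_matrix_vector_le[of "B y ** A x" z] by (simp add: matrix_vector_mul_assoc op_norm_BA)
      then have "norm (B y *v (A x *v z)) powr q \<le> (op_norm (A x ** B y) * norm z) powr q"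
        using q by (intro powr_mono2) auto
      then show "ennreal (norm (B y *v (A x *v z)) powr q) \<le> ennreal (norm z powr q) * ?k x y"
        by (simp add: powr_mult mult.commute ennreal_leI flip: ennreal_mult)
    qed
    also have "\<dots> = ennreal (norm z powr q) * (I x * ennreal m)"
      unfolding I_int[symmetric] by (intro nn_set_integral_cmult) measurable
    finally show ?thesis .
  qed
  have I_meas [measurable]: "I \<in> borel_measurable lebesgue"
  proof -
    interpret sigma_finite_measure "lebesgue :: (real^'n) measure" by (rule sigma_finite_lebesgue)
    show ?thesis
      unfolding I_def average_def by measurable
  qed
  \<comment> \<open>One point with a finite inner average makes \<nu> finite everywhere, since every
    vector lies in the image of the invertible matrix \<open>A x0\<close>.\<close>
  obtain x0 where x0: "x0 \<in> R" "I x0 < top"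
  proof -
    have "(\<integral>\<^sup>+x\<in>R. ennreal_powr (I x) (p / q) \<partial>lebesgue) \<noteq> \<infinity>"
      using Ap R0 unfolding I_def[symmetric] by (auto simp: top_unique ennreal_mult_eq_top_iff simp del: emeasure_completion)
    then have "AE x in lebesgue. ennreal_powr (I x) (p / q) * indicator R x \<noteq> \<infinity>"
      by (intro nn_integral_PInf_AE) measurable
    then have "AE x in lebesgue. x \<in> R \<longrightarrow> I x < top"
      by eventually_elim (auto simp: ennreal_powr_less_top_iff simp flip: less_top)
    moreover have "\<not> (AE x in lebesgue. x \<notin> R)" using R0 R
      by (subst AE_iff_measurable[OF R]) (auto simp del: emeasure_completion)
    ultimately have "\<exists>x. x \<in> R \<and> I x < top" by (metis (mono_tags, lifting) AE_mp AE_I2)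
    then show ?thesis using that by blast
  qed
  have \<nu>_fin: "\<nu> z < top" for z
  proof -
    have "\<nu> z = \<nu> (A x0 *v (B x0 *v z))" by (simp add: matrix_vector_mul_assoc AB)
    also have "\<dots> \<le> ennreal (norm (B x0 *v z) powr q) * (I x0 * ennreal m)" by (rule \<nu>_le)
    also have "\<dots> < top" using x0 by (simp add: ennreal_mult_less_top)
    finally show ?thesis .
  qed
  \<comment> \<open>A positive lower bound of \<nu> on the unit sphere; it makes \<open>S\<close>
    bounded and allows every nonzero vector to be rescaled into \<open>S\<close>.\<close>
  define c where "c = (\<integral>\<^sup>+y\<in>R. ennreal (op_norm (A y) powr - q) \<partial>lebesgue)"
  have \<nu>_ge: "ennreal (norm z powr q) * c \<le> \<nu> z" for z
  proof -
    have "ennreal (norm z powr q) * c = (\<integral>\<^sup>+y\<in>R. ennreal (norm z powr q) * ennreal (op_norm (A y) powr - q) \<partial>lebesgue)"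
      unfolding c_def by (intro nn_set_integral_cmult[symmetric]) measurable
    also have "\<dots> \<le> \<nu> z" unfolding \<nu>_def
    proof (rule nn_set_integral_mono)
      fix y
      have "norm z = norm (A y *v (B y *v z))" by (simp add: matrix_vector_mul_assoc AB)
      also have "\<dots> \<le> op_norm (A y) * norm (B y *v z)" by (rule norm_matrix_vector_le)
      finally have "norm z powr q \<le> (op_norm (A y) * norm (B y *v z)) powr q" using q by (intro powr_mono2) auto
      then have "norm z powr q * op_norm (A y) powr - q \<le> norm (B y *v z) powr q"
        using op_norm_A_pos[of y] by (simp add: powr_mult powr_minus field_simps)
      then show "ennreal (norm z powr q) * ennreal (op_norm (A y) powr - q) \<le> ennreal (norm (B y *v z) powr q)"
        by (simp add: ennreal_leI flip: ennreal_mult)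
    qed
    finally show ?thesis .
  qed
  have c0: "c \<noteq> 0"
  proof
    assume "c = 0"
    then have "AE y in lebesgue. ennreal (op_norm (A y) powr - q) * indicator R y = 0"
      unfolding c_def by (subst (asm) nn_integral_0_iff_AE) measurable
    then have "AE y in lebesgue. y \<notin> R"
    proof eventually_elim
      case (elim y)
      then show ?case using op_norm_A_pos[of y] by (auto simp: indicator_def split: if_splits)
    qed
    then show False using R0 R by (subst (asm) AE_iff_measurable[OF R]) (auto simp del: emeasure_completion)
  qed
  have \<nu>_pos: "\<nu> z \<noteq> 0" if "z \<noteq> 0" for z
    using \<nu>_ge[of z] c0 that by (auto simp: ennreal_eq_0_iff)
  have "c \<noteq> top"
    using \<nu>_ge[of "axis undefined 1"] \<nu>_fin[of "axis undefined 1"] by (auto simp: top_unique)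
  then obtain c' where c': "c = ennreal c'" "0 < c'" using c0 by (cases c) auto
  define S where "S = {z. \<nu> z \<le> ennreal m}"
  have normalize: "\<exists>t>0. t powr q * enn2real (\<nu> z) = m \<and> t *\<^sub>R z \<in> S" if nz: "z \<noteq> 0" for z
  proof -
    obtain n where n: "\<nu> z = ennreal n" "0 < n" using \<nu>_fin[of z] \<nu>_pos[OF nz] by (cases "\<nu> z") auto
    define t where "t = (m / n) powr (1/q)"
    have t: "0 < t" "t powr q = m / n" using m n q by (auto simp: t_def powr_powr)
    then have "\<nu> (t *\<^sub>R z) = ennreal m" using n m by (simp add: \<nu>_scale flip: ennreal_mult)
    then show ?thesis using t n by (intro exI[of _ t]) (auto simp: S_def)
  qed
  have "bounded S"
  proof (rule boundedI)
    fix z assume "z \<in> S"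
    then have "ennreal (norm z powr q) * c \<le> ennreal m" using \<nu>_ge[of z] by (auto simp: S_def)
    then have "norm z powr q * c' \<le> m" using c' m by (simp flip: ennreal_mult)
    then have "(norm z powr q) powr (1/q) \<le> (m / c') powr (1/q)" using c' q m by (intro powr_mono2) (auto simp: field_simps)
    then show "norm z \<le> (m / c') powr (1/q)" using q by (simp add: powr_powr)
  qed
  have star: "s *\<^sub>R z \<in> S" if "z \<in> S" "0 \<le> s" "s \<le> 1" for s z
  proof -
    have "s powr q \<le> 1 powr q" using that q by (intro powr_mono2) auto
    then have "ennreal (\<bar>s\<bar> powr q) * \<nu> z \<le> 1 * ennreal m" using that by (intro mult_mono) (auto simp: S_def)
    then show ?thesis by (simp add: S_def \<nu>_scale)
  qed
  \<comment> \<open>The Auerbach lemma wants one length for all axis vectors. Since \<open>S\<close>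
    is closed under shrinking, the smallest of the individual lengths works.\<close>
  obtain t where t: "0 < t" "\<And>i::'d. axis i t \<in> S"
  proof -
    have "\<forall>i::'d. \<exists>t>0. t *\<^sub>R axis i 1 \<in> S"
      using normalize by (metis axis_eq_0_iff zero_neq_one)
    then obtain \<tau> where \<tau>: "\<And>i::'d. 0 < \<tau> i" "\<And>i. \<tau> i *\<^sub>R axis i 1 \<in> S" by metis
    define t where "t = Min (range \<tau>)"
    have t: "0 < t" "\<And>i. t \<le> \<tau> i" using \<tau>(1) by (auto simp: t_def)
    have "axis i t \<in> S" for i
    proof -
      have "axis i t = (t / \<tau> i) *\<^sub>R (\<tau> i *\<^sub>R axis i 1)"
        using \<tau>(1)[of i] by (simp add: axis_def vec_eq_iff)
      also have "\<dots> \<in> S" by (rule star[OF \<tau>(2)]) (use \<tau>(1)[of i] t(1) t(2)[of i] in \<open>auto simp: field_simps\<close>)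
      finally show ?thesis .
    qed
    then show ?thesis using t that by blast
  qed
  obtain u v :: "'d \<Rightarrow> real^'d" where u: "\<And>i. u i \<in> S"
    and e1: "\<And>z. z = (\<Sum>i\<in>UNIV. (u i \<bullet> z) *\<^sub>R v i)" and e2: "\<And>z. z = (\<Sum>i\<in>UNIV. (v i \<bullet> z) *\<^sub>R u i)"
    and v: "\<And>z i. z \<in> S \<Longrightarrow> \<bar>v i \<bullet> z\<bar> \<le> 2" and uv: "\<And>i. u i \<bullet> v i = 1"
    by (rule almost_Auerbach_basis[OF \<open>bounded S\<close> t]) (rule that)
  have v': "ennreal (\<bar>v i \<bullet> z\<bar> powr q * m) \<le> ennreal (2 powr q) * \<nu> z" for z i
  proof (cases "z = 0")
    case False
    then obtain t where t: "0 < t" "t powr q * enn2real (\<nu> z) = m" "t *\<^sub>R z \<in> S" using normalize by blast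
    have "\<bar>v i \<bullet> z\<bar> \<le> 2 / t" using v[OF t(3), of i] t(1) by (simp add: abs_mult field_simps)
    then have "\<bar>v i \<bullet> z\<bar> powr q * m \<le> (2 / t) powr q * m" using q m by (intro mult_right_mono powr_mono2) auto
    also have "\<dots> = 2 powr q * enn2real (\<nu> z)" using t by (simp add: powr_divide flip: t(2))
    finally have "ennreal (\<bar>v i \<bullet> z\<bar> powr q * m) \<le> ennreal (2 powr q) * ennreal (enn2real (\<nu> z))"
      by (simp add: ennreal_leI flip: ennreal_mult)
    then show ?thesis using \<nu>_fin[of z] by simp
  qed (use q in simp)
  have Av: "ennreal (norm (A x *v v i) powr q) \<le> ennreal (2 powr q) * I x" for x i
  proof (cases "A x *v v i = 0")
    case False
    \<comment> \<open>The dual test vector: pairing \<open>v i\<close> with \<open>A x *v w\<close>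
      gives the square of \<open>norm w\<close>, while \<open>\<nu>_le\<close> bounds the other side
      by \<open>norm w\<close> to the power q. One factor \<open>norm w powr q\<close>
      cancels.\<close>
    define w where "w = A x *v v i"
    have w: "0 < norm w" using False by (simp add: w_def)
    have "v i \<bullet> (A x *v w) = norm w ^ 2"
      by (simp add: inner_matrix_vector A_sym power2_norm_eq_inner w_def)
    then have "ennreal ((norm w ^ 2) powr q * m) \<le> ennreal (2 powr q) * \<nu> (A x *v w)"
      using v'[of i "A x *v w"] by simp
    also have "\<dots> \<le> ennreal (2 powr q) * (ennreal (norm w powr q) * (I x * ennreal m))"
      by (intro mult_left_mono \<nu>_le) simp
    also have "ennreal ((norm w ^ 2) powr q * m) = ennreal (norm w powr q * m) * ennreal (norm w powr q)"
      using m by (simp add: power2_eq_square powr_mult ac_simps flip: ennreal_mult)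
    also have "ennreal (2 powr q) * (ennreal (norm w powr q) * (I x * ennreal m))
       = ennreal (norm w powr q * m) * (ennreal (2 powr q) * I x)"
      using m by (simp add: ennreal_mult ac_simps)
    finally show ?thesis using w m unfolding w_def[symmetric]
      by (subst (asm) ennreal_mult_le_mult_iff) auto
  qed (use q in simp)
  have Avp: "(\<integral>\<^sup>+x\<in>R. ennreal (norm (A x *v v i) powr p) \<partial>lebesgue) \<le> ennreal ((2 * K) powr p) * ennreal m" for i
  proof -
    have "(\<integral>\<^sup>+x\<in>R. ennreal (norm (A x *v v i) powr p) \<partial>lebesgue)
      \<le> (\<integral>\<^sup>+x\<in>R. ennreal (2 powr p) * ennreal_powr (I x) (p / q) \<partial>lebesgue)"
    proof (rule nn_set_integral_mono)
      fix x
      have "ennreal_powr (ennreal (norm (A x *v v i) powr q)) (p / q) \<le> ennreal_powr (ennreal (2 powr q) * I x) (p / q)"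
        using p q by (intro ennreal_powr_mono Av) auto
      then show "ennreal (norm (A x *v v i) powr p) \<le> ennreal (2 powr p) * ennreal_powr (I x) (p / q)"
        using p q by (simp add: ennreal_powr_mult powr_powr)
    qed
    also have "\<dots> = ennreal (2 powr p) * (\<integral>\<^sup>+x\<in>R. ennreal_powr (I x) (p / q) \<partial>lebesgue)"
      by (intro nn_set_integral_cmult) measurable
    also have "\<dots> \<le> ennreal (2 powr p) * (ennreal (K powr p) * ennreal m)"
      using Ap unfolding I_def[symmetric] m(1) by (intro mult_left_mono) auto
    also have "\<dots> = ennreal ((2 * K) powr p) * ennreal m"
      using K by (simp add: powr_mult ennreal_mult mult.assoc)
    finally show ?thesis .
  qed
  have Bu: "(\<integral>\<^sup>+x\<in>R. ennreal (norm (B x *v u i) powr q) \<partial>lebesgue) \<le> ennreal m" for i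
    using u[of i] by (simp add: S_def \<nu>_def)
  have qq: "conj_exponent q = p" using p by (simp add: q_def conj_exponent_conj_exponent)
  show "balanced_bases B A q (2 * K) R"
    unfolding balanced_bases_def qq m(1)
  proof (intro exI conjI allI)
    show "z = (\<Sum>i\<in>UNIV. (v i \<bullet> z) *\<^sub>R u i)" "z = (\<Sum>i\<in>UNIV. (u i \<bullet> z) *\<^sub>R v i)" for z by (rule e2 e1)+
  qed (rule Bu Avp)+
  \<comment> \<open>The pairing \<open>u i \<bullet> v i = 1\<close> is integrated over
    \<open>R\<close> with \<open>abs_inner_le\<close>, and Hoelder's inequality returns the product
    of the two bounds.\<close>
  show K1: "1 \<le> 2 * K"
  proof -
    fix i0 :: 'd
    let ?a = "\<lambda>x. norm (A x *v v i0)" and ?b = "\<lambda>x. norm (B x *v u i0)"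
    have "ennreal m = (\<integral>\<^sup>+x\<in>R. 1 \<partial>lebesgue)" by (simp add: m(1)[symmetric] del: emeasure_completion)
    also have "\<dots> \<le> (\<integral>\<^sup>+x\<in>R. ennreal (?a x) * ennreal (?b x) \<partial>lebesgue)"
      using abs_inner_le[of "u i0" "v i0"] uv[of i0]
      by (intro nn_set_integral_mono) (simp add: ennreal_leI flip: ennreal_mult ennreal_1)
    also have "\<dots> \<le> ennreal_powr (\<integral>\<^sup>+x\<in>R. ennreal_powr (ennreal (?a x)) p \<partial>lebesgue) (1/p)
      * ennreal_powr (\<integral>\<^sup>+x\<in>R. ennreal_powr (ennreal (?b x)) q \<partial>lebesgue) (1/q)"
      unfolding q_def by (rule nn_set_integral_Holder[OF p]) measurable
    also have "\<dots>
      \<le> ennreal_powr (ennreal ((2 * K) powr p) * ennreal m) (1/p) * ennreal_powr (ennreal m) (1/q)"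
      using p q Avp Bu by (intro mult_mono ennreal_powr_mono) auto
    also have "\<dots> = ennreal (2 * K * (m powr (1/p) * m powr (1/q)))"
      using p K m by (simp add: ennreal_powr_mult powr_powr ennreal_mult mult.assoc)
    also have "m powr (1/p) * m powr (1/q) = m"
      using conj_exponent[OF p] m by (simp add: q_def flip: powr_add)
    finally show ?thesis using m K by (simp add: ennreal_le_iff)
  qed
  \<comment> \<open>Multiplying \<open>u\<close> by \<open>k\<close> and dividing \<open>v\<close>
    by \<open>k\<close> keeps the bases dual and moves the constant from the bound for
    \<open>A\<close> to the bound for \<open>B\<close>.\<close>
  define k where "k = 2 * K"
  have k: "1 \<le> k" using K1 by (simp add: k_def)
  show "balanced_bases A B p (2 * K) R"
    unfolding balanced_bases_def m(1) q_def[symmetric] k_def[symmetric]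
  proof (rule exI[of _ "\<lambda>i. k *\<^sub>R u i"], rule exI[of _ "\<lambda>i. (1 / k) *\<^sub>R v i"], intro conjI allI)
    show "z = (\<Sum>i\<in>UNIV. ((k *\<^sub>R u i) \<bullet> z) *\<^sub>R ((1 / k) *\<^sub>R v i))" for z
      using e1[of z] k by simp
    show "z = (\<Sum>i\<in>UNIV. (((1 / k) *\<^sub>R v i) \<bullet> z) *\<^sub>R (k *\<^sub>R u i))" for z
      using e2[of z] k by simp
    have scale: "(\<integral>\<^sup>+x\<in>R. ennreal (norm (F x *v (s *\<^sub>R z)) powr r) \<partial>lebesgue)
      = ennreal (s powr r) * (\<integral>\<^sup>+x\<in>R. ennreal (norm (F x *v z) powr r) \<partial>lebesgue)"
      if [measurable]: "F \<in> borel_measurable lebesgue" and "0 < s" for F :: "real^'n \<Rightarrow> real^'d^'d" and s r z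
      using \<open>0 < s\<close> by (simp add: matrix_vector_mult_scaleR powr_mult ennreal_mult nn_set_integral_cmult)
    show "(\<integral>\<^sup>+x\<in>R. ennreal (norm (A x *v ((1 / k) *\<^sub>R v i)) powr p) \<partial>lebesgue) \<le> ennreal m" for i
    proof -
      have "ennreal ((1 / k) powr p) * (\<integral>\<^sup>+x\<in>R. ennreal (norm (A x *v v i) powr p) \<partial>lebesgue)
        \<le> ennreal ((1 / k) powr p) * (ennreal (k powr p) * ennreal m)"
        using Avp[of i] unfolding k_def by (intro mult_left_mono) auto
      also have "\<dots> = ennreal m" using k m by (simp add: powr_divide flip: ennreal_mult)
      finally show ?thesis using k by (subst scale) auto
    qed
    show "(\<integral>\<^sup>+x\<in>R. ennreal (norm (B x *v (k *\<^sub>R u i)) powr q) \<partial>lebesgue) \<le> ennreal (k powr q) * ennreal m" for i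
      using k by (subst scale) (auto intro: mult_left_mono Bu)
  qed
qed

end

subsection \<open>Shifted dyadic grids\<close>

text \<open>Dyadic cubes of side \<open>2 powr -j\<close>, shifted by \<open>\<plusminus>1/3\<close> of their side in the coordinates
  selected by \<open>t\<close>. The alternating sign makes consecutive levels nested.\<close>

definition shift :: "bool \<Rightarrow> int \<Rightarrow> real" where
  "shift b j = (if b then (if even j then 1 else - 1) / 3 else 0)"

abbreviation (input) cell :: "int \<Rightarrow> bool \<Rightarrow> real \<Rightarrow> int" where
  "cell j b y \<equiv> \<lfloor>2 powr of_int j * y - shift b j\<rfloor>"

definition grid_cube :: "('n \<Rightarrow> bool) \<Rightarrow> int \<Rightarrow> ('n \<Rightarrow> int) \<Rightarrow> (real^'n) set" where
  "grid_cube t j m = {x. \<forall>i. cell j (t i) (x $ i) = m i}"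

definition grid :: "('n \<Rightarrow> bool) \<Rightarrow> (real^'n) set set" where
  "grid t = (\<lambda>(j, m). grid_cube t j m) ` UNIV"

lemma gridE:
  assumes "Q \<in> grid t" obtains j m where "Q = grid_cube t j m"
  using assms by (auto simp: grid_def)

lemma countable_grid: "countable (grid t)"
  unfolding grid_def by simp

text \<open>One level down the position doubles, and \<open>2 * shift b j - shift b (j + 1)\<close>
  is 0, 1 or -1. It is an integer because the sign alternates (a constant sign would leave a third),
  so the coarse index is a function of the fine one.\<close>

lemma floor_refine:
  "cell j b x =
     (cell (j + 1) b x - (if b then (if even j then 1 else - 1) else 0)) div 2"
proof -
  define s :: int where "s = (if b then (if even j then 1 else - 1) else 0)"
  define z where "z = 2 powr of_int (j + 1) * x - shift b (j + 1)"
  have "2 powr of_int j * x - shift b j = (z - of_int s) / 2"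
    by (auto simp: z_def s_def shift_def powr_add field_simps)
  moreover have "\<lfloor>(z - of_int s) / of_int 2\<rfloor> = \<lfloor>z - of_int s\<rfloor> div 2" by (rule floor_divide_real_eq_div) simp
  ultimately show ?thesis by (simp only: z_def[symmetric] s_def[symmetric] floor_diff_of_int of_int_numeral)
qed

lemma grid_index_coarsen:
  assumes "j \<le> j'" "\<And>i. cell j' (t i) (x $ i) = cell j' (t i) (y $ i)"
  shows "cell j (t i) (x $ i) = cell j (t i) (y $ i)"
  using assms
proof (induction j' arbitrary: i rule: int_ge_induct)
  case base
  then show ?case .
next
  case (step k)
  show ?case
  proof (rule step.IH)
    fix i
    show "cell k (t i) (x $ i) = cell k (t i) (y $ i)"
      unfolding floor_refine[of k] using step.prems[of i] by simp
  qed
qed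

lemma grid_cube_subset:
  assumes "j \<le> j'" "z \<in> grid_cube t j m" "z \<in> grid_cube t j' m'"
  shows "grid_cube t j' m' \<subseteq> grid_cube t j m"
proof
  fix x assume "x \<in> grid_cube t j' m'"
  have "cell j (t i) (x $ i) = cell j (t i) (z $ i)" for i
    by (rule grid_index_coarsen[OF assms(1)]) (use assms(3) \<open>x \<in> grid_cube t j' m'\<close> in \<open>simp add: grid_cube_def\<close>)
  then show "x \<in> grid_cube t j m" using assms by (simp add: grid_cube_def)
qed

lemma laminar_grid: "laminar (grid t)"
  unfolding laminar_def
proof (intro ballI)
  fix Q R assume "Q \<in> grid t" "R \<in> grid t"
  then obtain j m j' m' where QR: "Q = grid_cube t j m" "R = grid_cube t j' m'" by (elim gridE)
  show "Q \<subseteq> R \<or> R \<subseteq> Q \<or> Q \<inter> R = {}"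
  proof (cases "Q \<inter> R = {}")
    case False
    then obtain z where "z \<in> Q" "z \<in> R" by auto
    then have "R \<subseteq> Q" if "j \<le> j'" using grid_cube_subset[OF that] unfolding QR by blast
    moreover have "Q \<subseteq> R" if "j' \<le> j"
      using grid_cube_subset[OF that] \<open>z \<in> Q\<close> \<open>z \<in> R\<close> unfolding QR by blast
    ultimately show ?thesis using linear[of j j'] by blast
  qed simp
qed

text \<open>Grid cubes are half-open, whereas the members of \<open>cubes\<close> are closed boxes;
  volumes and averages do not see the difference.\<close>

definition almost_cube :: "(real^'n) set \<Rightarrow> (real^'n) set \<Rightarrow> bool" where
  "almost_cube Q C \<longleftrightarrow> Q \<in> sets lebesgue \<and> Q \<subseteq> C \<and> C - Q \<in> null_sets lebesgue"

lemma content_cube: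
  assumes "0 < l" shows "vol (cbox a (\<chi> i. a $ i + l) :: (real^'n) set) = ennreal (l ^ CARD('n))"
proof -
  have ne: "cbox a (\<chi> i. a $ i + l) \<noteq> ({} :: (real^'n) set)" using assms by (auto simp: interval_ne_empty_cart less_imp_le)
  have "vol (cbox a (\<chi> i. a $ i + l)) = ennreal (measure lebesgue (cbox a (\<chi> i. a $ i + l)))"
    by (rule emeasure_eq_ennreal_measure) (metis emeasure_bounded_finite bounded_cbox emeasure_completion main_part lborelD_Collect less_top fmeasurableD2 lmeasurable_cbox)
  then show ?thesis using content_cbox_cart[OF ne] by (simp del: emeasure_completion)
qed

lemma grid_cube_almost_cube:
  fixes t :: "'n::finite \<Rightarrow> bool"
  shows "\<exists>C\<in>cubes. almost_cube (grid_cube t j m) C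
    \<and> vol C = ennreal ((2 powr - of_int j) ^ CARD('n))"
proof -
  define l :: real where "l = 2 powr - of_int j"
  have l: "0 < l" "l * 2 powr of_int j = 1" by (auto simp: l_def simp flip: powr_add)
  define a :: "real^'n" where "a = (\<chi> i. l * (of_int (m i) + shift (t i) j))"
  have eq: "grid_cube t j m = {x. \<forall>i. a $ i \<le> x $ i \<and> x $ i < a $ i + l}"
  proof -
    have "\<lfloor>2 powr of_int j * y - s\<rfloor> = k \<longleftrightarrow> l * (of_int k + s) \<le> y \<and> y < l * (of_int k + s) + l" for y s k
    proof -
      have "\<lfloor>2 powr of_int j * y - s\<rfloor> = k \<longleftrightarrow> of_int k + s \<le> 2 powr of_int j * y \<and> 2 powr of_int j * y < of_int k + s + 1"
        by (auto simp: floor_eq_iff)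
      also have "\<dots> \<longleftrightarrow> l * (of_int k + s) \<le> l * (2 powr of_int j * y) \<and> l * (2 powr of_int j * y) < l * (of_int k + s + 1)"
        using l by simp
      also have "l * (2 powr of_int j * y) = y" using l(2) by (simp flip: mult.assoc)
      finally show ?thesis by (simp add: algebra_simps)
    qed
    then show ?thesis by (simp add: grid_cube_def a_def)
  qed
  let ?b = "\<chi> i. a $ i + l"
  have sub: "box a ?b \<subseteq> grid_cube t j m" "grid_cube t j m \<subseteq> cbox a ?b"
    unfolding eq by (auto simp: mem_box_cart less_imp_le)
  have "negligible (cbox a ?b - grid_cube t j m)"
    by (rule negligible_subset[OF negligible_frontier_interval[of a ?b]]) (use sub in auto)
  then have null: "cbox a ?b - grid_cube t j m \<in> null_sets lebesgue" by (simp add: negligible_iff_null_sets)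
  then have "cbox a ?b - grid_cube t j m \<in> sets lebesgue" by (rule null_setsD2)
  then have "cbox a ?b - (cbox a ?b - grid_cube t j m) \<in> sets lebesgue" by (rule sets.Diff[rotated]) simp
  moreover have "cbox a ?b - (cbox a ?b - grid_cube t j m) = grid_cube t j m" using sub by auto
  ultimately have "grid_cube t j m \<in> sets lebesgue" by simp
  moreover have "cbox a ?b \<in> cubes" unfolding cubes_def using l(1) by blast
  ultimately show ?thesis
    using sub null content_cube[OF l(1), of a]
    by (intro bexI[of _ "cbox a ?b"]) (simp_all add: almost_cube_def l_def)
qed

lemma almost_cube_emeasure:
  assumes "almost_cube Q C" "C \<in> sets lebesgue"
  shows "vol Q = vol C"
proof -
  have "Q = C - (C - Q)" using assms by (auto simp: almost_cube_def)
  then show ?thesis using assms emeasure_Diff_null_set[of "C - Q" lebesgue C] by (simp add: almost_cube_def del: emeasure_completion)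
qed

lemma almost_cube_nn_integral:
  assumes "almost_cube Q C"
  shows "(\<integral>\<^sup>+x\<in>Q. f x \<partial>lebesgue) = (\<integral>\<^sup>+x\<in>C. f x \<partial>lebesgue)"
proof (rule nn_integral_cong_AE)
  have "AE x in lebesgue. x \<notin> C - Q" using assms by (intro AE_not_in) (simp add: almost_cube_def)
  then show "AE x in lebesgue. f x * indicator Q x = f x * indicator C x"
  proof eventually_elim
    case (elim x)
    then show ?case using assms by (auto simp: almost_cube_def indicator_def)
  qed
qed

text \<open>If both floors changed, the half-open interval from \<open>A\<close> to \<open>B\<close>
  would contain an integer \<open>k\<close> and a point \<open>k' + s / 3\<close> with
  \<open>s\<close> equal to 1 or -1. Their distance is strictly less than 1/3, so
  \<open>3 * k - 3 * k' - s\<close> would be an integer of absolute value below 1, and 3 would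
  divide \<open>s\<close>. The half-open interval is what allows the length 1/3 itself.\<close>

lemma one_third_trick:
  fixes A B :: real
  assumes "A \<le> B" "B - A \<le> 1 / 3"
  shows "\<lfloor>A\<rfloor> = \<lfloor>B\<rfloor> \<or> \<lfloor>A - shift True j\<rfloor> = \<lfloor>B - shift True j\<rfloor>"
proof (rule ccontr)
  define s :: int where "s = (if even j then 1 else - 1)"
  have s: "shift True j = of_int s / 3" by (simp add: shift_def s_def)
  assume "\<not> ?thesis"
  then have ne: "\<lfloor>A\<rfloor> < \<lfloor>B\<rfloor>" "\<lfloor>A - of_int s / 3\<rfloor> < \<lfloor>B - of_int s / 3\<rfloor>"
    using assms floor_mono[of A B] floor_mono[of "A - of_int s / 3" "B - of_int s / 3"] by (auto simp: s)
  define k k' where "k = \<lfloor>B\<rfloor>" and "k' = \<lfloor>B - of_int s / 3\<rfloor>"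
  have k: "A < of_int k" "of_int k \<le> B" using ne by (auto simp: k_def floor_less_iff)
  have k': "A - of_int s / 3 < of_int k'" "of_int k' \<le> B - of_int s / 3" using ne by (auto simp: k'_def floor_less_iff)
  have "real_of_int (3 * k - 3 * k' - s) < of_int 1" "of_int (-1) < real_of_int (3 * k - 3 * k' - s)"
    using k k' assms by (simp_all add: field_simps)
  then have "3 * k - 3 * k' - s < 1" "-1 < 3 * k - 3 * k' - s" unfolding of_int_less_iff .
  then have "s = 3 * (k - k')" by simp
  moreover have "s = 1 \<or> s = - 1" by (simp add: s_def)
  ultimately show False by presburger
qed

lemma cube_subset_grid_cube:
  fixes Q :: "(real^'n) set"
  assumes "Q \<in> cubes"
  shows "\<exists>t. \<exists>R\<in>grid t. Q \<subseteq> R \<and> vol R \<le> ennreal (6 ^ CARD('n)) * vol Q"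
proof -
  obtain a :: "real^'n" and l where Q: "Q = cbox a (\<chi> i. a $ i + l)" and l: "0 < l" using assms by (auto simp: cubes_def)
  \<comment> \<open>The finest level whose side is at least \<open>3 * l\<close>: an edge of
    \<open>Q\<close> then spans at most a third of the grid side, and the side is at most
    \<open>6 * l\<close>.\<close>
  define j where "j = \<lfloor>- log 2 (3 * l)\<rfloor>"
  have j: "of_int j \<le> - log 2 (3 * l)" "- log 2 (3 * l) < of_int j + 1" unfolding j_def by linarith+
  have "2 powr of_int j \<le> 2 powr (- log 2 (3 * l))" using j by (intro powr_mono) auto
  then have j1: "2 powr of_int j * l \<le> 1 / 3" using l by (simp add: powr_minus field_simps)
  have "2 powr - of_int j \<le> 2 powr (1 + log 2 (3 * l))" using j by (intro powr_mono) auto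
  then have j2: "2 powr - of_int j \<le> 6 * l" using l by (simp add: powr_add)
  define P where "P i b \<longleftrightarrow> cell j b (a $ i) = cell j b (a $ i + l)" for i b
  have "\<exists>b. P i b" for i
  proof -
    have "\<lfloor>2 powr of_int j * a $ i\<rfloor> = \<lfloor>2 powr of_int j * (a $ i + l)\<rfloor> \<or>
       cell j True (a $ i) = cell j True (a $ i + l)"
      using l j1 by (intro one_third_trick) (auto simp: algebra_simps)
    then have "P i False \<or> P i True" by (simp add: P_def shift_def)
    then show ?thesis by blast
  qed
  \<comment> \<open>The shift is chosen separately in each coordinate, hence the grids are indexed
    by functions from coordinates to \<open>bool\<close>.\<close>
  then obtain t where t: "\<And>i. P i (t i)" by metis
  define m where "m i = cell j (t i) (a $ i)" for i
  have "Q \<subseteq> grid_cube t j m"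
  proof
    fix x assume "x \<in> Q"
    then have x: "a $ i \<le> x $ i" "x $ i \<le> a $ i + l" for i by (auto simp: Q mem_box_cart)
    have "cell j (t i) (x $ i) = m i" for i
    proof (rule antisym)
      have "2 powr of_int j * x $ i \<le> 2 powr of_int j * (a $ i + l)" by (intro mult_left_mono x) auto
      then show "cell j (t i) (x $ i) \<le> m i"
        using t[of i] unfolding m_def P_def by (simp add: floor_mono)
      have "2 powr of_int j * a $ i \<le> 2 powr of_int j * x $ i" by (intro mult_left_mono x) auto
      then show "m i \<le> cell j (t i) (x $ i)" unfolding m_def by (simp add: floor_mono)
    qed
    then show "x \<in> grid_cube t j m" by (simp add: grid_cube_def)
  qed
  moreover have "vol (grid_cube t j m) \<le> ennreal (6 ^ CARD('n)) * vol Q"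
  proof -
    obtain C where C: "C \<in> cubes" "almost_cube (grid_cube t j m) C"
       "vol C = ennreal ((2 powr - of_int j) ^ CARD('n))" using grid_cube_almost_cube by blast
    have "C \<in> sets lebesgue" using C(1) by (auto simp: cubes_def)
    then have "vol (grid_cube t j m) = ennreal ((2 powr - of_int j) ^ CARD('n))"
      using almost_cube_emeasure[OF C(2)] C(3) by simp
    also have "\<dots> \<le> ennreal ((6 * l) ^ CARD('n))" using j2 by (intro ennreal_leI power_mono) auto
    also have "\<dots> = ennreal (6 ^ CARD('n)) * vol Q"
      using l unfolding Q content_cube[OF l] by (simp add: power_mult_distrib ennreal_mult)
    finally show ?thesis .
  qed
  ultimately show ?thesis unfolding grid_def by blast
qed

subsection \<open>The maximal operator\<close>

lemma ennreal_powr_SUP_le: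
  assumes "0 < s" shows "ennreal_powr (SUP i\<in>I. g i) s \<le> (SUP i\<in>I. ennreal_powr (g i) s)"
proof -
  have "(SUP i\<in>I. g i) \<le> ennreal_powr (SUP i\<in>I. ennreal_powr (g i) s) (1 / s)"
  proof (rule SUP_least)
    fix i assume "i \<in> I"
    then have "ennreal_powr (ennreal_powr (g i) s) (1 / s) \<le> ennreal_powr (SUP i\<in>I. ennreal_powr (g i) s) (1 / s)"
      using assms by (intro ennreal_powr_mono SUP_upper) auto
    then show "g i \<le> ennreal_powr (SUP i\<in>I. ennreal_powr (g i) s) (1 / s)"
      using assms by (simp add: ennreal_powr_powr)
  qed
  then have "ennreal_powr (SUP i\<in>I. g i) s \<le> ennreal_powr (ennreal_powr (SUP i\<in>I. ennreal_powr (g i) s) (1 / s)) s"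
    using assms by (intro ennreal_powr_mono) auto
  then show ?thesis using assms by (simp add: ennreal_powr_powr)
qed

lemma grid_cube_finite_measure:
  fixes t :: "'n::finite \<Rightarrow> bool"
  assumes "Q \<in> grid t"
  shows "nondegenerate Q"
proof -
  obtain j m where Q: "Q = grid_cube t j m" using assms by (rule gridE)
  obtain C where C: "C \<in> cubes" "almost_cube Q C"
    "vol C = ennreal ((2 powr - of_int j) ^ CARD('n))" using grid_cube_almost_cube[of t j m] unfolding Q by blast
  have "C \<in> sets lebesgue" using C(1) by (auto simp: cubes_def)
  then have "vol Q = ennreal ((2 powr - of_int j) ^ CARD('n))"
    using almost_cube_emeasure[OF C(2)] C(3) by simp
  then show ?thesis using C(2) by (simp add: almost_cube_def del: emeasure_completion)
qed

definition all_grids :: "(real^'n) set set" where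
  "all_grids = (\<Union>t. grid t)"

lemma countable_all_grids: "countable all_grids"
  unfolding all_grids_def by (simp add: countable_grid)

lemma all_grids_finite_measure:
  "Q \<in> all_grids \<Longrightarrow> nondegenerate Q"
  unfolding all_grids_def using grid_cube_finite_measure by blast

context dual_matrix_functions
begin

abbreviation (input) kernel_average where
  "kernel_average Q f x \<equiv> average Q (\<lambda>y. ennreal (op_norm (A x ** B y)) * f y)"

text \<open>The indicator makes the index set independent of \<open>x\<close>, so for countable
  \<open>D\<close> this is a countable supremum of measurable functions.\<close>

definition maximal :: "(real^'n) set set \<Rightarrow> (real^'n \<Rightarrow> ennreal) \<Rightarrow> real^'n \<Rightarrow> ennreal" where
  "maximal D f x = (SUP Q\<in>D. kernel_average Q f x * indicator Q x)"

lemma measurable_average_kernel: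
  assumes [measurable]: "Q \<in> sets lebesgue" "f \<in> borel_measurable lebesgue"
  shows "(\<lambda>x. kernel_average Q f x) \<in> borel_measurable lebesgue"
proof -
  interpret sigma_finite_measure "lebesgue :: (real^'n) measure" by (rule sigma_finite_lebesgue)
  show ?thesis unfolding average_def by measurable
qed

lemma measurable_maximal:
  assumes "countable D" "\<And>Q. Q \<in> D \<Longrightarrow> Q \<in> sets lebesgue" "f \<in> borel_measurable lebesgue"
  shows "maximal D f \<in> borel_measurable lebesgue"
proof -
  have "(\<lambda>x. kernel_average Q f x * indicator Q x) \<in> borel_measurable lebesgue"
    if "Q \<in> D" for Q
    using assms(2)[OF that] measurable_average_kernel[OF assms(2)[OF that] assms(3)]
    by (intro borel_measurable_times_ennreal borel_measurable_indicator) auto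
  then show ?thesis unfolding maximal_def[abs_def] using assms(1) by (intro borel_measurable_SUP) auto
qed

lemma maximal_mono:
  assumes "\<And>y. f y \<le> g y" shows "maximal D f x \<le> maximal D g x"
  unfolding maximal_def
  by (intro SUP_mono') (intro mult_right_mono average_mono mult_left_mono assms, auto)

lemma maximal_le:
  "(\<And>Q. Q \<in> D \<Longrightarrow> x \<in> Q \<Longrightarrow> kernel_average Q f x \<le> c) \<Longrightarrow> maximal D f x \<le> c"
  unfolding maximal_def by (rule SUP_least) (auto simp: indicator_def)

lemma average_le_maximal:
  assumes "Q \<in> D" "x \<in> Q"
  shows "kernel_average Q f x \<le> maximal D f x"
  unfolding maximal_def using assms by (intro SUP_upper2[of Q]) auto

text \<open>Continuity from below, by monotone convergence in each average; the monotone iteration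
  needs it to pass to its limit.\<close>

lemma maximal_SUP:
  assumes "incseq f" "\<And>n. f n \<in> borel_measurable lebesgue" "\<And>Q. Q \<in> D \<Longrightarrow> Q \<in> sets lebesgue"
  shows "maximal D (\<lambda>y. SUP n. f n y) x \<le> (SUP n. maximal D (f n) x)"
proof (rule maximal_le)
  fix Q assume Q: "Q \<in> D" "x \<in> Q"
  note [measurable] = assms(2) assms(3)[OF Q(1)]
  have "(\<integral>\<^sup>+y\<in>Q. ennreal (op_norm (A x ** B y)) * (SUP n. f n y) \<partial>lebesgue)
     = (\<integral>\<^sup>+y. (SUP n. ennreal (op_norm (A x ** B y)) * f n y * indicator Q y) \<partial>lebesgue)"
    by (intro nn_integral_cong) (simp add: SUP_mult_left_ennreal SUP_mult_right_ennreal)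
  also have "\<dots> = (SUP n. \<integral>\<^sup>+y\<in>Q. ennreal (op_norm (A x ** B y)) * f n y \<partial>lebesgue)"
    using assms(1) by (intro nn_integral_monotone_convergence_SUP)
      (auto simp: incseq_def le_fun_def intro!: mult_right_mono mult_left_mono)
  finally have "kernel_average Q (\<lambda>y. SUP n. f n y) x
      = (SUP n. kernel_average Q (f n) x)"
    unfolding average_def divide_ennreal_def by (simp add: SUP_mult_right_ennreal)
  also have "\<dots> \<le> (SUP n. maximal D (f n) x)"
    by (intro SUP_mono' average_le_maximal Q)
  finally show "kernel_average Q (\<lambda>y. SUP n. f n y) x \<le> (SUP n. maximal D (f n) x)" .
qed

text \<open>The stopping argument needs finite families, for maximal members to exist and for its
  induction. Its constant does not depend on their size, so exhausting \<open>D\<close> by finite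
  subfamilies and monotone convergence suffice.\<close>

lemma laminar_maximal_bound:
  assumes p: "1 < p" and K: "1 \<le> K"
    and D: "countable D" "laminar D"
      "\<And>Q. Q \<in> D \<Longrightarrow> nondegenerate Q"
    and bb: "\<And>Q. Q \<in> D \<Longrightarrow> balanced_bases A B p K Q"
    and f: "f \<in> borel_measurable lebesgue"
  shows "(\<integral>\<^sup>+x. ennreal_powr (maximal D f x) p \<partial>lebesgue)
     \<le> ennreal (maximal_const p (real CARD('d)) * K powr (p + conj_exponent p)) * (\<integral>\<^sup>+x. ennreal_powr (f x) p \<partial>lebesgue)"
    (is "_ \<le> ?r")
proof (cases "D = {}")
  case True
  then show ?thesis by (simp add: maximal_def bot_ennreal)
next
  case False
  define E where "E n = from_nat_into D ` {..n}" for n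
  have ED: "E n \<subseteq> D" "finite (E n)" for n using from_nat_into[OF False] by (auto simp: E_def)
  have E_UN: "(\<Union>n. E n) = D"
  proof -
    have "(\<Union>n. E n) = range (from_nat_into D)" by (auto simp: E_def)
    then show ?thesis by (simp only: range_from_nat_into[OF False D(1)])
  qed
  have Emono: "E m \<subseteq> E n" if "m \<le> n" for m n using that by (auto simp: E_def)
  have meas: "maximal (E n) f \<in> borel_measurable lebesgue" for n
    using ED D f by (intro measurable_maximal) (auto intro: countable_finite)
  let ?M = "\<lambda>D x. ennreal_powr (maximal D f x) p"
  have "(\<integral>\<^sup>+x. ?M D x \<partial>lebesgue) \<le> (\<integral>\<^sup>+x. (SUP n. ?M (E n) x) \<partial>lebesgue)"
  proof (intro nn_integral_mono)
    fix x
    have "maximal D f x \<le> (SUP n. maximal (E n) f x)"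
      unfolding E_UN[symmetric] by (rule maximal_le) (auto intro: SUP_upper2 average_le_maximal)
    then have "?M D x \<le> ennreal_powr (SUP n. maximal (E n) f x) p"
      using p by (intro ennreal_powr_mono) auto
    also have "\<dots> \<le> (SUP n. ?M (E n) x)" using p by (intro ennreal_powr_SUP_le) auto
    finally show "?M D x \<le> (SUP n. ?M (E n) x)" .
  qed
  also have "\<dots> = (SUP n. \<integral>\<^sup>+x. ?M (E n) x \<partial>lebesgue)"
  proof (rule nn_integral_monotone_convergence_SUP)
    show "incseq (\<lambda>n x. ?M (E n) x)"
      unfolding incseq_def le_fun_def
    proof (intro allI impI ennreal_powr_mono)
      fix m n x assume "m \<le> (n::nat)"
      then show "maximal (E m) f x \<le> maximal (E n) f x"
        using Emono by (intro maximal_le average_le_maximal) auto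
    qed (use p in auto)
    show "(\<lambda>x. ?M (E n) x) \<in> borel_measurable lebesgue" for n
      using meas by (rule ennreal_powr_measurable)
  qed
  also have "\<dots> \<le> ?r"
  proof (rule SUP_least)
    fix n
    have lam: "laminar (E n)" using D(2) ED(1) unfolding laminar_def by blast
    have "(\<integral>\<^sup>+x. ?M (E n) x \<partial>lebesgue) \<le>
      (\<integral>\<^sup>+x. ennreal_powr (SUP Q\<in>{Q\<in>E n. x \<in> Q}. kernel_average Q f x) p \<partial>lebesgue)"
      using p by (intro nn_integral_mono ennreal_powr_mono maximal_le SUP_upper) auto
    also have "\<dots> \<le> ?r"
      by (rule finite_laminar_maximal_bound[OF p K ED(2) lam _ _ f]) (use D(3) bb ED(1) in \<open>simp_all only: subset_iff\<close>)
    finally show "(\<integral>\<^sup>+x. ?M (E n) x \<partial>lebesgue) \<le> ?r" .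
  qed
  finally show ?thesis .
qed

lemma all_grids_maximal_bound:
  assumes p: "1 < p" and K: "1 \<le> K"
    and bb: "\<And>Q. Q \<in> all_grids \<Longrightarrow> balanced_bases A B p K Q"
    and f: "f \<in> borel_measurable lebesgue"
  shows "(\<integral>\<^sup>+x. ennreal_powr (maximal all_grids f x) p \<partial>lebesgue)
     \<le> ennreal (real CARD('n \<Rightarrow> bool) * maximal_const p (real CARD('d)) * K powr (p + conj_exponent p))
       * (\<integral>\<^sup>+x. ennreal_powr (f x) p \<partial>lebesgue)"
proof -
  have meas: "maximal (grid t) f \<in> borel_measurable lebesgue" for t :: "'n \<Rightarrow> bool"
    using grid_cube_finite_measure[of _ t] f by (intro measurable_maximal countable_grid) auto
  have "(\<integral>\<^sup>+x. ennreal_powr (maximal all_grids f x) p \<partial>lebesgue)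
    \<le> (\<integral>\<^sup>+x. (\<Sum>t\<in>UNIV. ennreal_powr (maximal (grid t) f x) p) \<partial>lebesgue)"
  proof (intro nn_integral_mono)
    fix x
    have "maximal all_grids f x \<le> (SUP t. maximal (grid t) f x)"
      unfolding all_grids_def by (rule maximal_le) (auto intro: SUP_upper2 average_le_maximal)
    then have "ennreal_powr (maximal all_grids f x) p \<le> ennreal_powr (SUP t. maximal (grid t) f x) p"
      using p by (intro ennreal_powr_mono) auto
    also have "\<dots> \<le> (SUP t. ennreal_powr (maximal (grid t) f x) p)" using p by (intro ennreal_powr_SUP_le) auto
    also have "\<dots> \<le> (\<Sum>t\<in>UNIV. ennreal_powr (maximal (grid t) f x) p)"
      by (intro SUP_least member_le_sum) auto
    finally show "ennreal_powr (maximal all_grids f x) p \<le> (\<Sum>t\<in>UNIV. ennreal_powr (maximal (grid t) f x) p)" .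
  qed
  also have "\<dots> = (\<Sum>t\<in>UNIV. \<integral>\<^sup>+x. ennreal_powr (maximal (grid t) f x) p \<partial>lebesgue)"
    by (intro nn_integral_sum ennreal_powr_measurable meas)
  also have "\<dots> \<le> (\<Sum>t\<in>(UNIV :: ('n \<Rightarrow> bool) set). ennreal (maximal_const p (real CARD('d)) * K powr (p + conj_exponent p)) * (\<integral>\<^sup>+x. ennreal_powr (f x) p \<partial>lebesgue))"
    using bb by (intro sum_mono laminar_maximal_bound p K countable_grid laminar_grid grid_cube_finite_measure f)
      (auto simp: all_grids_def)
  also have "\<dots> = ennreal (real CARD('n \<Rightarrow> bool) * maximal_const p (real CARD('d)) * K powr (p + conj_exponent p))
       * (\<integral>\<^sup>+x. ennreal_powr (f x) p \<partial>lebesgue)"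
    unfolding sum_constant
    by (simp only: ennreal_of_nat_eq_real_of_nat ennreal_mult' of_nat_0_le_iff mult.assoc)
  finally show ?thesis .
qed

text \<open>Replaces the uncountably many cubes by countably many grid cubes at the cost of the
  ratio of volumes, so the iteration can run with a measurable operator.\<close>

lemma average_cube_le_maximal:
  assumes Q: "Q \<in> cubes" "x \<in> Q"
  shows "kernel_average Q f x \<le> ennreal (6 ^ CARD('n)) * maximal all_grids f x"
proof -
  let ?h = "\<lambda>y. ennreal (op_norm (A x ** B y)) * f y"
  obtain t R where R: "R \<in> grid t" "Q \<subseteq> R" and le: "vol R \<le> ennreal (6 ^ CARD('n)) * vol Q"
    using cube_subset_grid_cube[OF Q(1)] by blast
  have Rg: "R \<in> all_grids" using R by (auto simp: all_grids_def)
  note Rm = all_grids_finite_measure[OF Rg]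
  obtain a l where al: "Q = cbox a (\<chi> i. a $ i + l)" "0 < l" using Q by (auto simp: cubes_def)
  have eQ: "vol Q = ennreal (l ^ CARD('n))" using content_cube al by simp
  have "(\<integral>\<^sup>+y\<in>Q. ?h y \<partial>lebesgue) \<le> (\<integral>\<^sup>+y\<in>R. ?h y \<partial>lebesgue)"
    using R by (intro nn_set_integral_set_mono) auto
  also have "\<dots> = average R ?h * vol R"
    by (rule average_times_emeasure[symmetric]) (use Rm in auto)
  also have "\<dots> \<le> maximal all_grids f x * (ennreal (6 ^ CARD('n)) * vol Q)"
    using R Q by (intro mult_mono average_le_maximal Rg le) auto
  finally have "average Q ?h \<le> maximal all_grids f x * (ennreal (6 ^ CARD('n)) * vol Q) / vol Q"
    unfolding average_def by (rule divide_right_mono_ennreal)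
  also have "\<dots> = maximal all_grids f x * ennreal (6 ^ CARD('n))"
    unfolding mult.assoc[symmetric] eQ using al(2) by (intro ennreal_mult_divide_eq) simp_all
  finally show ?thesis by (simp add: mult.commute)
qed

lemma balanced_bases_grid:
  assumes p: "1 < p" and q_def: "q = conj_exponent p" and K: "0 \<le> K"
    and Ap: "\<And>Q. Q \<in> cubes \<Longrightarrow>
      Ap_on A B p q K Q"
    and R: "R \<in> all_grids"
  shows "balanced_bases A B p (2 * K) R" "balanced_bases B A q (2 * K) R" "1 \<le> 2 * K"
proof -
  obtain t j m where "R = grid_cube t j m" using R unfolding all_grids_def by (auto elim: gridE)
  then obtain C where C: "C \<in> cubes" "almost_cube R C" using grid_cube_almost_cube by blast
  have "C \<in> sets lebesgue" using C(1) by (auto simp: cubes_def)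
  then have em: "vol R = vol C" by (rule almost_cube_emeasure[OF C(2)])
  have av: "average R h = average C h" for h :: "real^'n \<Rightarrow> ennreal"
    unfolding average_def em almost_cube_nn_integral[OF C(2)] ..
  have "Ap_on A B p q K R"
    unfolding av em almost_cube_nn_integral[OF C(2)] by (rule Ap[OF C(1)])
  note * = balanced_bases_of_Ap[OF p q_def K _ _ _ this]
  show "balanced_bases A B p (2 * K) R" "balanced_bases B A q (2 * K) R" "1 \<le> 2 * K"
    using all_grids_finite_measure[OF R] * by auto
qed

end

subsection \<open>The spectral theorem and powers of matrices\<close>

lemma symmetric_inner_commute:
  fixes A :: "real^'d^'d" assumes "transpose A = A"
  shows "x \<bullet> (A *v y) = y \<bullet> (A *v x)"
  using assms by (metis inner_commute inner_matrix_vector)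

text \<open>A maximizer \<open>b\<close> of the quadratic form on the unit sphere of
  \<open>S\<close>. Its first variation vanishes, so \<open>A *v b\<close> is orthogonal to every
  vector of \<open>S\<close> orthogonal to \<open>b\<close>; as \<open>S\<close> is invariant, this
  applies to the component of \<open>A *v b\<close> orthogonal to \<open>b\<close>.\<close>

lemma exists_eigenvector_in_subspace:
  fixes A :: "real^'d^'d"
  assumes A: "transpose A = A" and S: "subspace S" "\<And>x. x \<in> S \<Longrightarrow> A *v x \<in> S" and z: "z \<in> S" "z \<noteq> 0"
  shows "\<exists>b c. b \<in> S \<and> norm b = 1 \<and> A *v b = c *\<^sub>R b"
proof -
  have "compact (S \<inter> sphere 0 1)" by (intro closed_Int_compact closed_subspace S compact_sphere)
  moreover have "(1 / norm z) *\<^sub>R z \<in> S \<inter> sphere 0 1" using S z by (auto simp: subspace_scale)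
  then have "S \<inter> sphere 0 1 \<noteq> {}" by blast
  moreover have "continuous_on (S \<inter> sphere 0 1) (\<lambda>x. x \<bullet> (A *v x))"
    by (intro continuous_intros linear_continuous_on matrix_vector_mul_bounded_linear)
  ultimately have "\<exists>b\<in>S \<inter> sphere 0 1. \<forall>x\<in>S \<inter> sphere 0 1. x \<bullet> (A *v x) \<le> b \<bullet> (A *v b)"
    by (rule continuous_attains_sup)
  then obtain b where b': "b \<in> S \<inter> sphere 0 1" and max': "\<forall>x\<in>S \<inter> sphere 0 1. x \<bullet> (A *v x) \<le> b \<bullet> (A *v b)" by blast
  have b: "b \<in> S" "norm b = 1" using b' by auto
  have max: "x \<bullet> (A *v x) \<le> b \<bullet> (A *v b)" if "x \<in> S" "norm x = 1" for x
    using max' that by (auto dest: bspec[of _ _ x])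
  define c where "c = b \<bullet> (A *v b)"
  have max': "x \<bullet> (A *v x) \<le> c * (x \<bullet> x)" if "x \<in> S" for x
  proof (cases "x = 0")
    case False
    have "((1 / norm x) *\<^sub>R x) \<bullet> (A *v ((1 / norm x) *\<^sub>R x)) \<le> c"
      unfolding c_def using that False S by (intro max) (auto simp: subspace_scale)
    then have "(x \<bullet> (A *v x)) / (norm x)\<^sup>2 \<le> c" by (simp add: matrix_vector_mult_scaleR power2_eq_square)
    then show ?thesis using False by (simp add: field_simps power2_norm_eq_inner)
  qed simp
  have orth: "y \<bullet> (A *v b) = 0" if y: "y \<in> S" "y \<bullet> b = 0" for y
  proof (rule ccontr)
    assume ne: "y \<bullet> (A *v b) \<noteq> 0"
    define g M where "g = y \<bullet> (A *v b)" and "M = c * (y \<bullet> y) - y \<bullet> (A *v y)"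
    \<comment> \<open>The maximality of \<open>c\<close> at \<open>b + t *\<^sub>R y\<close>. A
      linear function of \<open>t\<close> cannot stay below a quadratic one near 0 unless its slope
      vanishes; below, \<open>t = g\<close> or \<open>t = g / M\<close> makes this explicit.\<close>
    have *: "2 * t * g \<le> t * t * M" for t
    proof -
      have "b + t *\<^sub>R y \<in> S" using b y S by (intro subspace_add subspace_scale) auto
      from max'[OF this] show ?thesis
        using y b symmetric_inner_commute[OF A, of b y]
        by (simp add: matrix_vector_right_distrib matrix_vector_mult_scaleR inner_add_left inner_add_right
            inner_commute[of b y] g_def M_def c_def algebra_simps norm_eq_1)
    qed
    have "0 \<le> M" using *[of 1] *[of "-1"] by simp
    show False
    proof (cases "M = 0")
      case True
      then have "2 * (g * g) \<le> 0" using *[of g] by simp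
      moreover have "0 < g * g" using ne by (auto simp: g_def zero_less_mult_iff)
      ultimately show False by simp
    next
      case False
      then have "0 < M" using \<open>0 \<le> M\<close> by simp
      then have "2 * (g / M) * g \<le> (g / M) * (g / M) * M" using * by blast
      then have "2 * (g * g) \<le> g * g" using \<open>0 < M\<close> by (simp add: field_simps)
      moreover have "0 < g * g" using ne by (auto simp: g_def zero_less_mult_iff)
      ultimately show False by simp
    qed
  qed
  let ?y = "A *v b - c *\<^sub>R b"
  have "?y \<in> S" using b S by (intro subspace_diff subspace_scale) auto
  moreover have yb: "?y \<bullet> b = 0" using b by (simp add: inner_diff_left c_def norm_eq_1 inner_commute[of "A *v b" b])
  ultimately have "?y \<bullet> (A *v b) = 0" by (rule orth)
  then have "?y \<bullet> ?y = 0" using yb by (simp add: inner_diff_right[of _ "A *v b"])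
  then show ?thesis using b by auto
qed

text \<open>An orthonormal set of eigenvectors of greatest cardinality must span: its orthogonal
  complement is invariant under \<open>A\<close>, and if nonzero it would contain a further
  eigenvector.\<close>

theorem symmetric_diagonalizable:
  fixes A :: "real^'d^'d"
  assumes A: "transpose A = A"
  shows "\<exists>U v. orthogonal_matrix U \<and> A = U ** diag_matrix v ** transpose U"
proof -
  define P where "P B \<longleftrightarrow> pairwise orthogonal B \<and> (\<forall>b\<in>B. norm b = 1 \<and> (\<exists>c. A *v b = c *\<^sub>R b))" for B :: "(real^'d) set"
  have ind: "independent B" if "P B" for B
    using that by (intro pairwise_orthogonal_independent) (auto simp: P_def)
  have fin: "finite B \<and> card B \<le> CARD('d)" if "P B" for B
    using independent_bound[OF ind[OF that]] by simp
  have "P {}" by (simp add: P_def)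
  define n where "n = (GREATEST n. \<exists>B. P B \<and> card B = n)"
  have ex: "\<exists>B. P B \<and> card B = n" unfolding n_def
    by (rule GreatestI_nat[of _ 0 "CARD('d)"]) (use fin \<open>P {}\<close> in \<open>auto intro!: exI[of _ "{}"]\<close>)
  have maxi: "card B \<le> n" if "P B" for B unfolding n_def
    by (rule Greatest_le_nat[of _ _ "CARD('d)"]) (use fin that in auto)
  obtain B where B: "P B" "card B = n" using ex by blast
  have span: "span B = UNIV"
  proof (rule ccontr)
    assume "span B \<noteq> UNIV"
    then obtain z where z: "z \<noteq> 0" "\<And>y. y \<in> span B \<Longrightarrow> orthogonal z y"
      using orthogonal_to_subspace_exists_gen[of B UNIV] by auto
    define S where "S = {x. \<forall>b\<in>B. x \<bullet> b = 0}"
    have "subspace S" unfolding S_def subspace_def by (simp add: inner_add_left)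
    moreover have "A *v x \<in> S" if "x \<in> S" for x
      unfolding S_def
    proof (intro CollectI ballI)
      fix b assume b: "b \<in> B"
      then obtain c where "A *v b = c *\<^sub>R b" using B by (auto simp: P_def)
      then have "b \<bullet> (A *v x) = 0" using that b symmetric_inner_commute[OF A, of b x] by (simp add: S_def)
      then show "(A *v x) \<bullet> b = 0" by (simp add: inner_commute)
    qed
    moreover have "z \<in> S" using z span_base[of _ B] by (auto simp: S_def orthogonal_def)
    ultimately obtain b c where b: "b \<in> S" "norm b = 1" "A *v b = c *\<^sub>R b"
      using exists_eigenvector_in_subspace[OF A _ _ _ z(1)] by blast
    have "b \<notin> B" using b by (auto simp: S_def norm_eq_1)
    moreover have "P (insert b B)"
      using B b unfolding P_def pairwise_insert by (auto simp: S_def orthogonal_def inner_commute)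
    moreover have "finite B" using fin[OF B(1)] by blast
    ultimately have "Suc n \<le> n" using maxi[of "insert b B"] B(2) by simp
    then show False by simp
  qed
  have "card B = CARD('d)"
    using span basis_card_eq_dim[of B UNIV] ind[OF B(1)] by simp
  then obtain f :: "'d \<Rightarrow> real^'d" where f: "bij_betw f UNIV B"
    using fin[OF B(1)] finite_same_card_bij[of "UNIV :: 'd set" B] by auto
  have fB: "f i \<in> B" for i using f by (auto simp: bij_betw_def)
  have orthonormal: "f i \<bullet> f j = (if i = j then 1 else 0)" for i j
  proof (cases "i = j")
    case True
    then show ?thesis using fB[of i] B(1) by (auto simp: P_def norm_eq_1)
  next
    case False
    then have "f i \<noteq> f j" using f by (auto simp: bij_betw_def inj_def)
    then show ?thesis using False fB B(1) by (auto simp: P_def pairwise_def orthogonal_def)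
  qed
  have "\<forall>i. \<exists>c. A *v f i = c *\<^sub>R f i" using fB B(1) unfolding P_def by blast
  then obtain v where v: "\<And>i. A *v f i = v i *\<^sub>R f i" by metis
  define U :: "real^'d^'d" where "U = (\<chi> i j. f j $ i)"
  have "transpose U ** U = mat 1"
    using orthonormal by (simp add: U_def transpose_def matrix_matrix_mult_def mat_def vec_eq_iff inner_vec_def)
  then have U: "orthogonal_matrix U" by (simp add: orthogonal_matrix)
  have "A ** U = U ** diag_matrix (\<chi> i. v i)"
  proof -
    have "(A ** U) $ i $ j = (U ** diag_matrix (\<chi> i. v i)) $ i $ j" for i j
    proof -
      have "(A ** U) $ i $ j = (A *v f j) $ i" by (simp add: U_def matrix_matrix_mult_def matrix_vector_mult_def)
      also have "\<dots> = (U ** diag_matrix (\<chi> i. v i)) $ i $ j"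
        by (simp add: v U_def diag_matrix_def matrix_matrix_mult_def if_distrib[of "\<lambda>x. _ * x"] cong: if_cong)
      finally show ?thesis .
    qed
    then show ?thesis by (simp add: vec_eq_iff)
  qed
  then have "A ** (U ** transpose U) = U ** diag_matrix (\<chi> i. v i) ** transpose U"
    by (simp add: matrix_mul_assoc)
  then show ?thesis using U unfolding orthogonal_matrix_def by (metis matrix_mul_rid)
qed

lemma diag_matrix_mult_nth: "(diag_matrix v ** M) $ i $ j = v $ i * M $ i $ j"
  by (simp add: diag_matrix_def matrix_matrix_mult_def if_distrib[of "\<lambda>x. x * _"] cong: if_cong)

lemma mult_diag_matrix_nth: "(M ** diag_matrix v) $ i $ j = M $ i $ j * v $ j"
  by (simp add: diag_matrix_def matrix_matrix_mult_def if_distrib[of "\<lambda>x. _ * x"] cong: if_cong)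

lemma diag_matrix_mult: "diag_matrix v ** diag_matrix w = diag_matrix (\<chi> i. v $ i * w $ i)"
  by (simp add: vec_eq_iff diag_matrix_mult_nth) (simp add: diag_matrix_def)

text \<open>The change of basis \<open>O'\<close> intertwines the two diagonal matrices. Entrywise,
  each entry of \<open>O'\<close> is zero or links two equal eigenvalues, so it also intertwines
  their images under \<open>f\<close>. This makes the description in \<open>matrix_powr\<close>
  definite.\<close>

lemma functional_calculus_unique:
  assumes U: "orthogonal_matrix U" and U': "orthogonal_matrix (U' :: real^'d^'d)"
    and eq: "U ** diag_matrix v ** transpose U = U' ** diag_matrix v' ** transpose U'"
  shows "U ** diag_matrix (\<chi> i. f (v $ i)) ** transpose U = U' ** diag_matrix (\<chi> i. f (v' $ i)) ** transpose U'"
proof -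
  note o = U[unfolded orthogonal_matrix_def] U'[unfolded orthogonal_matrix_def]
  let ?D = "diag_matrix (\<chi> i. f (v $ i))" and ?D' = "diag_matrix (\<chi> i. f (v' $ i))"
  define O' where "O' = transpose U' ** U"
  have "transpose U' ** (U ** diag_matrix v ** transpose U) ** U = transpose U' ** (U' ** diag_matrix v' ** transpose U') ** U"
    by (simp only: eq)
  then have "O' ** diag_matrix v ** (transpose U ** U) = (transpose U' ** U') ** diag_matrix v' ** O'"
    by (simp only: O'_def matrix_mul_assoc)
  then have *: "O' ** diag_matrix v = diag_matrix v' ** O'" by (simp add: o)
  have "O' $ i $ j * v $ j = v' $ i * O' $ i $ j" for i j
    by (metis * diag_matrix_mult_nth mult_diag_matrix_nth)
  then have "O' $ i $ j * f (v $ j) = f (v' $ i) * O' $ i $ j" for i j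
    by (cases "O' $ i $ j = 0") (auto simp: mult.commute, metis mult_left_cancel mult.commute)
  then have **: "O' ** ?D = ?D' ** O'"
    by (simp add: vec_eq_iff diag_matrix_mult_nth mult_diag_matrix_nth)
  have "U ** ?D ** transpose U = (U' ** transpose U') ** U ** ?D ** transpose U"
    by (simp add: o)
  also have "\<dots> = U' ** (O' ** ?D) ** transpose U"
    by (simp only: O'_def matrix_mul_assoc)
  also have "\<dots> = U' ** (?D' ** O') ** transpose U" by (simp only: **)
  also have "\<dots> = U' ** ?D' ** transpose U' ** (U ** transpose U)"
    by (simp only: O'_def matrix_mul_assoc)
  finally show ?thesis by (simp add: o)
qed

lemma matrix_powr_eq:
  assumes "orthogonal_matrix U"
  shows "matrix_powr (U ** diag_matrix v ** transpose U) s = U ** diag_matrix (\<chi> i. v $ i powr s) ** transpose U"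
  unfolding matrix_powr_def
proof (rule the_equality)
  show "\<exists>U' v'. orthogonal_matrix U' \<and> U ** diag_matrix v ** transpose U = U' ** diag_matrix v' ** transpose U'
     \<and> U ** diag_matrix (\<chi> i. v $ i powr s) ** transpose U = U' ** diag_matrix (\<chi> i. v' $ i powr s) ** transpose U'"
    using assms by blast
next
  fix B
  assume "\<exists>U' v'. orthogonal_matrix U' \<and> U ** diag_matrix v ** transpose U = U' ** diag_matrix v' ** transpose U'
     \<and> B = U' ** diag_matrix (\<chi> i. v' $ i powr s) ** transpose U'"
  then obtain U' v' where "orthogonal_matrix U'" "U ** diag_matrix v ** transpose U = U' ** diag_matrix v' ** transpose U'"
     and B: "B = U' ** diag_matrix (\<chi> i. v' $ i powr s) ** transpose U'" by blast
  from functional_calculus_unique[OF assms this(1,2), where f = "\<lambda>x. x powr s"]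
  show "B = U ** diag_matrix (\<chi> i. v $ i powr s) ** transpose U" unfolding B ..
qed

text \<open>Both scalar multiples share one diagonalization of \<open>A\<close>, which reduces the
  claim to a scalar identity for each eigenvalue.\<close>

lemma matrix_powr_mult_scaled:
  fixes A :: "real^'d^'d"
  assumes A: "pos_def A" and p: "1 < p" and rs: "0 < r" "0 < s" "r powr (1 / p) * s powr (1 / conj_exponent p) = 1"
  shows "matrix_powr (r *\<^sub>R A) (1 / p) ** matrix_powr (s *\<^sub>R A) (1 / conj_exponent p) = A"
proof -
  obtain U v where U: "orthogonal_matrix U" and Aeq: "A = U ** diag_matrix v ** transpose U"
    using symmetric_diagonalizable[of A] A by (auto simp: pos_def_def)
  note o = U[unfolded orthogonal_matrix_def]
  have v: "0 < v $ i" for i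
  proof -
    define w where "w = U *v axis i 1"
    have w: "transpose U *v w = axis i 1" by (simp add: w_def matrix_vector_mul_assoc o)
    then have "w \<noteq> 0" by (metis axis_eq_0_iff matrix_vector_mult_0_right zero_neq_one)
    then have "0 < w \<bullet> (A *v w)" using A by (simp add: pos_def_def)
    also have "w \<bullet> (A *v w) = (transpose U *v w) \<bullet> (diag_matrix v *v (transpose U *v w))"
      by (simp only: Aeq matrix_vector_mul_assoc[symmetric] inner_matrix_vector[of w U])
    also have "\<dots> = v $ i"
      unfolding w by (simp add: inner_axis inner_axis' matrix_vector_mul_component) (simp add: diag_matrix_def)
    finally show ?thesis .
  qed
  have scale: "c *\<^sub>R A = U ** diag_matrix (c *\<^sub>R v) ** transpose U" for c
  proof -
    have "c *\<^sub>R diag_matrix v = diag_matrix (c *\<^sub>R v)" by (simp add: diag_matrix_def vec_eq_iff)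
    then show ?thesis unfolding Aeq
      by (simp add: matrix_scalar_ac scalar_matrix_assoc flip: \<open>c *\<^sub>R diag_matrix v = diag_matrix (c *\<^sub>R v)\<close>)
  qed
  have e: "1 / p + 1 / conj_exponent p = 1" using p by (rule conj_exponent)
  let ?Dr = "diag_matrix (\<chi> i. (r * v $ i) powr (1 / p))" and ?Ds = "diag_matrix (\<chi> i. (s * v $ i) powr (1 / conj_exponent p))"
  have "matrix_powr (r *\<^sub>R A) (1 / p) ** matrix_powr (s *\<^sub>R A) (1 / conj_exponent p)
    = U ** ?Dr ** (transpose U ** U)
       ** ?Ds ** transpose U"
    unfolding scale matrix_powr_eq[OF U] by (simp add: matrix_mul_assoc)
  also have "\<dots> = U ** (?Dr ** ?Ds) ** transpose U"
    by (simp add: o matrix_mul_assoc)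
  also have "?Dr ** ?Ds = diag_matrix v"
  proof -
    have "(r * v $ i) powr (1 / p) * (s * v $ i) powr (1 / conj_exponent p) = v $ i" for i
    proof -
      have "(r * v $ i) powr (1 / p) * (s * v $ i) powr (1 / conj_exponent p)
        = (r powr (1 / p) * s powr (1 / conj_exponent p)) * (v $ i powr (1 / p) * v $ i powr (1 / conj_exponent p))"
        using rs v[of i] by (simp add: powr_mult)
      also have "\<dots> = v $ i" unfolding rs(3) using v[of i] e by (simp flip: powr_add)
      finally show ?thesis .
    qed
    then show ?thesis by (simp add: diag_matrix_mult)
  qed
  finally show ?thesis by (simp add: Aeq)
qed

subsection \<open>Factorization\<close>

text \<open>Monotone iteration replaces the Neumann series of the Rubio de Francia algorithm, because
  \<open>f \<mapsto> T2 (f\<^sup>1\<^sup>/\<^sup>p)\<^sup>p\<close> need not be sublinear.\<close>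

lemma simultaneous_Rubio_de_Francia:
  fixes T1 T2 :: "('a \<Rightarrow> ennreal) \<Rightarrow> 'a \<Rightarrow> ennreal"
  assumes M: "sigma_finite_measure M" and pq: "1 < p" "1 < q" and N: "0 < N1" "0 < N2"
    and meas: "\<And>f. f \<in> borel_measurable M \<Longrightarrow> T1 f \<in> borel_measurable M"
      "\<And>f. f \<in> borel_measurable M \<Longrightarrow> T2 f \<in> borel_measurable M"
    and mono: "\<And>f g x. (\<And>y. f y \<le> g y) \<Longrightarrow> T1 f x \<le> T1 g x" "\<And>f g x. (\<And>y. f y \<le> g y) \<Longrightarrow> T2 f x \<le> T2 g x"
    and cont: "\<And>f x. incseq f \<Longrightarrow> (\<And>n::nat. f n \<in> borel_measurable M) \<Longrightarrow> T1 (\<lambda>y. SUP n. f n y) x \<le> (SUP n. T1 (f n) x)"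
       "\<And>f x. incseq f \<Longrightarrow> (\<And>n::nat. f n \<in> borel_measurable M) \<Longrightarrow> T2 (\<lambda>y. SUP n. f n y) x \<le> (SUP n. T2 (f n) x)"
    and bound: "\<And>f. f \<in> borel_measurable M \<Longrightarrow> (\<integral>\<^sup>+x. ennreal_powr (T1 f x) q \<partial>M) \<le> ennreal N1 * (\<integral>\<^sup>+x. ennreal_powr (f x) q \<partial>M)"
       "\<And>f. f \<in> borel_measurable M \<Longrightarrow> (\<integral>\<^sup>+x. ennreal_powr (T2 f x) p \<partial>M) \<le> ennreal N2 * (\<integral>\<^sup>+x. ennreal_powr (f x) p \<partial>M)"
  shows "\<exists>F. F \<in> borel_measurable M \<and> (\<forall>x\<in>space M. 0 < F x) \<and> (AE x in M. F x < top)
    \<and> (\<forall>x. T1 (\<lambda>y. ennreal_powr (F y) (1/q)) x \<le> ennreal ((4 * N1) powr (1/q)) * ennreal_powr (F x) (1/q))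
    \<and> (\<forall>x. T2 (\<lambda>y. ennreal_powr (F y) (1/p)) x \<le> ennreal ((4 * N2) powr (1/p)) * ennreal_powr (F x) (1/p))"
proof -
  obtain h where h [measurable]: "h \<in> borel_measurable M" and hI: "integral\<^sup>N M h \<noteq> top" and h0: "\<And>x. x \<in> space M \<Longrightarrow> 0 < h x"
    using sigma_finite_measure.Ex_finite_integrable_function[OF M] by auto
  \<comment> \<open>By \<open>bound\<close>, the map sending \<open>f\<close> to the q-th power of
    \<open>T1\<close> applied to the q-th root of \<open>f\<close> has norm at most
    \<open>N1\<close> on L^1, and likewise for \<open>T2\<close> with \<open>N2\<close>. The weights
    make each contribute a quarter, so \<open>2 * integral\<^sup>N M h\<close> bounds all iterates,
    being the fixed point of \<open>c \<mapsto> integral\<^sup>N M h + c / 2\<close>. The positive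
    \<open>h\<close> keeps the limit positive.\<close>
  define S where "S f x = h x + (ennreal (1 / (4 * N1)) * ennreal_powr (T1 (\<lambda>y. ennreal_powr (f y) (1/q)) x) q
      + ennreal (1 / (4 * N2)) * ennreal_powr (T2 (\<lambda>y. ennreal_powr (f y) (1/p)) x) p)" for f x
  have S_mono: "S f x \<le> S g x" if "\<And>y. f y \<le> g y" for f g x
    unfolding S_def using that pq
    by (intro add_mono mult_left_mono order_refl ennreal_powr_mono mono) auto
  define F where "F n = (S ^^ n) h" for n
  have F_Suc: "F (Suc n) = S (F n)" and F_0: "F 0 = h" for n by (simp_all add: F_def)
  have F_meas [measurable]: "F n \<in> borel_measurable M" for n
  proof (induction n)
    case (Suc n)
    have [measurable]: "T1 (\<lambda>y. ennreal_powr (F n y) (1/q)) \<in> borel_measurable M" "T2 (\<lambda>y. ennreal_powr (F n y) (1/p)) \<in> borel_measurable M"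
      using Suc by (intro meas ennreal_powr_measurable; simp)+
    show ?case unfolding F_Suc S_def[abs_def] by measurable
  qed (simp add: F_0)
  have F_le: "F n x \<le> F (Suc n) x" for n x
  proof (induction n arbitrary: x)
    case 0
    show ?case by (simp add: F_Suc F_0 S_def)
  next
    case (Suc n)
    then show ?case unfolding F_Suc[of "Suc n"] F_Suc[of n] by (intro S_mono) (simp flip: F_Suc)
  qed
  have F_inc: "incseq F" by (rule incseq_SucI) (simp add: le_fun_def F_le)
  have F_int: "(\<integral>\<^sup>+x. F n x \<partial>M) \<le> 2 * integral\<^sup>N M h" for n
  proof (induction n)
    case 0
    then show ?case using mult_right_mono[of 1 2 "integral\<^sup>N M h"] by (simp add: F_0)
  next
    case (Suc n)
    let ?f1 = "\<lambda>y. ennreal_powr (F n y) (1/q)" and ?f2 = "\<lambda>y. ennreal_powr (F n y) (1/p)"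
    have f: "?f1 \<in> borel_measurable M" "?f2 \<in> borel_measurable M" by measurable
    note [measurable] = meas(1)[OF f(1)] meas(2)[OF f(2)]
    have "(\<integral>\<^sup>+x. F (Suc n) x \<partial>M) = integral\<^sup>N M h + (ennreal (1 / (4 * N1)) * (\<integral>\<^sup>+x. ennreal_powr (T1 ?f1 x) q \<partial>M)
       + ennreal (1 / (4 * N2)) * (\<integral>\<^sup>+x. ennreal_powr (T2 ?f2 x) p \<partial>M))"
      unfolding F_Suc S_def by (simp add: nn_integral_add nn_integral_cmult)
    also have "\<dots> \<le> integral\<^sup>N M h + (ennreal (1 / (4 * N1)) * (ennreal N1 * (\<integral>\<^sup>+x. F n x \<partial>M))
       + ennreal (1 / (4 * N2)) * (ennreal N2 * (\<integral>\<^sup>+x. F n x \<partial>M)))"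
      using bound(1)[OF f(1)] bound(2)[OF f(2)] pq
      by (intro add_mono order_refl mult_left_mono) (simp_all add: ennreal_powr_powr)
    also have "\<dots> = integral\<^sup>N M h + ennreal (1 / 2) * (\<integral>\<^sup>+x. F n x \<partial>M)"
    proof -
      have "ennreal (1 / (4 * N1)) * (ennreal N1 * c) + ennreal (1 / (4 * N2)) * (ennreal N2 * c) = ennreal (1 / 2) * c" for c
      proof -
        have "ennreal (1 / (4 * N1)) * ennreal N1 = ennreal (1/4)" "ennreal (1 / (4 * N2)) * ennreal N2 = ennreal (1/4)"
          using N by (simp_all flip: ennreal_mult)
        moreover have "ennreal (1/4) + ennreal (1/4) = ennreal (1/2)" by (simp flip: ennreal_plus)
        ultimately show ?thesis by (metis mult.assoc distrib_right)
      qed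
      then show ?thesis by simp
    qed
    also have "\<dots> \<le> integral\<^sup>N M h + ennreal (1 / 2) * (2 * integral\<^sup>N M h)"
      by (intro add_mono mult_left_mono Suc) auto
    also have "\<dots> = 2 * integral\<^sup>N M h"
    proof -
      have "ennreal (1 / 2) * 2 = 1" using ennreal_mult'[of 2 "1/2"] by (simp add: mult.commute)
      then have "ennreal (1 / 2) * (2 * integral\<^sup>N M h) = integral\<^sup>N M h" by (metis mult.assoc mult_1)
      then show ?thesis by (simp only: mult_2)
    qed
    finally show ?case .
  qed
  define G where "G x = (SUP n. F n x)" for x
  have G_meas: "G \<in> borel_measurable M" unfolding G_def[abs_def] by measurable
  have FG: "F n x \<le> G x" for n x unfolding G_def by (rule SUP_upper) simp
  have "(\<integral>\<^sup>+x. G x \<partial>M) = (SUP n. \<integral>\<^sup>+x. F n x \<partial>M)"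
    unfolding G_def using F_inc by (intro nn_integral_monotone_convergence_SUP) auto
  also have "\<dots> \<le> 2 * integral\<^sup>N M h" by (intro SUP_least F_int)
  also have "\<dots> < top" using hI by (simp add: ennreal_mult_less_top less_top)
  finally have "AE x in M. G x \<noteq> top" using nn_integral_PInf_AE[OF G_meas] by simp
  then have G_fin: "AE x in M. G x < top" by (simp add: less_top)
  \<comment> \<open>\<open>F (Suc n)\<close> dominates \<open>1 / (4 * N)\<close> times the r-th
    power of \<open>T\<close> at stage \<open>n\<close>, and \<open>G\<close> dominates
    \<open>F (Suc n)\<close>. Continuity from below carries this to the limit, for \<open>T1\<close>
    and \<open>T2\<close> alike.\<close>
  have supersolution: "T (\<lambda>y. ennreal_powr (G y) (1/r)) x \<le> ennreal ((4 * N) powr (1/r)) * ennreal_powr (G x) (1/r)"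
    if r: "1 < r" and N: "0 < N"
      and c: "\<And>f x. incseq f \<Longrightarrow> (\<And>n::nat. f n \<in> borel_measurable M) \<Longrightarrow> T (\<lambda>y. SUP n. f n y) x \<le> (SUP n. T (f n) x)"
      and m: "\<And>f g x. (\<And>y. f y \<le> g y) \<Longrightarrow> T f x \<le> T g x"
      and le: "\<And>n x. ennreal (1 / (4 * N)) * ennreal_powr (T (\<lambda>y. ennreal_powr (F n y) (1/r)) x) r \<le> S (F n) x"
    for T :: "('a \<Rightarrow> ennreal) \<Rightarrow> 'a \<Rightarrow> ennreal" and r N x
  proof -
    have "T (\<lambda>y. ennreal_powr (G y) (1/r)) x \<le> T (\<lambda>y. SUP n. ennreal_powr (F n y) (1/r)) x"
      unfolding G_def using r by (intro m ennreal_powr_SUP_le) auto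
    also have "\<dots> \<le> (SUP n. T (\<lambda>y. ennreal_powr (F n y) (1/r)) x)"
    proof (rule c)
      show "incseq (\<lambda>n y. ennreal_powr (F n y) (1/r))"
        using F_inc r by (auto simp: incseq_def le_fun_def intro!: ennreal_powr_mono)
    qed measurable
    also have "\<dots> \<le> ennreal ((4 * N) powr (1/r)) * ennreal_powr (G x) (1/r)"
    proof (rule SUP_least)
      fix n
      let ?t = "T (\<lambda>y. ennreal_powr (F n y) (1/r)) x"
      have "ennreal (1 / (4 * N)) * ennreal_powr ?t r \<le> F (Suc n) x" unfolding F_Suc by (rule le)
      also have "\<dots> \<le> G x" by (rule FG)
      finally have "ennreal (4 * N) * (ennreal (1 / (4 * N)) * ennreal_powr ?t r) \<le> ennreal (4 * N) * G x"
        by (rule mult_left_mono) simp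
      moreover have "ennreal (4 * N) * ennreal (1 / (4 * N)) = 1" using N by (simp flip: ennreal_mult)
      ultimately have "ennreal_powr ?t r \<le> ennreal (4 * N) * G x" by (simp flip: mult.assoc)
      then have "ennreal_powr (ennreal_powr ?t r) (1/r) \<le> ennreal_powr (ennreal (4 * N) * G x) (1/r)"
        using r by (intro ennreal_powr_mono) auto
      then show "?t \<le> ennreal ((4 * N) powr (1/r)) * ennreal_powr (G x) (1/r)"
        using r N by (simp add: ennreal_powr_powr ennreal_powr_mult)
    qed
    finally show ?thesis .
  qed
  show ?thesis
  proof (intro exI[of _ G] conjI ballI allI G_meas G_fin)
    show "0 < G x" if "x \<in> space M" for x using h0[OF that] FG[of 0 x] unfolding F_0 by (rule less_le_trans)
    show "T1 (\<lambda>y. ennreal_powr (G y) (1/q)) x \<le> ennreal ((4 * N1) powr (1/q)) * ennreal_powr (G x) (1/q)" for x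
      by (rule supersolution[OF pq(2) N(1) cont(1) mono(1)]) (auto simp: S_def intro: add_increasing add_increasing2)
    show "T2 (\<lambda>y. ennreal_powr (G y) (1/p)) x \<le> ennreal ((4 * N2) powr (1/p)) * ennreal_powr (G x) (1/p)" for x
      by (rule supersolution[OF pq(1) N(2) cont(2) mono(2)]) (auto simp: S_def intro: add_increasing add_increasing2)
  qed
qed

section \<open>Measurable inverses and positive definite matrices\<close>

lemma matrix_inv_eq:
  fixes M :: "real^'d^'d" assumes "M ** N = mat 1" shows "matrix_inv M = N"
proof -
  have "N ** M = mat 1" using assms matrix_left_right_inverse by blast
  then have "\<exists>N. M ** N = mat 1 \<and> N ** M = mat 1" using assms by blast
  from someI_ex[OF this] have "M ** matrix_inv M = mat 1" by (simp add: matrix_inv_def)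
  then have "N ** (M ** matrix_inv M) = N" by simp
  then show ?thesis using \<open>N ** M = mat 1\<close> by (simp add: matrix_mul_assoc)
qed

lemma det_nonzero_matrix_inv:
  fixes M :: "real^'d^'d" assumes "det M \<noteq> 0" shows "M ** matrix_inv M = mat 1"
  using assms matrix_inv_eq unfolding invertible_det_nz[symmetric] invertible_def by metis

text \<open>By Cramer's rule the inverse is a quotient of polynomials in the entries.\<close>

lemma measurable_matrix_inv:
  fixes f :: "'a \<Rightarrow> real^'d^'d"
  assumes f: "f \<in> borel_measurable M" and det: "\<And>x. det (f x) \<noteq> 0"
  shows "(\<lambda>x. matrix_inv (f x)) \<in> borel_measurable M"
proof -
  define num :: "real^'d^'d \<Rightarrow> real^'d^'d" where
    "num = (\<lambda>A. \<chi> k j. det (\<chi> i l. if l = k then axis j 1 $ i else A $ i $ l))"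
  have if_cont: "continuous_on UNIV (\<lambda>A. if b then c else g A)" if "continuous_on UNIV g" for b c and g :: "real^'d^'d \<Rightarrow> real"
    using that by (cases b) auto
  have "continuous_on UNIV num" unfolding num_def det_def
    by (simp, intro continuous_intros if_cont)
  moreover have "continuous_on UNIV (det :: real^'d^'d \<Rightarrow> real)" unfolding det_def[abs_def]
    by (intro continuous_intros)
  ultimately have "(\<lambda>x. (1 / det (f x)) *\<^sub>R num (f x)) \<in> borel_measurable M"
    using f by (intro borel_measurable_scaleR borel_measurable_divide borel_measurable_const
        measurable_compose[OF f borel_measurable_continuous_onI])
  moreover have "matrix_inv A = (1 / det A) *\<^sub>R num A" if "det A \<noteq> 0" for A :: "real^'d^'d"
  proof -
    have "matrix_inv A $ k $ j = ((1 / det A) *\<^sub>R num A) $ k $ j" for k j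
    proof -
      have "A *v (matrix_inv A *v axis j 1) = axis j 1"
        using det_nonzero_matrix_inv[OF that] by (simp add: matrix_vector_mul_assoc)
      then have "matrix_inv A *v axis j 1 = (\<chi> k. det (\<chi> i l. if l = k then axis j 1 $ i else A $ i $ l) / det A)"
        using cramer[OF that] by blast
      then have "(matrix_inv A *v axis j 1) $ k = num A $ k $ j / det A" by (simp add: num_def)
      then show ?thesis by (simp add: matrix_vector_mul_component inner_axis)
    qed
    then show ?thesis by (simp add: vec_eq_iff)
  qed
  ultimately show ?thesis using det by simp
qed

lemma pos_def_det_nonzero:
  fixes M :: "real^'d^'d" assumes "pos_def M" shows "det M \<noteq> 0"
proof -
  have "\<forall>x. M *v x = 0 \<longrightarrow> x = 0"
    using assms unfolding pos_def_def by (metis inner_zero_right less_irrefl)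
  then show ?thesis
    unfolding invertible_det_nz[symmetric] invertible_left_inverse matrix_left_invertible_ker .
qed

lemma transpose_scaleR: "transpose (c *\<^sub>R M) = c *\<^sub>R transpose (M :: real^'d^'d)"
  by (simp add: transpose_def vec_eq_iff)

lemma pos_def_scaleR: "pos_def M \<Longrightarrow> 0 < c \<Longrightarrow> pos_def (c *\<^sub>R M)"
  by (simp add: pos_def_def transpose_scaleR flip: scaleR_matrix_vector_assoc)

lemma pos_def_imp_pos_semidef: "pos_def M \<Longrightarrow> pos_semidef M"
  unfolding pos_def_def pos_semidef_def by (metis inner_zero_left less_imp_le order_refl)

section \<open>From scalar inequalities to the A_1 and A_infinity constants\<close>

abbreviation (input) subinvariant_on ::
  "(real^'n \<Rightarrow> real^'d^'d) \<Rightarrow> (real^'n \<Rightarrow> real^'d^'d) \<Rightarrow> (real^'n \<Rightarrow> real) \<Rightarrow> real \<Rightarrow> (real^'n) set \<Rightarrow> bool"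
  where "subinvariant_on A B g c Q \<equiv> AE x in lebesgue. x \<in> Q \<longrightarrow>
    average Q (\<lambda>y. ennreal (op_norm (A x ** B y)) * ennreal (g y)) \<le> ennreal c * ennreal (g x)"

lemma pos_def_mat_1: "pos_def (mat 1 :: real^'d^'d)"
  by (simp add: pos_def_def transpose_mat)

context dual_matrix_functions
begin

lemma dual_swap: "dual_matrix_functions B A"
  by unfold_locales (auto simp: A_sym B_sym BA)

text \<open>Both constants of the theorem have this shape. The A_1 constant of \<open>r W\<close> is
  the case where \<open>A\<close> is the inverse of \<open>W\<close> and \<open>g = r\<close>; the
  A_infinity constant of \<open>s W\<close> is the case where \<open>A\<close> is \<open>W\<close>
  and \<open>g = 1 / s\<close>.\<close>

lemma esssup_weighted_le:
  assumes g: "g \<in> borel_measurable lebesgue" "\<And>x. 0 < g x"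
    and Q: "Q \<in> cubes"
    and le: "subinvariant_on A B g c Q"
  shows "esssup (lebesgue_on Q) (\<lambda>x. average Q (\<lambda>y. ennreal (op_norm (((1 / g x) *\<^sub>R A x) ** (g y *\<^sub>R B y))))) \<le> ennreal c"
proof -
  note [measurable] = g(1)
  have Qm [measurable]: "Q \<in> sets lebesgue" using Q by (auto simp: cubes_def)
  let ?T = "\<lambda>x. kernel_average Q (\<lambda>y. ennreal (g y)) x"
    and ?S = "\<lambda>x. average Q (\<lambda>y. ennreal (op_norm (((1 / g x) *\<^sub>R A x) ** (g y *\<^sub>R B y))))"
  have eq: "?S x
     = ennreal (1 / g x) * ?T x" for x
  proof -
    have "op_norm (((1 / g x) *\<^sub>R A x) ** (g y *\<^sub>R B y)) = 1 / g x * (op_norm (A x ** B y) * g y)" for y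
    proof -
      have "((1 / g x) *\<^sub>R A x) ** (g y *\<^sub>R B y) = (1 / g x * g y) *\<^sub>R (A x ** B y)"
        by (simp add: matrix_scalar_ac scalar_matrix_assoc[symmetric])
      then show ?thesis using g(2)[of x] g(2)[of y] by (simp add: op_norm_scaleR)
    qed
    then have "?S x
      = average Q (\<lambda>y. ennreal (1 / g x) * (ennreal (op_norm (A x ** B y)) * ennreal (g y)))"
      using g(2)[of x] g(2) by (simp add: ennreal_mult less_imp_le del: times_divide_eq_left)
    also have "\<dots> = ennreal (1 / g x) * ?T x"
      by (intro average_cmult) measurable
    finally show ?thesis .
  qed
  show ?thesis unfolding eq
  proof (rule esssup_I)
    have "(\<lambda>x. ?T x) \<in> borel_measurable lebesgue"
      by (rule measurable_average_kernel) measurable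
    then have "(\<lambda>x. ennreal (1 / g x) * ?T x) \<in> borel_measurable lebesgue"
      by measurable
    then show "(\<lambda>x. ennreal (1 / g x) * ?T x) \<in> borel_measurable (lebesgue_on Q)"
      by (rule measurable_restrict_space1)
    have "AE x in lebesgue. x \<in> Q \<longrightarrow>
       ennreal (1 / g x) * ?T x \<le> ennreal c"
      using le
    proof eventually_elim
      case (elim x)
      show ?case
      proof
        assume "x \<in> Q"
        then have "ennreal (1 / g x) * ?T x
           \<le> ennreal (1 / g x) * (ennreal c * ennreal (g x))" using elim by (intro mult_left_mono) auto
        also have "\<dots> = (ennreal (1 / g x) * ennreal (g x)) * ennreal c" by (simp add: ac_simps)
        also have "ennreal (1 / g x) * ennreal (g x) = 1" using g(2)[of x] by (simp flip: ennreal_mult)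
        finally show "ennreal (1 / g x) * ?T x \<le> ennreal c" by simp
      qed
    qed
    then show "AE x in lebesgue_on Q. ennreal (1 / g x) * ?T x \<le> ennreal c"
      using Qm by (simp add: AE_restrict_space_iff)
  qed
qed

text \<open>Passes from the extended function \<open>F\<close>, which may be infinite on a null set,
  to a positive real version: the integral ignores exceptional \<open>y\<close>, and exceptional
  \<open>x\<close> are absorbed by the almost everywhere statement.\<close>

lemma weighted_average_le:
  assumes F: "AE x in lebesgue. F x = ennreal (\<phi> x)" and \<phi>: "\<And>x. 0 < \<phi> x" and C: "0 \<le> C"
    and T: "\<And>x. maximal all_grids (\<lambda>y. ennreal_powr (F y) e) x \<le> ennreal C * ennreal_powr (F x) e"
    and Q: "Q \<in> cubes"
  shows "subinvariant_on A B (\<lambda>x. \<phi> x powr e) (6 ^ CARD('n) * C) Q"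
  using F
proof eventually_elim
  case (elim x)
  show ?case
  proof
    assume x: "x \<in> Q"
    have "kernel_average Q (\<lambda>y. ennreal (\<phi> y powr e)) x
        = kernel_average Q (\<lambda>y. ennreal_powr (F y) e) x"
      unfolding average_def
    proof (intro arg_cong2[where f = "(/)"] nn_integral_cong_AE refl)
      show "AE y in lebesgue. ennreal (op_norm (A x ** B y)) * ennreal (\<phi> y powr e) * indicator Q y
         = ennreal (op_norm (A x ** B y)) * ennreal_powr (F y) e * indicator Q y"
        using F
      proof eventually_elim
        case (elim y)
        then show ?case using \<phi>[of y] by simp
      qed
    qed
    also have "\<dots> \<le> ennreal (6 ^ CARD('n)) * maximal all_grids (\<lambda>y. ennreal_powr (F y) e) x"
      by (rule average_cube_le_maximal[OF Q x])
    also have "\<dots> \<le> ennreal (6 ^ CARD('n)) * (ennreal C * ennreal_powr (F x) e)"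
      by (intro mult_left_mono T) simp
    also have "\<dots> = ennreal (6 ^ CARD('n) * C) * ennreal (\<phi> x powr e)"
      using elim \<phi>[of x] C by (simp add: ennreal_mult mult.assoc)
    finally show "kernel_average Q (\<lambda>y. ennreal (\<phi> y powr e)) x \<le> ennreal (6 ^ CARD('n) * C) * ennreal (\<phi> x powr e)" .
  qed
qed

end

text \<open>The summand 1 makes the constant strictly positive, because the iteration divides by
  it.\<close>

definition operator_const :: "real \<Rightarrow> 'n::finite itself \<Rightarrow> 'd::finite itself \<Rightarrow> real" where
  "operator_const p _ _ = 1 + real CARD('n \<Rightarrow> bool) * maximal_const p (real CARD('d))"

lemma operator_const_pos: "1 < p \<Longrightarrow> 0 < operator_const p TYPE('n::finite) TYPE('d::finite)"
  using maximal_const_nonneg[of p "real CARD('d)"] by (simp add: operator_const_def add_pos_nonneg)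

text \<open>The power of 6 comes from passing to grids, the 4 from the weights in the iteration, and
  \<open>2 powr conj_exponent p\<close> from the bases being balanced with \<open>2 * K\<close> in
  place of \<open>K\<close>.\<close>

definition factor_const :: "real \<Rightarrow> 'n::finite itself \<Rightarrow> 'd::finite itself \<Rightarrow> real" where
  "factor_const p a b = 6 ^ CARD('n) * ((4 * operator_const p a b) powr (1 / p) * 2 powr conj_exponent p)"

lemma factor_const_pos: "1 < p \<Longrightarrow> 0 < factor_const p TYPE('n::finite) TYPE('d::finite)"
  using operator_const_pos[of p, where 'n = 'n and 'd = 'd] by (simp add: factor_const_def)

context dual_matrix_functions
begin

lemma scalar_factor_exists:
  assumes p: "1 < p" and q_def: "q = conj_exponent p" and K: "0 \<le> K"
    and Ap: "\<And>Q. Q \<in> cubes \<Longrightarrow>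
      Ap_on A B p q K Q"
  shows "\<exists>\<phi> :: real^'n \<Rightarrow> real. \<phi> \<in> borel_measurable lebesgue \<and> (\<forall>x. 0 < \<phi> x)
     \<and> (\<forall>Q\<in>cubes. subinvariant_on A B (\<lambda>x. \<phi> x powr (1 / p)) (factor_const p TYPE('n) TYPE('d) * K powr q) Q)
     \<and> (\<forall>Q\<in>cubes. subinvariant_on B A (\<lambda>x. \<phi> x powr (1 / q)) (factor_const q TYPE('n) TYPE('d) * K powr p) Q)"
proof -
  interpret swap: dual_matrix_functions B A by (rule dual_swap)
  have q: "1 < q" and qq: "conj_exponent q = p"
    using p by (simp_all add: q_def conj_exponent_gt_1 conj_exponent_conj_exponent)
  have pq: "(p + q) / p = q" "(p + q) / q = p" using p by (auto simp: q_def conj_exponent_def field_simps)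
  have bb: "balanced_bases A B p (2 * K) R" "balanced_bases B A q (2 * K) R" "1 \<le> 2 * K"
    if "R \<in> all_grids" for R
    using balanced_bases_grid[OF p q_def K _ that] Ap by blast+
  \<comment> \<open>\<open>1 \<le> 2 * K\<close> is a consequence of the A_p condition on a single
    cube, so one grid cube has to be exhibited.\<close>
  have "grid (\<lambda>_. False) \<noteq> ({} :: (real^'n) set set)" by (simp add: grid_def)
  then obtain R :: "(real^'n) set" where "R \<in> all_grids" by (auto simp: all_grids_def)
  then have K1: "1 \<le> 2 * K" by (rule bb(3))
  define N1 N2 where "N1 = operator_const q TYPE('n) TYPE('d) * (2 * K) powr (p + q)"
    and "N2 = operator_const p TYPE('n) TYPE('d) * (2 * K) powr (p + q)"
  have N: "0 < N1" "0 < N2"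
    using K1 operator_const_pos[OF p, where 'n = 'n and 'd = 'd] operator_const_pos[OF q, where 'n = 'n and 'd = 'd]
    by (auto simp: N1_def N2_def)
  have sets: "\<And>Q. Q \<in> all_grids \<Longrightarrow> Q \<in> sets (lebesgue :: (real^'n) measure)"
    using all_grids_finite_measure by blast
  have le_op: "ennreal (real CARD('n \<Rightarrow> bool) * maximal_const r (real CARD('d)) * (2 * K) powr (p + q)) * c
      \<le> ennreal (operator_const r TYPE('n) TYPE('d) * (2 * K) powr (p + q)) * c" for r c
    unfolding operator_const_def by (intro mult_right_mono ennreal_leI) auto
  have bound2: "(\<integral>\<^sup>+x. ennreal_powr (maximal all_grids f x) p \<partial>lebesgue) \<le> ennreal N2 * (\<integral>\<^sup>+x. ennreal_powr (f x) p \<partial>lebesgue)"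
    if "f \<in> borel_measurable lebesgue" for f
    using all_grids_maximal_bound[OF p K1 bb(1) that] le_op[of p] unfolding N2_def q_def[symmetric]
    by (rule order_trans)
  have bound1: "(\<integral>\<^sup>+x. ennreal_powr (swap.maximal all_grids f x) q \<partial>lebesgue) \<le> ennreal N1 * (\<integral>\<^sup>+x. ennreal_powr (f x) q \<partial>lebesgue)"
    if "f \<in> borel_measurable lebesgue" for f
    using swap.all_grids_maximal_bound[OF q K1 bb(2) that] le_op[of q] unfolding N1_def qq add.commute[of q p]
    by (rule order_trans)
  obtain F :: "real^'n \<Rightarrow> ennreal" where F [measurable]: "F \<in> borel_measurable lebesgue" and F0: "\<And>x. 0 < F x"
    and F_fin: "AE x in lebesgue. F x < top"
    and T1: "\<And>x. swap.maximal all_grids (\<lambda>y. ennreal_powr (F y) (1/q)) x \<le> ennreal ((4 * N1) powr (1/q)) * ennreal_powr (F x) (1/q)"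
    and T2: "\<And>x. maximal all_grids (\<lambda>y. ennreal_powr (F y) (1/p)) x \<le> ennreal ((4 * N2) powr (1/p)) * ennreal_powr (F x) (1/p)"
  proof -
    have "\<exists>F. F \<in> borel_measurable lebesgue \<and> (\<forall>x\<in>space lebesgue. 0 < F x) \<and> (AE x in lebesgue. F x < top)
      \<and> (\<forall>x. swap.maximal all_grids (\<lambda>y. ennreal_powr (F y) (1/q)) x \<le> ennreal ((4 * N1) powr (1/q)) * ennreal_powr (F x) (1/q))
      \<and> (\<forall>x. maximal all_grids (\<lambda>y. ennreal_powr (F y) (1/p)) x \<le> ennreal ((4 * N2) powr (1/p)) * ennreal_powr (F x) (1/p))"
      by (rule simultaneous_Rubio_de_Francia[OF sigma_finite_lebesgue p q N])
        (intro measurable_maximal swap.measurable_maximal countable_all_grids sets maximal_mono swap.maximal_mono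
          maximal_SUP swap.maximal_SUP bound1 bound2; assumption)+
    then show ?thesis using that by auto
  qed
  \<comment> \<open>The value 1 on the null set where \<open>F\<close> is infinite keeps \<phi> real
    and positive everywhere.\<close>
  define \<phi> where "\<phi> x = (if F x = top then 1 else enn2real (F x))" for x
  have \<phi>0: "0 < \<phi> x" for x
    using F0[of x] by (auto simp: \<phi>_def enn2real_positive_iff less_top)
  have F\<phi>: "AE x in lebesgue. F x = ennreal (\<phi> x)"
    using F_fin by eventually_elim (auto simp: \<phi>_def)
  have root: "(4 * (c * (2 * K) powr (p + q))) powr (1 / r) = (4 * c) powr (1 / r) * 2 powr ((p + q) / r) * K powr ((p + q) / r)"
    if "0 < c" for c r
    using that K by (simp add: powr_mult powr_powr)
  have C2: "6 ^ CARD('n) * (4 * N2) powr (1 / p) = factor_const p TYPE('n) TYPE('d) * K powr q"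
    unfolding N2_def root[OF operator_const_pos[OF p]] pq by (simp add: factor_const_def q_def)
  have C1: "6 ^ CARD('n) * (4 * N1) powr (1 / q) = factor_const q TYPE('n) TYPE('d) * K powr p"
    unfolding N1_def root[OF operator_const_pos[OF q]] pq by (simp add: factor_const_def qq)
  show ?thesis
  proof (intro exI[of _ \<phi>] conjI allI ballI)
    show "\<phi> \<in> borel_measurable lebesgue" unfolding \<phi>_def by measurable
    show "0 < \<phi> x" for x by (rule \<phi>0)
    fix Q :: "(real^'n) set" assume Q: "Q \<in> cubes"
    show "subinvariant_on A B (\<lambda>x. \<phi> x powr (1 / p)) (factor_const p TYPE('n) TYPE('d) * K powr q) Q"
      using weighted_average_le[OF F\<phi> \<phi>0 _ T2 Q] unfolding C2 by simp
    show "subinvariant_on B A (\<lambda>x. \<phi> x powr (1 / q)) (factor_const q TYPE('n) TYPE('d) * K powr p) Q"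
      using swap.weighted_average_le[OF F\<phi> \<phi>0 _ T1 Q] unfolding C1 by simp
  qed
qed

end

section \<open>Reduction to everywhere invertible weights, and the factorization\<close>

lemma pos_def_modification:
  fixes W :: "real^'n \<Rightarrow> real^'d^'d"
  assumes "matrix_weight W"
  obtains V where "V \<in> borel_measurable lebesgue" "\<And>x. pos_def (V x)" "AE x in lebesgue. V x = W x"
proof
  \<comment> \<open>The identity replaces \<open>W\<close> on the exceptional null set, so that
    inverses exist everywhere, as the locale requires. The set where \<open>W\<close> is positive
    definite is measurable because Lebesgue measure is complete.\<close>
  let ?V = "\<lambda>x. if pos_def (W x) then W x else mat 1"
  have AE: "AE x in lebesgue. pos_def (W x)" and W: "W \<in> borel_measurable lebesgue" using assms by (auto simp: matrix_weight_def)
  then have "{x. \<not> pos_def (W x)} \<in> null_sets lebesgue"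
    by (simp add: completion.AE_iff_null_sets)
  then have "{x. \<not> pos_def (W x)} \<in> sets lebesgue" by (rule null_setsD2)
  then have "space lebesgue - {x. \<not> pos_def (W x)} \<in> sets lebesgue" by (rule sets.compl_sets)
  moreover have "space lebesgue - {x. \<not> pos_def (W x)} = {x \<in> space lebesgue. pos_def (W x)}" by auto
  ultimately have "{x \<in> space lebesgue. pos_def (W x)} \<in> sets lebesgue" by simp
  then show "?V \<in> borel_measurable lebesgue" using W by (intro measurable_If) auto
  show "pos_def (?V x)" for x by (simp add: pos_def_mat_1)
  show "AE x in lebesgue. ?V x = W x" using AE by eventually_elim simp
qed

lemma Ap_const_cube_bound:
  fixes W V :: "real^'n \<Rightarrow> real^'d^'d"
  assumes p: "1 < p" and fin: "Ap_const p W = ennreal K" and K: "0 \<le> K" and V: "AE x in lebesgue. V x = W x" and Q: "Q \<in> cubes"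
  shows "Ap_on V (\<lambda>y. matrix_inv (V y)) p (conj_exponent p) K Q"
proof -
  let ?q = "conj_exponent p"
  let ?I = "\<lambda>W x. average Q (\<lambda>y. ennreal (op_norm (W x ** matrix_inv (W y)) powr ?q))"
  let ?J = "\<lambda>W x. ennreal_powr (?I W x) (p / ?q)"
  have "ennreal_powr (average Q (?J W)) (1 / p) \<le> ennreal K"
    unfolding fin[symmetric] Ap_const_def by (rule SUP_upper[OF Q])
  then have "ennreal_powr (ennreal_powr (average Q (?J W)) (1 / p)) p \<le> ennreal_powr (ennreal K) p"
    using p by (intro ennreal_powr_mono) auto
  then have le: "average Q (?J W) \<le> ennreal (K powr p)"
    using p K by (simp add: ennreal_powr_powr)
  have inner: "?I V x = ?I W x" if "V x = W x" for x
    unfolding average_def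
  proof (intro arg_cong2[where f = "(/)"] nn_integral_cong_AE refl)
    show "AE y in lebesgue. ennreal (op_norm (V x ** matrix_inv (V y)) powr ?q) * indicator Q y
       = ennreal (op_norm (W x ** matrix_inv (W y)) powr ?q) * indicator Q y"
      using V by eventually_elim (simp add: that)
  qed
  have "(\<integral>\<^sup>+x\<in>Q. ?J V x \<partial>lebesgue) = (\<integral>\<^sup>+x\<in>Q. ?J W x \<partial>lebesgue)"
  proof (rule nn_integral_cong_AE)
    show "AE x in lebesgue. ?J V x * indicator Q x = ?J W x * indicator Q x"
      using V
    proof eventually_elim
      case (elim x)
      show ?case unfolding inner[OF elim] ..
    qed
  qed
  also have "\<dots> = average Q (?J W) * vol Q"
  proof -
    obtain a l where al: "Q = cbox a (\<chi> i. a $ i + l)" "0 < l" using Q by (auto simp: cubes_def)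
    have "vol Q = ennreal (l ^ CARD('n))" using content_cube al by simp
    then show ?thesis using al(2) by (intro average_times_emeasure[symmetric]) (simp_all del: emeasure_completion)
  qed
  also have "\<dots> \<le> ennreal (K powr p) * vol Q" by (intro mult_right_mono le) simp
  finally show ?thesis .
qed

theorem proposition8p2:
  fixes p :: real
  assumes "1 < p"
  shows "\<exists>c::real. 0 < c \<and>
    (\<forall>W :: real^'n \<Rightarrow> real^'d^'d. W \<in> Ap_class p \<longrightarrow>
      (\<exists>W0 W1 :: real^'n \<Rightarrow> real^'d^'d.
         W0 \<in> A1_class \<and> A1_const W0 \<le> ennreal c * ennreal_powr (Ap_const p W) p
       \<and> W1 \<in> Ainf_class
       \<and> Ainf_const W1 \<le> ennreal c * ennreal_powr (Ap_const p W) (conj_exponent p)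
       \<and> (\<exists>r s :: real^'n \<Rightarrow> real.
            r \<in> borel_measurable lebesgue \<and> s \<in> borel_measurable lebesgue
          \<and> (AE x in lebesgue. W0 x = r x *\<^sub>R W x)
          \<and> (AE x in lebesgue. W1 x = s x *\<^sub>R W x))
       \<and> (AE x in lebesgue.
            W x = matrix_powr (W0 x) (1 / p) ** matrix_powr (W1 x) (1 / conj_exponent p))))"
    (is "\<exists>c. _ \<and> (\<forall>W. _ \<longrightarrow> ?factorization c W)")
proof -
  define q where "q = conj_exponent p"
  have q: "1 < q" using conj_exponent_gt_1[OF assms] by (simp add: q_def)
  define cp cq where "cp = factor_const p TYPE('n) TYPE('d)" and "cq = factor_const q TYPE('n) TYPE('d)"
  have cpq: "0 < cp" "0 < cq" using factor_const_pos assms q by (auto simp: cp_def cq_def)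
  show ?thesis
  \<comment> \<open>The constant is fixed before \<open>W\<close> is introduced; both
    \<open>cp\<close> and \<open>cq\<close> depend only on p and the two dimensions.\<close>
  proof (intro exI[of _ "max cp cq"] conjI allI impI)
    show "0 < max cp cq" using cpq by simp
    fix W :: "real^'n \<Rightarrow> real^'d^'d" assume W: "W \<in> Ap_class p"
    then have mw: "matrix_weight W" and "Ap_const p W \<noteq> top" by (auto simp: Ap_class_def)
    then obtain K where K: "Ap_const p W = ennreal K" "0 \<le> K" by (cases "Ap_const p W") auto
    obtain V where V [measurable]: "V \<in> borel_measurable lebesgue" and V_pos: "\<And>x. pos_def (V x)" and VW: "AE x in lebesgue. V x = W x"
      using pos_def_modification[OF mw] by blast
    define B where "B x = matrix_inv (V x)" for x
    have VB: "V x ** B x = mat 1" for x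
      unfolding B_def by (intro det_nonzero_matrix_inv pos_def_det_nonzero V_pos)
    have V_sym: "transpose (V x) = V x" for x using V_pos[of x] by (simp add: pos_def_def)
    have B_meas: "B \<in> borel_measurable lebesgue"
      unfolding B_def[abs_def] by (intro measurable_matrix_inv V pos_def_det_nonzero V_pos)
    have B_sym: "transpose (B x) = B x" for x
    proof -
      have "transpose (B x) ** V x = mat 1"
        using VB[of x] V_sym[of x] by (metis matrix_transpose_mul transpose_mat)
      then have "V x ** transpose (B x) = mat 1" using matrix_left_right_inverse by blast
      then show ?thesis unfolding B_def using matrix_inv_eq by metis
    qed
    interpret dual_matrix_functions V B
      by unfold_locales (use V B_meas V_sym B_sym VB in auto)
    interpret swap: dual_matrix_functions B V by (rule dual_swap)
    have Ap: "Ap_on V B p q K Q" if "Q \<in> cubes" for Q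
      unfolding B_def q_def by (rule Ap_const_cube_bound[OF assms K VW that])
    obtain \<phi> :: "real^'n \<Rightarrow> real" where \<phi> [measurable]: "\<phi> \<in> borel_measurable lebesgue" and \<phi>0: "\<And>x. 0 < \<phi> x"
      and est_p: "\<And>Q. Q \<in> cubes \<Longrightarrow> subinvariant_on V B (\<lambda>x. \<phi> x powr (1 / p)) (cp * K powr q) Q"
      and est_q: "\<And>Q. Q \<in> cubes \<Longrightarrow> subinvariant_on B V (\<lambda>x. \<phi> x powr (1 / q)) (cq * K powr p) Q"
      using scalar_factor_exists[OF assms q_def K(2) Ap] unfolding cp_def cq_def by blast
    define r s where "r x = \<phi> x powr (1 / q)" and "s x = 1 / \<phi> x powr (1 / p)" for x
    have rs: "0 < r x" "0 < s x" for x using \<phi>0[of x] by (auto simp: r_def s_def)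
    have r_meas [measurable]: "r \<in> borel_measurable lebesgue" and s_meas [measurable]: "s \<in> borel_measurable lebesgue"
      unfolding r_def[abs_def] s_def[abs_def] by measurable
    define W0 W1 where "W0 x = r x *\<^sub>R V x" and "W1 x = s x *\<^sub>R V x" for x
    have inv0: "matrix_inv (W0 x) = (1 / r x) *\<^sub>R B x" for x
      using rs[of x] VB[of x] by (intro matrix_inv_eq) (simp add: W0_def matrix_scalar_ac scalar_matrix_assoc[symmetric])
    have inv1: "matrix_inv (W1 x) = \<phi> x powr (1 / p) *\<^sub>R B x" for x
      using rs[of x] VB[of x] \<phi>0[of x] by (intro matrix_inv_eq) (simp add: W1_def s_def matrix_scalar_ac scalar_matrix_assoc[symmetric])
    have mw01: "matrix_weight (\<lambda>x. g x *\<^sub>R V x)" if "g \<in> borel_measurable lebesgue" "\<And>x. 0 < g x" for g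
      unfolding matrix_weight_def using that V V_pos
      by (auto intro!: borel_measurable_scaleR pos_def_imp_pos_semidef pos_def_scaleR)
    have c0: "A1_const W0 \<le> ennreal (cq * K powr p)"
      unfolding A1_const_def inv0 unfolding W0_def r_def
      by (rule SUP_least, rule swap.esssup_weighted_le) (use \<phi>0 est_q in \<open>auto simp: less_imp_neq[OF \<phi>0, symmetric]\<close>)
    have c1: "Ainf_const W1 \<le> ennreal (cp * K powr q)"
      unfolding Ainf_const_def inv1 unfolding W1_def s_def
      by (rule SUP_least, rule esssup_weighted_le) (use \<phi>0 est_p in \<open>auto simp: less_imp_neq[OF \<phi>0, symmetric]\<close>)
    have c0': "A1_const W0 \<le> ennreal (max cp cq) * ennreal_powr (Ap_const p W) p"
    proof -
      have "ennreal (cq * K powr p) \<le> ennreal (max cp cq * K powr p)" by (intro ennreal_leI mult_right_mono) auto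
      then show ?thesis using c0 cpq K by (simp add: ennreal_mult)
    qed
    have c1': "Ainf_const W1 \<le> ennreal (max cp cq) * ennreal_powr (Ap_const p W) (conj_exponent p)"
    proof -
      have "ennreal (cp * K powr q) \<le> ennreal (max cp cq * K powr q)" by (intro ennreal_leI mult_right_mono) auto
      then show ?thesis using c1 cpq K by (simp add: ennreal_mult q_def)
    qed
    have W0: "W0 \<in> A1_class"
      using c0 mw01[OF r_meas rs(1)] by (auto simp: A1_class_def W0_def[abs_def] intro: le_less_trans)
    have W1: "W1 \<in> Ainf_class"
      using c1 mw01[OF s_meas rs(2)] by (auto simp: Ainf_class_def W1_def[abs_def] intro: le_less_trans)
    have prod: "matrix_powr (W0 x) (1 / p) ** matrix_powr (W1 x) (1 / conj_exponent p) = V x" for x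
      unfolding W0_def W1_def
    proof (rule matrix_powr_mult_scaled[OF V_pos assms rs])
      \<comment> \<open>The two exponents of \<phi> are 1/(pq) and -1/(pq).\<close>
      show "r x powr (1 / p) * s x powr (1 / conj_exponent p) = 1"
        using \<phi>0[of x] by (simp add: r_def s_def q_def powr_powr powr_divide mult.commute)
    qed
    show "?factorization (max cp cq) W"
    proof (rule exI[of _ W0], rule exI[of _ W1], intro conjI W0 W1 c0' c1')
      show "\<exists>r s :: real^'n \<Rightarrow> real. r \<in> borel_measurable lebesgue \<and> s \<in> borel_measurable lebesgue
          \<and> (AE x in lebesgue. W0 x = r x *\<^sub>R W x) \<and> (AE x in lebesgue. W1 x = s x *\<^sub>R W x)"
      proof (rule exI[of _ r], rule exI[of _ s], intro conjI r_meas s_meas)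
        show "AE x in lebesgue. W0 x = r x *\<^sub>R W x" "AE x in lebesgue. W1 x = s x *\<^sub>R W x"
          using VW by (eventually_elim, simp add: W0_def W1_def)+
      qed
      show "AE x in lebesgue. W x = matrix_powr (W0 x) (1 / p) ** matrix_powr (W1 x) (1 / conj_exponent p)"
        using VW by eventually_elim (simp add: prod)
    qed
  qed
qed

end
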